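(* Let $(N,g)$ be a Riemannian manifold of dimension $p+n$, $M\subset N$ a $p$-dimensional submanifold, and $O(M,N)$ the bundle of orthonormal frames of $N$ adapted to $M$, with connection $\omega'$. For $X\in T_xM$ and $u\in O(M,N)$ over $x$, the $\omega'$-horizontal lift $X^{h'}_u$ of $X$ to $O(M,N)$ equals $$X^{h'}_u=X^h_u+(\overline{S_X})_u=X^h_u+\sum_{A=1}^{p}\Pi(X,u_A)^{v,A}_u-\sum_{\alpha=p+1}^{p+n}A_{u_\alpha}(X)^{v,\alpha}_u,$$ where $X^h_u$ denotes the horizontal lift of $X$ to $O(N)|M$ with respect to the Levi-Civita connection of $N$.
   Context: $O(N)$ is the bundle of orthonormal frames of $N$, $O(N)|M$ its restriction to $M$; a frame $u=(u_1,\dots,u_{p+n})$ at $x$ is identified with a linear isomorphism $\mathbb{R}^{p+n}\to T_xN$. $O(M,N)$ consists of the $u\in O(N)$ over points $x\in M$ with $u_1,\dots,u_p\in T_xM$. Let $\nabla$ be the Levi-Civita connection of $g$ with connection form $\omega$ on $O(N)$, with values in $o(p+n)$. The $o(p)\oplus o(n)$-component (block diagonal part) $\omega'$ of $\omega$ restricted to $O(M,N)$ is a connection form on $O(M,N)$; it induces on $TN|M$ the connection $\nabla'_XY=(\nabla_XY^\top)^\top+(\nabla_XY^\bot)^\bot$, where $\top,\bot$ are the components tangent and orthogonal to $M$. The tensor $S=\nabla-\nabla'$ is $S_XY=(\nabla_XY^\top)^\bot+(\nabla_XY^\bot)^\top=\Pi(X,Y^\top)-A_{Y^\bot}(X)$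 for $X\in TM$, $Y\in TN|M$, where $\Pi$ is the second fundamental form of $M$ and $A_V(X)=-(\nabla_XV)^\top$ is the Weingarten operator for a normal field $V$. $A^*$ is the fundamental vertical vector field of a matrix $A$, $E^j_i$ is the matrix with $1$ in row $j$, column $i$ and zeros elsewhere. For $Y=\sum_j\xi^ju_j$ put $Y^{v,i}_u=\sum_j\xi^j(E^j_i)^*_u$ (a vertical vector of the linear frame bundle $L(N)$ at $u$), and for an endomorphism $T$ of $T_xN$ put $\bar T_u=\sum_iT(u_i)^{v,i}_u$. *)

theory Defs
  imports "HOL-Analysis.Analysis" "HOL-Library.Function_Algebras"
begin

section \<open>Smooth maps between Euclidean spaces\<close>

fun Ck_on :: "nat \<Rightarrow> 'a::real_normed_vector set \<Rightarrow> ('a \<Rightarrow> 'b::real_normed_vector) \<Rightarrow> bool" where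
  "Ck_on 0 S f \<longleftrightarrow> continuous_on S f"
| "Ck_on (Suc k) S f \<longleftrightarrow>
     (\<forall>x\<in>S. f differentiable (at x)) \<and> (\<forall>v. Ck_on k S (\<lambda>x. frechet_derivative f (at x) v))"

text \<open>Intended for open subsets of finite-dimensional spaces.\<close>

definition smooth_on :: "'a::real_normed_vector set \<Rightarrow> ('a \<Rightarrow> 'b::real_normed_vector) \<Rightarrow> bool" where
  "smooth_on S f \<longleftrightarrow> (\<forall>k. Ck_on k S f)"

section \<open>Manifolds given by an atlas\<close>

text \<open>A chart is a pair of its domain and its coordinate map; only the values of the map on the
  domain matter. The manifold is the union of the domains, with the topology in which \<open>W\<close> is open
  iff all its chart images are open.\<close>

type_synonym ('a, 'e) chart = "'a set \<times> ('a \<Rightarrow> 'e)"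

definition carrier_of :: "('a, 'e) chart set \<Rightarrow> 'a set" where
  "carrier_of \<A> = (\<Union>(U, \<phi>)\<in>\<A>. U)"

definition smooth_atlas :: "('a, 'e::euclidean_space) chart set \<Rightarrow> bool" where
  "smooth_atlas \<A> \<longleftrightarrow>
     (\<forall>(U, \<phi>)\<in>\<A>. inj_on \<phi> U \<and> open (\<phi> ` U)) \<and>
     (\<forall>(U, \<phi>)\<in>\<A>. \<forall>(V, \<psi>)\<in>\<A>.
        open (\<phi> ` (U \<inter> V)) \<and> smooth_on (\<phi> ` (U \<inter> V)) (\<psi> \<circ> inv_into U \<phi>))"

definition open_in :: "('a, 'e::euclidean_space) chart set \<Rightarrow> 'a set \<Rightarrow> bool" where
  "open_in \<A> W \<longleftrightarrow> W \<subseteq> carrier_of \<A> \<and> (\<forall>(U, \<phi>)\<in>\<A>. open (\<phi> ` (W \<inter> U)))"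

definition smooth_manifold :: "('a, 'e::euclidean_space) chart set \<Rightarrow> bool" where
  "smooth_manifold \<A> \<longleftrightarrow>
     smooth_atlas \<A> \<and> Hausdorff_space (topology (open_in \<A>)) \<and>
     second_countable (topology (open_in \<A>))"

definition smooth_fun :: "('a, 'e::euclidean_space) chart set \<Rightarrow> 'a set \<Rightarrow> ('a \<Rightarrow> real) \<Rightarrow> bool" where
  "smooth_fun \<A> W f \<longleftrightarrow> (\<forall>(U, \<phi>)\<in>\<A>. smooth_on (\<phi> ` (W \<inter> U)) (f \<circ> inv_into U \<phi>))"

definition smooth_near :: "('a, 'e::euclidean_space) chart set \<Rightarrow> 'a \<Rightarrow> ('a \<Rightarrow> real) \<Rightarrow> bool" where
  "smooth_near \<A> x f \<longleftrightarrow> (\<exists>W. open_in \<A> W \<and> x \<in> W \<and> smooth_fun \<A> W f)"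

text \<open>Smooth functions on an arbitrary subset \<open>Q\<close> are those that extend smoothly near each point of
  \<open>Q\<close>; for embedded submanifolds this is the usual notion.\<close>

definition smooth_fun_on_subset ::
    "('a, 'e::euclidean_space) chart set \<Rightarrow> 'a set \<Rightarrow> ('a \<Rightarrow> real) \<Rightarrow> bool" where
  "smooth_fun_on_subset \<A> Q f \<longleftrightarrow>
     (\<forall>q\<in>Q. \<exists>W F. open_in \<A> W \<and> q \<in> W \<and> smooth_fun \<A> W F \<and> (\<forall>y\<in>W \<inter> Q. F y = f y))"

definition smooth_curve :: "('a, 'e::euclidean_space) chart set \<Rightarrow> real set \<Rightarrow> (real \<Rightarrow> 'a) \<Rightarrow> bool" where
  "smooth_curve \<A> T c \<longleftrightarrow>
     c ` T \<subseteq> carrier_of \<A> \<and>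
     (\<forall>(U, \<phi>)\<in>\<A>. open (T \<inter> c -` U) \<and> smooth_on (T \<inter> c -` U) (\<phi> \<circ> c))"

section \<open>Tangent vectors and vector fields\<close>

text \<open>Tangent vectors at \<open>x\<close> act on the real functions that are smooth near \<open>x\<close> and are normalised
  to be \<open>0\<close> on all other functions, so that they are determined by their action. They are added
  pointwise.\<close>

type_synonym 'a tvec = "('a \<Rightarrow> real) \<Rightarrow> real"

definition tscale :: "real \<Rightarrow> 'a tvec \<Rightarrow> 'a tvec"  (infixr "*\<^sub>t" 75) where
  "a *\<^sub>t v = (\<lambda>f. a * v f)"

definition velocity :: "('a, 'e::euclidean_space) chart set \<Rightarrow> (real \<Rightarrow> 'a) \<Rightarrow> 'a tvec" where
  "velocity \<A> c = (\<lambda>f. if smooth_near \<A> (c 0) f then deriv (f \<circ> c) 0 else 0)"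

text \<open>The tangent space at \<open>x\<close> of an embedded submanifold \<open>Q\<close>, as a subspace of the tangent space
  of the ambient manifold.\<close>

definition tangent_in :: "('a, 'e::euclidean_space) chart set \<Rightarrow> 'a set \<Rightarrow> 'a \<Rightarrow> 'a tvec set" where
  "tangent_in \<A> Q x =
     {velocity \<A> c | c \<epsilon>. \<epsilon> > 0 \<and> smooth_curve \<A> {-\<epsilon><..<\<epsilon>} c \<and> c 0 = x \<and> c ` {-\<epsilon><..<\<epsilon>} \<subseteq> Q}"

abbreviation tangent_space :: "('a, 'e::euclidean_space) chart set \<Rightarrow> 'a \<Rightarrow> 'a tvec set" where
  "tangent_space \<A> \<equiv> tangent_in \<A> (carrier_of \<A>)"

text \<open>The differential at \<open>x\<close> of a map \<open>F\<close> into the manifold with atlas \<open>\<B>\<close>.\<close>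

definition differential ::
    "('b, 'e::euclidean_space) chart set \<Rightarrow> ('a \<Rightarrow> 'b) \<Rightarrow> 'a \<Rightarrow> 'a tvec \<Rightarrow> 'b tvec" where
  "differential \<B> F x v = (\<lambda>f. if smooth_near \<B> (F x) f then v (f \<circ> F) else 0)"

definition smooth_vf :: "('a, 'e::euclidean_space) chart set \<Rightarrow> 'a set \<Rightarrow> ('a \<Rightarrow> 'a tvec) \<Rightarrow> bool" where
  "smooth_vf \<A> W Y \<longleftrightarrow>
     open_in \<A> W \<and> (\<forall>y\<in>W. Y y \<in> tangent_space \<A> y) \<and>
     (\<forall>W' f. open_in \<A> W' \<and> W' \<subseteq> W \<and> smooth_fun \<A> W' f \<longrightarrow> smooth_fun \<A> W' (\<lambda>y. Y y f))"

definition smooth_vf_near :: "('a, 'e::euclidean_space) chart set \<Rightarrow> 'a \<Rightarrow> ('a \<Rightarrow> 'a tvec) \<Rightarrow> bool" where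
  "smooth_vf_near \<A> x Y \<longleftrightarrow> (\<exists>W. x \<in> W \<and> smooth_vf \<A> W Y)"

definition lie_bracket ::
    "('a, 'e::euclidean_space) chart set \<Rightarrow> ('a \<Rightarrow> 'a tvec) \<Rightarrow> ('a \<Rightarrow> 'a tvec) \<Rightarrow> 'a \<Rightarrow> 'a tvec" where
  "lie_bracket \<A> X Y x =
     (\<lambda>f. if smooth_near \<A> x f then X x (\<lambda>y. Y y f) - Y x (\<lambda>y. X y f) else 0)"

section \<open>Riemannian metrics and the Levi-Civita connection\<close>

type_synonym 'a metric = "'a \<Rightarrow> 'a tvec \<Rightarrow> 'a tvec \<Rightarrow> real"

definition riemannian_metric :: "('a, 'e::euclidean_space) chart set \<Rightarrow> 'a metric \<Rightarrow> bool" where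
  "riemannian_metric \<A> g \<longleftrightarrow>
     (\<forall>x\<in>carrier_of \<A>. \<forall>v\<in>tangent_space \<A> x. \<forall>w\<in>tangent_space \<A> x.
        g x v w = g x w v \<and> (v \<noteq> 0 \<longrightarrow> g x v v > 0) \<and>
        (\<forall>a. g x (a *\<^sub>t v) w = a * g x v w) \<and>
        (\<forall>v'\<in>tangent_space \<A> x. g x (v + v') w = g x v w + g x v' w)) \<and>
     (\<forall>W Y Z. smooth_vf \<A> W Y \<and> smooth_vf \<A> W Z \<longrightarrow> smooth_fun \<A> W (\<lambda>y. g y (Y y) (Z y)))"

text \<open>A covariant derivative assigns to a point \<open>x\<close>, a tangent vector at \<open>x\<close> and a vector field that
  is defined and smooth near \<open>x\<close> a tangent vector at \<open>x\<close>. That it depends only on the germ of the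
  field follows from the Leibniz rule, applied to functions that are locally constant near \<open>x\<close>.\<close>

type_synonym 'a cov = "'a \<Rightarrow> 'a tvec \<Rightarrow> ('a \<Rightarrow> 'a tvec) \<Rightarrow> 'a tvec"

definition covariant_derivative :: "('a, 'e::euclidean_space) chart set \<Rightarrow> 'a cov \<Rightarrow> bool" where
  "covariant_derivative \<A> nabla \<longleftrightarrow>
     (\<forall>x\<in>carrier_of \<A>. \<forall>X\<in>tangent_space \<A> x. \<forall>Y. smooth_vf_near \<A> x Y \<longrightarrow>
        nabla x X Y \<in> tangent_space \<A> x \<and>
        (\<forall>X'\<in>tangent_space \<A> x. nabla x (X + X') Y = nabla x X Y + nabla x X' Y) \<and>
        (\<forall>a. nabla x (a *\<^sub>t X) Y = a *\<^sub>t nabla x X Y) \<and>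
        (\<forall>Z. smooth_vf_near \<A> x Z \<longrightarrow> nabla x X (\<lambda>y. Y y + Z y) = nabla x X Y + nabla x X Z) \<and>
        (\<forall>f. smooth_near \<A> x f \<longrightarrow>
           nabla x X (\<lambda>y. f y *\<^sub>t Y y) = f x *\<^sub>t nabla x X Y + X f *\<^sub>t Y x)) \<and>
     (\<forall>W X Y. smooth_vf \<A> W X \<and> smooth_vf \<A> W Y \<longrightarrow> smooth_vf \<A> W (\<lambda>y. nabla y (X y) Y))"

definition levi_civita :: "('a, 'e::euclidean_space) chart set \<Rightarrow> 'a metric \<Rightarrow> 'a cov \<Rightarrow> bool" where
  "levi_civita \<A> g nabla \<longleftrightarrow>
     covariant_derivative \<A> nabla \<and>
     (\<forall>x\<in>carrier_of \<A>. \<forall>X\<in>tangent_space \<A> x. \<forall>Y Z.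
        smooth_vf_near \<A> x Y \<and> smooth_vf_near \<A> x Z \<longrightarrow>
        X (\<lambda>y. g y (Y y) (Z y)) = g x (nabla x X Y) (Z x) + g x (Y x) (nabla x X Z)) \<and>
     (\<forall>x\<in>carrier_of \<A>. \<forall>X Y. smooth_vf_near \<A> x X \<and> smooth_vf_near \<A> x Y \<longrightarrow>
        nabla x (X x) Y - nabla x (Y x) X = lie_bracket \<A> X Y x)"

section \<open>The frame bundle\<close>

text \<open>The \<open>CARD('m)\<close>-dimensional manifold is modelled on \<open>real ^ 'm\<close> and \<open>'m\<close> also indexes the
  vectors of a frame. A frame \<open>u\<close> is identified with the isomorphism \<open>frame_map u\<close>.\<close>

type_synonym ('a, 'm) fpoint = "'a \<times> ('m \<Rightarrow> 'a tvec)"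

definition frame_map :: "('m::finite \<Rightarrow> 'a tvec) \<Rightarrow> real ^ 'm \<Rightarrow> 'a tvec" where
  "frame_map u \<xi> = (\<Sum>j\<in>UNIV. (\<xi> $ j) *\<^sub>t u j)"

definition linear_frames :: "('a, real ^ 'm::finite) chart set \<Rightarrow> ('a, 'm) fpoint set" where
  "linear_frames \<A> = {(x, u). x \<in> carrier_of \<A> \<and> bij_betw (frame_map u) UNIV (tangent_space \<A> x)}"

text \<open>The coordinates induced on the frame bundle by a chart: the component \<open>i\<close> of the vector \<open>u j\<close>
  is the value of \<open>u j\<close> on the coordinate function \<open>i\<close>.\<close>

definition frame_atlas ::
    "('a, real ^ 'm::finite) chart set \<Rightarrow> (('a, 'm) fpoint, (real ^ 'm) \<times> ((real ^ 'm) ^ 'm)) chart set" where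
  "frame_atlas \<A> =
     (\<lambda>(U, \<phi>). ({(x, u) \<in> linear_frames \<A>. x \<in> U},
                \<lambda>(x, u). (\<phi> x, \<chi> j i. u j (\<lambda>y. \<phi> y $ i)))) ` \<A>"

definition orthonormal_frames ::
    "('a, real ^ 'm::finite) chart set \<Rightarrow> 'a metric \<Rightarrow> ('a, 'm) fpoint set" where
  "orthonormal_frames \<A> g =
     {(x, u) \<in> linear_frames \<A>. \<forall>i j. g x (u i) (u j) = (if i = j then 1 else 0)}"

definition orthonormal_frames_over ::
    "('a, real ^ 'm::finite) chart set \<Rightarrow> 'a metric \<Rightarrow> 'a set \<Rightarrow> ('a, 'm) fpoint set" where
  "orthonormal_frames_over \<A> g M = {(x, u) \<in> orthonormal_frames \<A> g. x \<in> M}"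

text \<open>\<open>I\<close> plays the role of the index range \<open>{1..p}\<close>, and \<open>- I\<close> that of \<open>{p+1..p+n}\<close>.\<close>

definition adapted_frames ::
    "('a, real ^ 'm::finite) chart set \<Rightarrow> 'a metric \<Rightarrow> 'a set \<Rightarrow> 'm set \<Rightarrow> ('a, 'm) fpoint set" where
  "adapted_frames \<A> g M I =
     {(x, u) \<in> orthonormal_frames \<A> g. x \<in> M \<and> (\<forall>i\<in>I. u i \<in> tangent_in \<A> M x)}"

text \<open>The right action, \<open>(u a)\<^sub>k = \<Sum>\<^sub>l a\<^sub>l\<^sub>k u\<^sub>l\<close>.\<close>

definition frame_act :: "real ^ 'm ^ 'm \<Rightarrow> ('a, 'm::finite) fpoint \<Rightarrow> ('a, 'm) fpoint" where
  "frame_act a = (\<lambda>(x, u). (x, \<lambda>k. \<Sum>l\<in>UNIV. (a $ l $ k) *\<^sub>t u l))"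

text \<open>The fundamental vertical vector field of \<open>A\<close>: at \<open>q\<close> it is the image of \<open>A\<close> under the
  differential at the identity of the orbit map taking \<open>a\<close> to \<open>q a\<close>.\<close>

definition fundamental ::
    "('a, real ^ 'm::finite) chart set \<Rightarrow> real ^ 'm ^ 'm \<Rightarrow> ('a, 'm) fpoint \<Rightarrow> ('a, 'm) fpoint tvec" where
  "fundamental \<A> A q =
     (\<lambda>f. if smooth_near (frame_atlas \<A>) q f
          then frechet_derivative (\<lambda>a. f (frame_act a q)) (at (mat 1)) A else 0)"

text \<open>\<open>matE j i\<close> has its entry \<open>1\<close> in row \<open>j\<close> and column \<open>i\<close>.\<close>

definition matE :: "'m::finite \<Rightarrow> 'm \<Rightarrow> real ^ 'm ^ 'm" where
  "matE j i = (\<chi> r c. if r = j \<and> c = i then 1 else 0)"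

text \<open>The vertical vector \<open>Y\<^bsup>v,i\<^esup>\<close> at the frame \<open>(x, u)\<close>.\<close>

definition vert ::
    "('a, real ^ 'm::finite) chart set \<Rightarrow> ('a, 'm) fpoint \<Rightarrow> 'm \<Rightarrow> 'a tvec \<Rightarrow> ('a, 'm) fpoint tvec" where
  "vert \<A> q i Y = (\<Sum>j\<in>UNIV. (inv (frame_map (snd q)) Y $ j) *\<^sub>t fundamental \<A> (matE j i) q)"

definition endo_bar ::
    "('a, real ^ 'm::finite) chart set \<Rightarrow> ('a, 'm) fpoint \<Rightarrow> ('a tvec \<Rightarrow> 'a tvec) \<Rightarrow> ('a, 'm) fpoint tvec" where
  "endo_bar \<A> q T = (\<Sum>i\<in>UNIV. vert \<A> q i (T (snd q i)))"

section \<open>Connection forms and horizontal lifts\<close>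

type_synonym ('a, 'm) conn_form = "('a, 'm) fpoint \<Rightarrow> ('a, 'm) fpoint tvec \<Rightarrow> real ^ 'm ^ 'm"

text \<open>Connection forms on the principal \<open>O(p+n)\<close>-bundle of orthonormal frames.\<close>

definition connection_form ::
    "('a, real ^ 'm::finite) chart set \<Rightarrow> 'a metric \<Rightarrow> ('a, 'm) conn_form \<Rightarrow> bool" where
  "connection_form \<A> g \<omega> \<longleftrightarrow>
     (\<forall>q\<in>orthonormal_frames \<A> g.
        (\<forall>Z\<in>tangent_in (frame_atlas \<A>) (orthonormal_frames \<A> g) q.
           transpose (\<omega> q Z) = - \<omega> q Z \<and>
           (\<forall>a. \<omega> q (a *\<^sub>t Z) = a *\<^sub>R \<omega> q Z) \<and>
           (\<forall>Z'\<in>tangent_in (frame_atlas \<A>) (orthonormal_frames \<A> g) q.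
              \<omega> q (Z + Z') = \<omega> q Z + \<omega> q Z') \<and>
           (\<forall>a. orthogonal_matrix a \<longrightarrow>
              \<omega> (frame_act a q) (differential (frame_atlas \<A>) (frame_act a) q Z)
              = matrix_inv a ** \<omega> q Z ** a)) \<and>
        (\<forall>A. transpose A = - A \<longrightarrow> \<omega> q (fundamental \<A> A q) = A)) \<and>
     (\<forall>W Z i j. smooth_vf (frame_atlas \<A>) W Z \<and>
        (\<forall>q\<in>W \<inter> orthonormal_frames \<A> g.
           Z q \<in> tangent_in (frame_atlas \<A>) (orthonormal_frames \<A> g) q) \<longrightarrow>
        smooth_fun_on_subset (frame_atlas \<A>) (W \<inter> orthonormal_frames \<A> g) (\<lambda>q. \<omega> q (Z q) $ i $ j))"

text \<open>\<open>\<omega>\<close> is the connection form of \<open>nabla\<close>: its pull-back by a local orthonormal frame field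
  \<open>\<sigma>\<close> satisfies \<open>\<nabla>\<^sub>X \<sigma>\<^sub>j = \<Sum>\<^sub>i (\<sigma>\<^sup>* \<omega>)(X)\<^sub>i\<^sub>j \<sigma>\<^sub>i\<close>.\<close>

definition connection_form_of ::
    "('a, real ^ 'm::finite) chart set \<Rightarrow> 'a metric \<Rightarrow> 'a cov \<Rightarrow> ('a, 'm) conn_form \<Rightarrow> bool" where
  "connection_form_of \<A> g nabla \<omega> \<longleftrightarrow>
     connection_form \<A> g \<omega> \<and>
     (\<forall>W \<sigma>. (\<forall>j. smooth_vf \<A> W (\<sigma> j)) \<and> (\<forall>y\<in>W. (y, \<lambda>j. \<sigma> j y) \<in> orthonormal_frames \<A> g) \<longrightarrow>
        (\<forall>x\<in>W. \<forall>X\<in>tangent_space \<A> x. \<forall>j.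
           nabla x X (\<sigma> j) =
           (\<Sum>i\<in>UNIV. (\<omega> (x, \<lambda>k. \<sigma> k x) (differential (frame_atlas \<A>) (\<lambda>y. (y, \<lambda>k. \<sigma> k y)) x X) $ i $ j)
                       *\<^sub>t \<sigma> i x)))"

text \<open>The component of \<open>\<omega>\<close> that is block diagonal with respect to \<open>I\<close> and \<open>- I\<close>.\<close>

definition block_diag_form :: "'m::finite set \<Rightarrow> ('a, 'm) conn_form \<Rightarrow> ('a, 'm) conn_form" where
  "block_diag_form I \<omega> = (\<lambda>q Z. \<chi> i j. if (i \<in> I) = (j \<in> I) then \<omega> q Z $ i $ j else 0)"

text \<open>The lift of \<open>X\<close> to \<open>q\<close> that is tangent to the bundle \<open>Q\<close> of frames and horizontal for \<open>\<omega>\<close>.\<close>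

definition horizontal_lift ::
    "('a, real ^ 'm::finite) chart set \<Rightarrow> ('a, 'm) fpoint set \<Rightarrow> ('a, 'm) conn_form \<Rightarrow>
     ('a, 'm) fpoint \<Rightarrow> 'a tvec \<Rightarrow> ('a, 'm) fpoint tvec" where
  "horizontal_lift \<A> Q \<omega> q X =
     (THE Z. Z \<in> tangent_in (frame_atlas \<A>) Q q \<and> differential \<A> fst q Z = X \<and> \<omega> q Z = 0)"

section \<open>Submanifolds\<close>

text \<open>Embedded submanifolds of dimension \<open>card I\<close>, by slice charts.\<close>

definition submanifold :: "('a, real ^ 'm::finite) chart set \<Rightarrow> 'm set \<Rightarrow> 'a set \<Rightarrow> bool" where
  "submanifold \<A> I M \<longleftrightarrow>
     (\<forall>x\<in>M. \<exists>U \<phi>. x \<in> U \<and> U \<subseteq> carrier_of \<A> \<and> smooth_atlas (insert (U, \<phi>) \<A>) \<and>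
        \<phi> ` (U \<inter> M) = \<phi> ` U \<inter> {y. \<forall>i\<in>- I. y $ i = 0})"

definition tan_part ::
    "('a, 'e::euclidean_space) chart set \<Rightarrow> 'a metric \<Rightarrow> 'a set \<Rightarrow> 'a \<Rightarrow> 'a tvec \<Rightarrow> 'a tvec" where
  "tan_part \<A> g M x v =
     (THE w. w \<in> tangent_in \<A> M x \<and> (\<forall>z\<in>tangent_in \<A> M x. g x (v - w) z = 0))"

definition nor_part ::
    "('a, 'e::euclidean_space) chart set \<Rightarrow> 'a metric \<Rightarrow> 'a set \<Rightarrow> 'a \<Rightarrow> 'a tvec \<Rightarrow> 'a tvec" where
  "nor_part \<A> g M x v = v - tan_part \<A> g M x v"

text \<open>\<open>Y'\<close> is a smooth vector field near \<open>x\<close> that agrees with \<open>Y\<close> on \<open>M\<close>. Smooth sections, over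
  \<open>W \<inter> M\<close>, of the restriction of the tangent bundle to \<open>M\<close> are those with such local extensions.\<close>

definition extends_section ::
    "('a, 'e::euclidean_space) chart set \<Rightarrow> 'a set \<Rightarrow> 'a \<Rightarrow> ('a \<Rightarrow> 'a tvec) \<Rightarrow> ('a \<Rightarrow> 'a tvec) \<Rightarrow> bool" where
  "extends_section \<A> M x Y Y' \<longleftrightarrow>
     (\<exists>W. x \<in> W \<and> smooth_vf \<A> W Y' \<and> (\<forall>y\<in>W \<inter> M. Y' y = Y y))"

definition section_along ::
    "('a, 'e::euclidean_space) chart set \<Rightarrow> 'a set \<Rightarrow> 'a set \<Rightarrow> ('a \<Rightarrow> 'a tvec) \<Rightarrow> bool" where
  "section_along \<A> M W Y \<longleftrightarrow> open_in \<A> W \<and> (\<forall>y\<in>W \<inter> M. \<exists>Y'. extends_section \<A> M y Y Y')"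

text \<open>The connection induced by \<open>nabla\<close> on the restriction of the tangent bundle to \<open>M\<close>: \<open>X\<close> is
  tangent to \<open>M\<close> and \<open>Y\<close> is a section along \<open>M\<close>, differentiated by means of a local extension.\<close>

definition cov_along ::
    "('a, 'e::euclidean_space) chart set \<Rightarrow> 'a cov \<Rightarrow> 'a set \<Rightarrow> 'a cov" where
  "cov_along \<A> nabla M x X Y = (THE V. \<exists>Y'. extends_section \<A> M x Y Y' \<and> V = nabla x X Y')"

definition cov' ::
    "('a, 'e::euclidean_space) chart set \<Rightarrow> 'a metric \<Rightarrow> 'a cov \<Rightarrow> 'a set \<Rightarrow> 'a cov" where
  "cov' \<A> g nabla M x X Y =
     tan_part \<A> g M x (cov_along \<A> nabla M x X (\<lambda>y. tan_part \<A> g M y (Y y))) +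
     nor_part \<A> g M x (cov_along \<A> nabla M x X (\<lambda>y. nor_part \<A> g M y (Y y)))"

text \<open>The tensors below are evaluated on \<open>Y\<close> by extending it to a local section along \<open>M\<close>; the
  values do not depend on the extension.\<close>

definition diff_tensor ::
    "('a, 'e::euclidean_space) chart set \<Rightarrow> 'a metric \<Rightarrow> 'a cov \<Rightarrow> 'a set \<Rightarrow>
     'a \<Rightarrow> 'a tvec \<Rightarrow> 'a tvec \<Rightarrow> 'a tvec" where
  "diff_tensor \<A> g nabla M x X Y =
     (THE V. \<exists>W s. x \<in> W \<and> section_along \<A> M W s \<and> s x = Y \<and>
        V = cov_along \<A> nabla M x X s - cov' \<A> g nabla M x X s)"

definition second_fundamental_form ::
    "('a, 'e::euclidean_space) chart set \<Rightarrow> 'a metric \<Rightarrow> 'a cov \<Rightarrow> 'a set \<Rightarrow>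
     'a \<Rightarrow> 'a tvec \<Rightarrow> 'a tvec \<Rightarrow> 'a tvec" where
  "second_fundamental_form \<A> g nabla M x X Y =
     (THE V. \<exists>W s. x \<in> W \<and> section_along \<A> M W s \<and> (\<forall>y\<in>W \<inter> M. s y \<in> tangent_in \<A> M y) \<and>
        s x = Y \<and> V = nor_part \<A> g M x (cov_along \<A> nabla M x X s))"

text \<open>\<open>weingarten \<A> g nabla M x V X\<close> is \<open>A\<^sub>V(X)\<close>.\<close>

definition weingarten ::
    "('a, 'e::euclidean_space) chart set \<Rightarrow> 'a metric \<Rightarrow> 'a cov \<Rightarrow> 'a set \<Rightarrow>
     'a \<Rightarrow> 'a tvec \<Rightarrow> 'a tvec \<Rightarrow> 'a tvec" where
  "weingarten \<A> g nabla M x V X =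
     (THE V'. \<exists>W s. x \<in> W \<and> section_along \<A> M W s \<and>
        (\<forall>y\<in>W \<inter> M. \<forall>z\<in>tangent_in \<A> M y. g y (s y) z = 0) \<and>
        s x = V \<and> V' = - tan_part \<A> g M x (cov_along \<A> nabla M x X s))"

end

(* Near x choose a smooth orthonormal frame field sigma of N, obtained by Gram-Schmidt from
   coordinate fields of a slice chart, which at points of M is adapted to M and which equals u at x.
   Every curve of frames near u can be written sigma(c(t)) a(t) with orthogonal matrices a(t), so the
   vectors at u tangent to the bundle O(N)|M, respectively O(M,N), are exactly the vectors
   sigma_* Y + C^* with Y tangent to M and C skew-symmetric, respectively also block diagonal.
   With B = omega(sigma_* X), the omega-horizontal lift of X is sigma_* X - B^* and the
   omega'-horizontal lift is sigma_* X - (B')^*, where B' is the block diagonal part of B; they differ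
   by (B - B')^*. As nabla_X sigma_j is the sum of B_ij u_i over i, the off-diagonal columns of B give
   S_X u_j: those with j in I are the second fundamental form, the others minus the Weingarten operator. *)

theory Submission
  imports Defs
begin

section \<open>Calculus of smooth maps\<close>

text \<open>Both lifts are definite descriptions over velocities of curves, so each needs a
  uniqueness proof, and a set of such velocities shows no linear structure by itself. The normal
  form for vectors tangent to the frame bundles settles this: horizontality becomes an affine
  equation for a matrix, with exactly one solution. To realise a prescribed skew-symmetric velocity
  by orthogonal matrices, products of rotations in coordinate planes suffice, and each plane can be
  chosen inside one block. The tensors are definite descriptions too, over all local extensions of a
  section. They are well defined because the velocity of a curve in \<open>M\<close> sees only
  restrictions to \<open>M\<close>, and because the frame is adapted at all points of
  \<open>M\<close> near x, not only at x: passing to tangential or normal parts then merely deletes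
  components, and the derivatives of the components cancel between the two connections. Tangent
  vectors are 0 by convention on functions that are not smooth near the point. Each chain rule
  therefore also has to show that pulling back preserves smoothness.\<close>

lemma Ck_on_SucI:
  assumes "\<And>x. x \<in> S \<Longrightarrow> (f has_derivative f' x) (at x)"
    and "\<And>v. Ck_on k S (\<lambda>x. frechet_derivative f (at x) v)"
  shows "Ck_on (Suc k) S f"
  using assms by (auto simp: differentiable_def)

text \<open>A derivative at a point of an open set depends only on the values in that set. Applied
  to all directional derivatives, this carries the agreement of \<open>f\<close> and
  \<open>h\<close> through the induction.\<close>

lemma Ck_on_cong:
  assumes "open S" "\<And>x. x \<in> S \<Longrightarrow> f x = h x"
  shows "Ck_on k S f \<longleftrightarrow> Ck_on k S h"
  using assms(2)
proof (induction k arbitrary: f h)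
  case 0
  then show ?case by (simp cong: continuous_on_cong)
next
  case (Suc k)
  have eq: "(f has_derivative D) (at x) \<longleftrightarrow> (h has_derivative D) (at x)" if "x \<in> S" for x D
    using has_derivative_transform_within_open[OF _ assms(1) that, of f D UNIV h]
      has_derivative_transform_within_open[OF _ assms(1) that, of h D UNIV f] Suc.prems by auto
  have "frechet_derivative f (at x) = frechet_derivative h (at x)" if "x \<in> S" for x
    unfolding frechet_derivative_def using eq[OF that] by simp
  moreover have "f differentiable (at x) \<longleftrightarrow> h differentiable (at x)" if "x \<in> S" for x
    unfolding differentiable_def using eq[OF that] by simp
  ultimately show ?case
    using Suc.IH[of "\<lambda>x. frechet_derivative f (at x) v" "\<lambda>x. frechet_derivative h (at x) v" for v] by simp
qed

text \<open>\<open>frechet_derivative\<close> is a choice; uniqueness of derivatives replaces it by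
  any derivative known in closed form. Most closure proofs below enter through this rule.\<close>

lemma Ck_on_SucI':
  assumes "open S" "\<And>x. x \<in> S \<Longrightarrow> (f has_derivative f' x) (at x)"
    and "\<And>v. Ck_on k S (\<lambda>x. f' x v)"
  shows "Ck_on (Suc k) S f"
proof (rule Ck_on_SucI[OF assms(2)])
  fix v
  have "frechet_derivative f (at x) = f' x" if "x \<in> S" for x
    using assms(2)[OF that] frechet_derivative_at by metis
  then show "Ck_on k S (\<lambda>x. frechet_derivative f (at x) v)"
    using Ck_on_cong[OF assms(1), of "\<lambda>x. frechet_derivative f (at x) v" "\<lambda>x. f' x v"] assms(3) by simp
qed

lemma Ck_on_SucD:
  assumes "Ck_on (Suc k) S f"
  shows "x \<in> S \<Longrightarrow> (f has_derivative frechet_derivative f (at x)) (at x)"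
    and "Ck_on k S (\<lambda>x. frechet_derivative f (at x) v)"
  using assms by (auto simp: frechet_derivative_works[symmetric])

lemma Ck_on_imp_continuous_on: "Ck_on k S f \<Longrightarrow> continuous_on S f"
  by (cases k) (auto intro!: continuous_at_imp_continuous_on differentiable_imp_continuous_within)

lemma Ck_on_pred: "Ck_on (Suc k) S f \<Longrightarrow> Ck_on k S f"
  by (induction k arbitrary: f) (auto intro!: continuous_at_imp_continuous_on differentiable_imp_continuous_within)

lemma Ck_on_subset: "Ck_on k T f \<Longrightarrow> S \<subseteq> T \<Longrightarrow> Ck_on k S f"
  by (induction k arbitrary: f) (auto intro: continuous_on_subset)

lemma Ck_on_local:
  assumes "\<And>x. x \<in> S \<Longrightarrow> \<exists>T. open T \<and> x \<in> T \<and> Ck_on k T f"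
  shows "Ck_on k S f"
  using assms
proof (induction k arbitrary: f)
  case 0
  show ?case
    unfolding Ck_on.simps
  proof (intro continuous_at_imp_continuous_on ballI)
    fix x assume "x \<in> S"
    then obtain T where "open T" "x \<in> T" "continuous_on T f" using 0 by auto
    then show "isCont f x" by (simp add: continuous_on_eq_continuous_at)
  qed
next
  case (Suc k)
  have "Ck_on k S (\<lambda>x. frechet_derivative f (at x) v)" for v
    using Suc.prems by (intro Suc.IH) fastforce
  then show ?case using Suc.prems by fastforce
qed

lemma Ck_on_const: "Ck_on k S (\<lambda>x. c)"
  by (induction k arbitrary: c) auto

section \<open>Closure of smooth maps under linear, bilinear and composite operations\<close>

lemma Ck_on_bounded_linear:
  assumes "open S" "bounded_linear h" "Ck_on k S f"
  shows "Ck_on k S (\<lambda>x. h (f x))"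
  using assms(3)
proof (induction k arbitrary: f)
  case 0
  then show ?case using assms(2) by (simp add: bounded_linear.continuous_on)
next
  case (Suc k)
  show ?case
    by (rule Ck_on_SucI'[OF assms(1) bounded_linear.has_derivative[OF assms(2) Ck_on_SucD(1)[OF Suc.prems]]])
      (use Suc in auto)
qed

lemma Ck_on_add:
  assumes "open S" "Ck_on k S f" "Ck_on k S h"
  shows "Ck_on k S (\<lambda>x. f x + h x)"
  using assms(2,3)
proof (induction k arbitrary: f h)
  case 0
  then show ?case by (simp add: continuous_on_add)
next
  case (Suc k)
  show ?case
    by (rule Ck_on_SucI'[OF assms(1) has_derivative_add[OF Ck_on_SucD(1)[OF Suc.prems(1)] Ck_on_SucD(1)[OF Suc.prems(2)]]])
      (use Suc in auto)
qed

text \<open>The product rule keeps one factor undifferentiated, so the induction hypothesis applies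
  to it only after its order is lowered by \<open>Ck_on_pred\<close>. Scalar multiplication and the
  matrix product are both instances.\<close>

lemma Ck_on_bounded_bilinear:
  assumes "open S" "bounded_bilinear B" "Ck_on k S f" "Ck_on k S h"
  shows "Ck_on k S (\<lambda>x. B (f x) (h x))"
  using assms(3,4)
proof (induction k arbitrary: f h)
  case 0
  then show ?case by (simp add: bounded_bilinear.continuous_on[OF assms(2)])
next
  case (Suc k)
  show ?case
  proof (rule Ck_on_SucI'[OF assms(1) bounded_bilinear.FDERIV[OF assms(2) Ck_on_SucD(1)[OF Suc.prems(1)] Ck_on_SucD(1)[OF Suc.prems(2)]]])
    fix v
    show "Ck_on k S (\<lambda>x. B (f x) (frechet_derivative h (at x) v) + B (frechet_derivative f (at x) v) (h x))"
      using Suc.prems Ck_on_pred[OF Suc.prems(1)] Ck_on_pred[OF Suc.prems(2)]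
      by (intro Ck_on_add[OF assms(1)] Suc.IH) auto
  qed
qed

lemmas Ck_on_scaleR = Ck_on_bounded_bilinear[OF _ bounded_bilinear_scaleR]

lemma Ck_on_sum:
  assumes "open S" "\<And>i. i \<in> A \<Longrightarrow> Ck_on k S (f i)"
  shows "Ck_on k S (\<lambda>x. \<Sum>i\<in>A. f i x)"
  using assms(2) by (induction A rule: infinite_finite_induct) (auto intro: Ck_on_const Ck_on_add[OF assms(1)])

lemma Ck_on_compose:
  fixes f :: "'a::real_normed_vector \<Rightarrow> 'b::euclidean_space"
  assumes "open S" "Ck_on k S f" "Ck_on k T h" "f ` S \<subseteq> T"
  shows "Ck_on k S (h \<circ> f)"
  using assms(2,3)
proof (induction k arbitrary: h)
  case 0
  then show ?case using continuous_on_compose[of S f h] continuous_on_subset assms(4) by auto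
next
  case (Suc k)
  show ?case
  proof (rule Ck_on_SucI'[OF assms(1)])
    fix x assume x: "x \<in> S"
    show "(h \<circ> f has_derivative frechet_derivative h (at (f x)) \<circ> frechet_derivative f (at x)) (at x)"
      using x assms(4) by (intro diff_chain_at Ck_on_SucD(1)[OF Suc.prems(1)] Ck_on_SucD(1)[OF Suc.prems(2)]) auto
  next
    fix v
    \<comment> \<open>The direction in which \<open>h\<close> is differentiated varies with
      \<open>x\<close>. Expanding it in the basis leaves derivatives of \<open>h\<close> in fixed
      directions, to which the induction hypothesis applies; hence the Euclidean middle
      space.\<close>
    let ?E = "\<lambda>x. \<Sum>b\<in>Basis. (frechet_derivative f (at x) v \<bullet> b) *\<^sub>R ((\<lambda>y. frechet_derivative h (at y) b) \<circ> f) x"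
    have "Ck_on k S ?E"
    proof (rule Ck_on_sum[OF assms(1)])
      fix b :: 'b assume "b \<in> Basis"
      have "Ck_on k S ((\<lambda>y. frechet_derivative h (at y) b) \<circ> f)"
        using Suc.prems Ck_on_pred[OF Suc.prems(1)] by (intro Suc.IH) auto
      moreover have "Ck_on k S (\<lambda>x. frechet_derivative f (at x) v \<bullet> b)"
        using Suc.prems(1) by (intro Ck_on_bounded_linear[OF assms(1) bounded_linear_inner_left]) auto
      ultimately show "Ck_on k S (\<lambda>x. (frechet_derivative f (at x) v \<bullet> b) *\<^sub>R ((\<lambda>y. frechet_derivative h (at y) b) \<circ> f) x)"
        by (intro Ck_on_scaleR[OF assms(1)])
    qed
    moreover have "(frechet_derivative h (at (f x)) \<circ> frechet_derivative f (at x)) v = ?E x" if "x \<in> S" for x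
    proof -
      have "bounded_linear (frechet_derivative h (at (f x)))"
        using Ck_on_SucD(1)[OF Suc.prems(2), of "f x"] that assms(4) has_derivative_bounded_linear by blast
      then interpret bounded_linear "frechet_derivative h (at (f x))" .
      have "frechet_derivative h (at (f x)) (\<Sum>b\<in>Basis. (frechet_derivative f (at x) v \<bullet> b) *\<^sub>R b) = ?E x"
        by (simp add: sum scaleR)
      then show ?thesis by (simp only: euclidean_representation o_apply)
    qed
    ultimately show "Ck_on k S (\<lambda>x. (frechet_derivative h (at (f x)) \<circ> frechet_derivative f (at x)) v)"
      using Ck_on_cong[OF assms(1), of "\<lambda>x. (frechet_derivative h (at (f x)) \<circ> frechet_derivative f (at x)) v" ?E k]
      by blast
  qed
qed

lemma smooth_on_cong:
  "open S \<Longrightarrow> (\<And>x. x \<in> S \<Longrightarrow> f x = h x) \<Longrightarrow> smooth_on S f \<longleftrightarrow> smooth_on S h"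
  unfolding smooth_on_def using Ck_on_cong by blast

lemma smooth_on_eq:
  "smooth_on S f \<Longrightarrow> (\<And>x. x \<in> S \<Longrightarrow> f x = h x) \<Longrightarrow> open S \<Longrightarrow> smooth_on S h"
  using smooth_on_cong by metis

lemma smooth_on_subset: "smooth_on T f \<Longrightarrow> S \<subseteq> T \<Longrightarrow> smooth_on S f"
  unfolding smooth_on_def using Ck_on_subset by blast

lemma smooth_on_local:
  "(\<And>x. x \<in> S \<Longrightarrow> \<exists>T. open T \<and> x \<in> T \<and> smooth_on T f) \<Longrightarrow> smooth_on S f"
  unfolding smooth_on_def by (intro allI Ck_on_local) meson

lemma smooth_on_imp_continuous_on: "smooth_on S f \<Longrightarrow> continuous_on S f"
  unfolding smooth_on_def using Ck_on_imp_continuous_on by blast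

lemma smooth_on_has_derivative:
  "smooth_on S f \<Longrightarrow> x \<in> S \<Longrightarrow> (f has_derivative frechet_derivative f (at x)) (at x)"
  unfolding smooth_on_def using Ck_on_SucD(1) by blast

lemma smooth_on_derivative: "smooth_on S f \<Longrightarrow> smooth_on S (\<lambda>x. frechet_derivative f (at x) v)"
  unfolding smooth_on_def using Ck_on_SucD(2) by blast

lemma smooth_on_const: "smooth_on S (\<lambda>x. c)"
  unfolding smooth_on_def using Ck_on_const by blast

lemma smooth_on_bounded_linear:
  "open S \<Longrightarrow> bounded_linear h \<Longrightarrow> smooth_on S f \<Longrightarrow> smooth_on S (\<lambda>x. h (f x))"
  unfolding smooth_on_def using Ck_on_bounded_linear by blast

lemma smooth_on_ident: "smooth_on S (\<lambda>x. x)"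
proof -
  have "Ck_on k S (\<lambda>x. x)" for k by (cases k) (auto intro: Ck_on_const)
  then show ?thesis by (simp add: smooth_on_def)
qed

lemma smooth_on_add:
  "open S \<Longrightarrow> smooth_on S f \<Longrightarrow> smooth_on S h \<Longrightarrow> smooth_on S (\<lambda>x. f x + h x)"
  unfolding smooth_on_def using Ck_on_add by blast

lemma smooth_on_bounded_bilinear:
  "open S \<Longrightarrow> bounded_bilinear B \<Longrightarrow> smooth_on S f \<Longrightarrow> smooth_on S h \<Longrightarrow> smooth_on S (\<lambda>x. B (f x) (h x))"
  unfolding smooth_on_def using Ck_on_bounded_bilinear[of S B _ f h] by blast

lemma smooth_on_scaleR:
  "open S \<Longrightarrow> smooth_on S f \<Longrightarrow> smooth_on S h \<Longrightarrow> smooth_on S (\<lambda>x. f x *\<^sub>R h x)"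
  unfolding smooth_on_def using Ck_on_scaleR by blast

lemma smooth_on_mult:
  fixes f h :: "_ \<Rightarrow> real"
  shows "open S \<Longrightarrow> smooth_on S f \<Longrightarrow> smooth_on S h \<Longrightarrow> smooth_on S (\<lambda>x. f x * h x)"
  using smooth_on_scaleR[of S f h] by simp

lemma smooth_on_sum:
  "open S \<Longrightarrow> (\<And>i. i \<in> A \<Longrightarrow> smooth_on S (f i)) \<Longrightarrow> smooth_on S (\<lambda>x. \<Sum>i\<in>A. f i x)"
  unfolding smooth_on_def using Ck_on_sum[of S A _ f] by blast

lemma smooth_on_compose:
  fixes f :: "'a::real_normed_vector \<Rightarrow> 'b::euclidean_space"
  shows "open S \<Longrightarrow> smooth_on S f \<Longrightarrow> smooth_on T h \<Longrightarrow> f ` S \<subseteq> T \<Longrightarrow> smooth_on S (h \<circ> f)"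
  unfolding smooth_on_def using Ck_on_compose by blast

lemma smooth_on_Pair:
  assumes "open S" "smooth_on S f" "smooth_on S h"
  shows "smooth_on S (\<lambda>x. (f x, h x))"
proof -
  have "smooth_on S (\<lambda>x. (f x, 0) + (0, h x))"
    by (intro smooth_on_add[OF assms(1)] smooth_on_bounded_linear[OF assms(1) _ assms(2)]
        smooth_on_bounded_linear[OF assms(1) _ assms(3)] bounded_linear_Pair bounded_linear_zero bounded_linear_ident)
  then show ?thesis by simp
qed

lemma bounded_linear_axis: "bounded_linear (axis i :: 'b::real_normed_vector \<Rightarrow> 'b ^ 'm::finite)"
proof (intro bounded_linear_intro[where K=1])
  fix x :: 'b
  have "(\<Sum>j\<in>UNIV. (norm (axis i x $ j))\<^sup>2) = (\<Sum>j\<in>UNIV. if j = i then (norm x)\<^sup>2 else 0)"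
    by (rule sum.cong) (auto simp: axis_def)
  also have "\<dots> = (norm x)\<^sup>2" by simp
  finally have "norm (axis i x) = norm x"
    unfolding norm_vec_def L2_set_def by (simp only: real_sqrt_abs abs_norm_cancel)
  then show "norm (axis i x) \<le> norm x * 1" by simp
qed (auto simp: axis_def vec_eq_iff)

lemma smooth_on_vec:
  fixes f :: "'m::finite \<Rightarrow> 'a::real_normed_vector \<Rightarrow> 'b::real_normed_vector"
  assumes "open S" "\<And>i. smooth_on S (f i)"
  shows "smooth_on S (\<lambda>x. \<chi> i. f i x)"
proof -
  have "smooth_on S (\<lambda>x. \<Sum>i\<in>UNIV. axis i (f i x))"
    by (intro smooth_on_sum assms(1) smooth_on_bounded_linear[OF assms(1) bounded_linear_axis assms(2)])
  moreover have "(\<Sum>i\<in>UNIV. axis i (f i x)) = (\<chi> i. f i x)" for x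
    by (simp add: vec_eq_iff axis_def)
  ultimately show ?thesis by simp
qed

lemma smooth_on_powr: "smooth_on {0<..} (\<lambda>x::real. x powr a)"
proof -
  \<comment> \<open>Differentiation replaces \<open>a\<close> by \<open>a - 1\<close> and multiplies
    \<open>c\<close> by \<open>a\<close>, so both must be free in the induction.\<close>
  have "Ck_on k {0<..} (\<lambda>x::real. c * x powr a)" for k c a
  proof (induction k arbitrary: c a)
    case 0
    show ?case by (auto intro!: continuous_intros)
  next
    case (Suc k)
    show ?case
    proof (rule Ck_on_SucI')
      fix x :: real assume "x \<in> {0<..}"
      then show "((\<lambda>x. c * x powr a) has_derivative (\<lambda>v. (v * c * a) * x powr (a - 1))) (at x)"
        by (auto intro!: derivative_eq_intros simp: powr_diff field_simps)
    qed (use Suc in auto)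
  qed
  from this[of _ 1 a] show ?thesis by (simp add: smooth_on_def)
qed

lemma smooth_on_cos: "smooth_on UNIV (\<lambda>x::real. cos x)"
  and smooth_on_sin: "smooth_on UNIV (\<lambda>x::real. sin x)"
proof -
  \<comment> \<open>Each derivative leads to the other function up to a factor, hence the
    simultaneous induction with a free constant.\<close>
  have "Ck_on k UNIV (\<lambda>x::real. c * cos x) \<and> Ck_on k UNIV (\<lambda>x::real. c * sin x)" for k c
  proof (induction k arbitrary: c)
    case 0
    show ?case by (auto intro!: continuous_intros)
  next
    case (Suc k)
    have "Ck_on (Suc k) UNIV (\<lambda>x::real. c * cos x)"
    proof (rule Ck_on_SucI')
      show "((\<lambda>x. c * cos x) has_derivative (\<lambda>v. (- (v * c)) * sin x)) (at x)" for x
        by (auto intro!: derivative_eq_intros)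
      show "Ck_on k UNIV (\<lambda>x::real. (- (v * c)) * sin x)" for v
        using Suc by blast
    qed auto
    moreover have "Ck_on (Suc k) UNIV (\<lambda>x::real. c * sin x)"
    proof (rule Ck_on_SucI')
      show "((\<lambda>x. c * sin x) has_derivative (\<lambda>v. (v * c) * cos x)) (at x)" for x
        by (auto intro!: derivative_eq_intros)
      show "Ck_on k UNIV (\<lambda>x::real. (v * c) * cos x)" for v
        using Suc by blast
    qed auto
    ultimately show ?case by blast
  qed
  from this[of _ 1] show "smooth_on UNIV (\<lambda>x::real. cos x)" "smooth_on UNIV (\<lambda>x::real. sin x)"
    by (auto simp: smooth_on_def)
qed

lemma smooth_on_euclidean:
  fixes f :: "'b::real_normed_vector \<Rightarrow> 'e::euclidean_space"
  assumes "open S" "\<And>b. b \<in> Basis \<Longrightarrow> smooth_on S (\<lambda>x. f x \<bullet> b)"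
  shows "smooth_on S f"
proof -
  have "smooth_on S (\<lambda>x. \<Sum>b\<in>Basis. (f x \<bullet> b) *\<^sub>R b)"
    by (intro smooth_on_sum smooth_on_scaleR smooth_on_const assms)
  then show ?thesis by (simp add: euclidean_representation)
qed

section \<open>Smooth functions and curves on a manifold\<close>

lemma continuous_on_open_Collect:
  assumes "open S" "continuous_on S f" "open T"
  shows "open {z \<in> S. f z \<in> T}"
  using continuous_open_preimage[OF assms(2,1,3)] by (simp add: Int_def vimage_def)

locale atlas_manifold =
  fixes \<A> :: "('a, 'e::euclidean_space) chart set"
  assumes atlas: "smooth_atlas \<A>"
begin

lemma chart_inj: "(U, \<phi>) \<in> \<A> \<Longrightarrow> inj_on \<phi> U"
  and transition_open: "(U, \<phi>) \<in> \<A> \<Longrightarrow> (V, \<psi>) \<in> \<A> \<Longrightarrow> open (\<phi> ` (U \<inter> V))"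
  and transition_smooth:
    "(U, \<phi>) \<in> \<A> \<Longrightarrow> (V, \<psi>) \<in> \<A> \<Longrightarrow> smooth_on (\<phi> ` (U \<inter> V)) (\<psi> \<circ> inv_into U \<phi>)"
  and chart_open: "(U, \<phi>) \<in> \<A> \<Longrightarrow> open (\<phi> ` U)"
  and chart_carrier: "(U, \<phi>) \<in> \<A> \<Longrightarrow> U \<subseteq> carrier_of \<A>"
  using atlas unfolding smooth_atlas_def carrier_of_def by fastforce+

lemma carrierE:
  assumes "y \<in> carrier_of \<A>"
  obtains U \<phi> where "(U, \<phi>) \<in> \<A>" "y \<in> U"
  using assms unfolding carrier_of_def by auto

lemma chart_inv: "(U, \<phi>) \<in> \<A> \<Longrightarrow> y \<in> U \<Longrightarrow> inv_into U \<phi> (\<phi> y) = y"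
  using chart_inj by auto

lemma open_in_carrierD: "open_in \<A> W \<Longrightarrow> W \<subseteq> carrier_of \<A>"
  and open_in_chartD: "open_in \<A> W \<Longrightarrow> (U, \<phi>) \<in> \<A> \<Longrightarrow> open (\<phi> ` (W \<inter> U))"
  unfolding open_in_def by auto

text \<open>In any other chart the image of \<open>W\<close> is the preimage of an open set under a
  transition map, so one chart decides.\<close>

lemma open_in_chartI:
  assumes "(U, \<phi>) \<in> \<A>" "W \<subseteq> U" "open (\<phi> ` W)"
  shows "open_in \<A> W"
  unfolding open_in_def
proof (intro conjI ballI; clarify?)
  show "y \<in> carrier_of \<A>" if "y \<in> W" for y using chart_carrier[OF assms(1)] assms(2) that by auto
next
  fix V \<psi> assume V: "(V, \<psi>) \<in> \<A>"
  have "\<psi> ` (W \<inter> V) = {z \<in> \<psi> ` (V \<inter> U). (\<phi> \<circ> inv_into V \<psi>) z \<in> \<phi> ` W}"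
    using chart_inv[OF V] inj_onD[OF chart_inj[OF assms(1)]] assms(2) by fastforce
  moreover have "open \<dots>"
    by (rule continuous_on_open_Collect[OF transition_open[OF V assms(1)]
          smooth_on_imp_continuous_on[OF transition_smooth[OF V assms(1)]] assms(3)])
  ultimately show "open (\<psi> ` (W \<inter> V))" by simp
qed

lemma open_in_chart: "(U, \<phi>) \<in> \<A> \<Longrightarrow> open_in \<A> U"
  using open_in_chartI chart_open by blast

lemma open_in_Int:
  assumes "open_in \<A> W" "open_in \<A> W'"
  shows "open_in \<A> (W \<inter> W')"
  unfolding open_in_def
proof (intro conjI ballI; clarify?)
  show "y \<in> carrier_of \<A>" if "y \<in> W" for y using open_in_carrierD[OF assms(1)] that by auto
next
  fix V \<psi> assume V: "(V, \<psi>) \<in> \<A>"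
  have "\<psi> ` (W \<inter> W' \<inter> V) = \<psi> ` (W \<inter> V) \<inter> \<psi> ` (W' \<inter> V)"
    using inj_onD[OF chart_inj[OF V]] by fastforce
  then show "open (\<psi> ` (W \<inter> W' \<inter> V))"
    using open_in_chartD[OF assms(1) V] open_in_chartD[OF assms(2) V] by auto
qed

lemma open_in_carrier: "open_in \<A> (carrier_of \<A>)"
  using chart_open chart_carrier by (auto simp: open_in_def Int_absorb1)

lemma smooth_fun_subset: "smooth_fun \<A> W f \<Longrightarrow> W' \<subseteq> W \<Longrightarrow> smooth_fun \<A> W' f"
  unfolding smooth_fun_def by (fastforce intro: smooth_on_subset)

lemma smooth_funD:
  "smooth_fun \<A> W f \<Longrightarrow> (U, \<phi>) \<in> \<A> \<Longrightarrow> smooth_on (\<phi> ` (W \<inter> U)) (f \<circ> inv_into U \<phi>)"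
  unfolding smooth_fun_def by auto

lemma smooth_funI:
  "(\<And>U \<phi>. (U, \<phi>) \<in> \<A> \<Longrightarrow> smooth_on (\<phi> ` (W \<inter> U)) (f \<circ> inv_into U \<phi>)) \<Longrightarrow> smooth_fun \<A> W f"
  unfolding smooth_fun_def by auto

lemma smooth_fun_cong:
  assumes "open_in \<A> W" "\<And>y. y \<in> W \<Longrightarrow> f y = h y"
  shows "smooth_fun \<A> W f \<longleftrightarrow> smooth_fun \<A> W h"
proof -
  have "smooth_on (\<phi> ` (W \<inter> U)) (f \<circ> inv_into U \<phi>) \<longleftrightarrow> smooth_on (\<phi> ` (W \<inter> U)) (h \<circ> inv_into U \<phi>)"
    if U: "(U, \<phi>) \<in> \<A>" for U \<phi>
    by (rule smooth_on_cong[OF open_in_chartD[OF assms(1) U]]) (auto simp: chart_inv[OF U] assms(2))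
  then show ?thesis unfolding smooth_fun_def by auto
qed

lemma smooth_fun_local:
  assumes "\<And>y. y \<in> W \<Longrightarrow> \<exists>W'. open_in \<A> W' \<and> y \<in> W' \<and> smooth_fun \<A> W' f"
  shows "smooth_fun \<A> W f"
proof (rule smooth_funI, rule smooth_on_local)
  fix U \<phi> z assume U: "(U, \<phi>) \<in> \<A>" and "z \<in> \<phi> ` (W \<inter> U)"
  then obtain y where y: "y \<in> W" "y \<in> U" "z = \<phi> y" by auto
  then obtain W' where "open_in \<A> W'" "y \<in> W'" "smooth_fun \<A> W' f" using assms by blast
  then show "\<exists>T. open T \<and> z \<in> T \<and> smooth_on T (f \<circ> inv_into U \<phi>)"
    using open_in_chartD[OF _ U] smooth_funD[OF _ U] y by (intro exI[of _ "\<phi> ` (W' \<inter> U)"]) auto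
qed

text \<open>Other charts differ by a smooth transition map, so inside a chart domain smoothness may
  be checked in that chart alone.\<close>

lemma smooth_fun_chartI:
  assumes "(U, \<phi>) \<in> \<A>" "W \<subseteq> U" "open (\<phi> ` W)" "smooth_on (\<phi> ` W) (f \<circ> inv_into U \<phi>)"
  shows "smooth_fun \<A> W f"
proof (rule smooth_funI)
  fix V \<psi> assume V: "(V, \<psi>) \<in> \<A>"
  have op: "open (\<psi> ` (W \<inter> V))" using open_in_chartD[OF open_in_chartI[OF assms(1-3)] V] .
  have "smooth_on (\<psi> ` (W \<inter> V)) ((f \<circ> inv_into U \<phi>) \<circ> (\<phi> \<circ> inv_into V \<psi>))"
    using assms(2) chart_inv[OF V]
    by (intro smooth_on_compose[OF op _ assms(4)] smooth_on_subset[OF transition_smooth[OF V assms(1)]]) auto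
  moreover have "((f \<circ> inv_into U \<phi>) \<circ> (\<phi> \<circ> inv_into V \<psi>)) z = (f \<circ> inv_into V \<psi>) z"
    if "z \<in> \<psi> ` (W \<inter> V)" for z
    using that assms(2) chart_inv[OF V] chart_inv[OF assms(1)] by auto
  ultimately show "smooth_on (\<psi> ` (W \<inter> V)) (f \<circ> inv_into V \<psi>)"
    by (rule smooth_on_eq) (assumption, rule op)
qed

lemma smooth_fun_const: "smooth_fun \<A> W (\<lambda>y. c)"
  using smooth_on_const[of _ c] by (auto simp: smooth_fun_def comp_def)

lemma smooth_fun_add:
  "open_in \<A> W \<Longrightarrow> smooth_fun \<A> W f \<Longrightarrow> smooth_fun \<A> W h \<Longrightarrow> smooth_fun \<A> W (\<lambda>y. f y + h y)"
  using smooth_on_add[OF open_in_chartD smooth_funD smooth_funD]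
  by (intro smooth_funI) (simp add: comp_def)

lemma smooth_fun_mult:
  "open_in \<A> W \<Longrightarrow> smooth_fun \<A> W f \<Longrightarrow> smooth_fun \<A> W h \<Longrightarrow> smooth_fun \<A> W (\<lambda>y. f y * h y)"
  using smooth_on_mult[OF open_in_chartD smooth_funD smooth_funD]
  by (intro smooth_funI) (simp add: comp_def)

lemma smooth_fun_compose:
  assumes "open_in \<A> W" "smooth_fun \<A> W f" "smooth_on T h" "f ` W \<subseteq> T"
  shows "smooth_fun \<A> W (\<lambda>y. h (f y))"
proof (rule smooth_funI)
  fix U \<phi> assume U: "(U, \<phi>) \<in> \<A>"
  have "smooth_on (\<phi> ` (W \<inter> U)) (h \<circ> (f \<circ> inv_into U \<phi>))"
    using assms(4) chart_inv[OF U]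
    by (intro smooth_on_compose[OF open_in_chartD[OF assms(1) U] smooth_funD[OF assms(2) U] assms(3)]) auto
  then show "smooth_on (\<phi> ` (W \<inter> U)) ((\<lambda>y. h (f y)) \<circ> inv_into U \<phi>)" by (simp add: comp_def)
qed

lemma smooth_fun_chart: "(U, \<phi>) \<in> \<A> \<Longrightarrow> smooth_fun \<A> U (\<lambda>y. \<phi> y \<bullet> b)"
proof (rule smooth_fun_chartI)
  assume U: "(U, \<phi>) \<in> \<A>"
  have "smooth_on (\<phi> ` U) (\<lambda>z. z \<bullet> b)"
    by (rule smooth_on_bounded_linear[OF chart_open[OF U] bounded_linear_inner_left smooth_on_ident])
  moreover have "z \<bullet> b = ((\<lambda>y. \<phi> y \<bullet> b) \<circ> inv_into U \<phi>) z" if "z \<in> \<phi> ` U" for z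
    using that by (auto simp: chart_inv[OF U])
  ultimately show "smooth_on (\<phi> ` U) ((\<lambda>y. \<phi> y \<bullet> b) \<circ> inv_into U \<phi>)"
    by (rule smooth_on_eq) (assumption, rule chart_open[OF U])
qed (auto intro: chart_open)

lemma open_in_preimage:
  assumes "open_in \<A> W" "smooth_fun \<A> W f" "open S"
  shows "open_in \<A> {y \<in> W. f y \<in> S}"
  unfolding open_in_def
proof (intro conjI ballI; clarify?)
  show "y \<in> carrier_of \<A>" if "y \<in> W" for y using open_in_carrierD[OF assms(1)] that by auto
next
  fix V \<psi> assume V: "(V, \<psi>) \<in> \<A>"
  have "\<psi> ` ({y \<in> W. f y \<in> S} \<inter> V) = {z \<in> \<psi> ` (W \<inter> V). (f \<circ> inv_into V \<psi>) z \<in> S}"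
    using chart_inv[OF V] by force
  moreover have "open \<dots>"
    by (intro continuous_on_open_Collect open_in_chartD[OF assms(1) V] assms(3)
        smooth_on_imp_continuous_on smooth_funD[OF assms(2) V])
  ultimately show "open (\<psi> ` ({y \<in> W. f y \<in> S} \<inter> V))" by simp
qed

lemma smooth_nearI: "open_in \<A> W \<Longrightarrow> x \<in> W \<Longrightarrow> smooth_fun \<A> W f \<Longrightarrow> smooth_near \<A> x f"
  unfolding smooth_near_def by blast

lemma smooth_near_chart: "(U, \<phi>) \<in> \<A> \<Longrightarrow> x \<in> U \<Longrightarrow> smooth_near \<A> x (\<lambda>y. \<phi> y \<bullet> b)"
  using smooth_nearI open_in_chart smooth_fun_chart by blast

lemma smooth_near_const: "x \<in> carrier_of \<A> \<Longrightarrow> smooth_near \<A> x (\<lambda>y. c)"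
  using smooth_nearI open_in_carrier smooth_fun_const by blast

lemma smooth_near_cong:
  assumes "open_in \<A> W" "x \<in> W" "\<And>y. y \<in> W \<Longrightarrow> f y = h y"
  shows "smooth_near \<A> x f \<longleftrightarrow> smooth_near \<A> x h"
proof -
  have "smooth_near \<A> x h" if "\<And>y. y \<in> W \<Longrightarrow> f y = h y" and f: "smooth_near \<A> x f" for f h
  proof -
    obtain W' where W': "open_in \<A> W'" "x \<in> W'" "smooth_fun \<A> W' f"
      using f unfolding smooth_near_def by blast
    have op: "open_in \<A> (W \<inter> W')" using open_in_Int assms(1) W'(1) by blast
    moreover have "smooth_fun \<A> (W \<inter> W') h"
      using smooth_fun_cong[OF op, of f h] smooth_fun_subset[OF W'(3)] that(1) by auto
    ultimately show ?thesis using smooth_nearI W'(2) assms(2) by blast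
  qed
  from this[of f h] this[of h f] show ?thesis using assms(3) by auto
qed

lemma smooth_near_differentiable:
  assumes "(U, \<phi>) \<in> \<A>" "x \<in> U" "smooth_near \<A> x f"
  shows "((f \<circ> inv_into U \<phi>) has_derivative frechet_derivative (f \<circ> inv_into U \<phi>) (at (\<phi> x))) (at (\<phi> x))"
proof -
  obtain W where "open_in \<A> W" "x \<in> W" "smooth_fun \<A> W f" using assms(3) unfolding smooth_near_def by blast
  then show ?thesis
    by (intro smooth_on_has_derivative[OF smooth_funD[OF _ assms(1), of W]]) (use assms(2) in auto)
qed

section \<open>Smooth curves in charts\<close>

lemma smooth_curve_chart:
  assumes "smooth_curve \<A> T c" "(U, \<phi>) \<in> \<A>"
  shows "open (T \<inter> c -` U)" "smooth_on (T \<inter> c -` U) (\<phi> \<circ> c)"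
  using assms unfolding smooth_curve_def by auto

lemma smooth_curve_carrier: "smooth_curve \<A> T c \<Longrightarrow> t \<in> T \<Longrightarrow> c t \<in> carrier_of \<A>"
  unfolding smooth_curve_def by auto

text \<open>Smoothness of a curve is stated chart by chart. Continuity for the manifold topology
  follows by cutting \<open>T\<close> into the open pieces mapped into single chart domains.\<close>

lemma smooth_curve_vimage_open:
  assumes "smooth_curve \<A> T c" "open_in \<A> W"
  shows "open (T \<inter> c -` W)"
proof -
  have "open {t \<in> T \<inter> c -` U. (\<phi> \<circ> c) t \<in> \<phi> ` (W \<inter> U)}" if "(U, \<phi>) \<in> \<A>" for U \<phi>
    by (intro continuous_on_open_Collect smooth_curve_chart[OF assms(1) that] smooth_on_imp_continuous_on
        open_in_chartD[OF assms(2) that])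
  moreover have "{t \<in> T \<inter> c -` U. (\<phi> \<circ> c) t \<in> \<phi> ` (W \<inter> U)} = (T \<inter> c -` W) \<inter> c -` U"
    if "(U, \<phi>) \<in> \<A>" for U \<phi>
    using inj_onD[OF chart_inj[OF that]] by fastforce
  ultimately have "open ((T \<inter> c -` W) \<inter> c -` fst C)" if "C \<in> \<A>" for C
    using that by (metis prod.collapse)
  then have "open (\<Union>C\<in>\<A>. (T \<inter> c -` W) \<inter> c -` fst C)" by blast
  moreover have "(\<Union>C\<in>\<A>. (T \<inter> c -` W) \<inter> c -` fst C) = T \<inter> c -` W"
    using smooth_curve_carrier[OF assms(1)] unfolding carrier_of_def by fastforce
  ultimately show ?thesis by simp
qed

lemma smooth_curve_fun:
  assumes "smooth_curve \<A> T c" "open_in \<A> W" "smooth_fun \<A> W f"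
  shows "smooth_on (T \<inter> c -` W) (f \<circ> c)"
proof (rule smooth_on_local)
  fix t assume t: "t \<in> T \<inter> c -` W"
  then obtain U \<phi> where U: "(U, \<phi>) \<in> \<A>" "c t \<in> U"
    using carrierE[OF smooth_curve_carrier[OF assms(1)]] by blast
  let ?T = "T \<inter> c -` (W \<inter> U)"
  have op: "open ?T"
    using smooth_curve_vimage_open[OF assms(1) open_in_Int[OF assms(2) open_in_chart[OF U(1)]]] .
  have "smooth_on ?T ((f \<circ> inv_into U \<phi>) \<circ> (\<phi> \<circ> c))"
    by (rule smooth_on_compose[OF op smooth_on_subset[OF smooth_curve_chart(2)[OF assms(1) U(1)]]
          smooth_funD[OF assms(3) U(1)]]) auto
  moreover have "((f \<circ> inv_into U \<phi>) \<circ> (\<phi> \<circ> c)) s = (f \<circ> c) s" if "s \<in> ?T" for s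
    using that chart_inv[OF U(1)] by auto
  ultimately have "smooth_on ?T (f \<circ> c)" by (rule smooth_on_eq) (assumption, rule op)
  then show "\<exists>S. open S \<and> t \<in> S \<and> smooth_on S (f \<circ> c)" using op t U(2) by (intro exI[of _ ?T]) auto
qed

lemma smooth_curve_restrict:
  assumes "smooth_curve \<A> T c" "open S" "S \<subseteq> T"
  shows "smooth_curve \<A> S c"
  unfolding smooth_curve_def
proof (intro conjI ballI; clarify?)
  show "c t \<in> carrier_of \<A>" if "t \<in> S" for t using smooth_curve_carrier[OF assms(1)] assms(3) that by auto
next
  fix U \<phi> assume U: "(U, \<phi>) \<in> \<A>"
  have "S \<inter> c -` U = S \<inter> (T \<inter> c -` U)" using assms(3) by auto
  then show "open (S \<inter> c -` U) \<and> smooth_on (S \<inter> c -` U) (\<phi> \<circ> c)"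
    using smooth_curve_chart[OF assms(1) U] assms(2) by (metis Int_lower2 open_Int smooth_on_subset)
qed

lemma smooth_curveI:
  assumes "(U, \<phi>) \<in> \<A>" "open T" "c ` T \<subseteq> U" "smooth_on T (\<phi> \<circ> c)"
  shows "smooth_curve \<A> T c"
  unfolding smooth_curve_def
proof (intro conjI ballI; clarify?)
  show "c t \<in> carrier_of \<A>" if "t \<in> T" for t using assms(3) that chart_carrier[OF assms(1)] by auto
next
  fix V \<psi> assume V: "(V, \<psi>) \<in> \<A>"
  have "T \<inter> c -` V = {t \<in> T. (\<phi> \<circ> c) t \<in> \<phi> ` (U \<inter> V)}"
    using inj_onD[OF chart_inj[OF assms(1)]] assms(3) by fastforce
  moreover have "open \<dots>"
    by (rule continuous_on_open_Collect[OF assms(2) smooth_on_imp_continuous_on[OF assms(4)]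
          transition_open[OF assms(1) V]])
  ultimately have op: "open (T \<inter> c -` V)" by simp
  have "smooth_on (T \<inter> c -` V) ((\<psi> \<circ> inv_into U \<phi>) \<circ> (\<phi> \<circ> c))"
    by (rule smooth_on_compose[OF op smooth_on_subset[OF assms(4)] transition_smooth[OF assms(1) V]])
      (use assms(3) in auto)
  moreover have "((\<psi> \<circ> inv_into U \<phi>) \<circ> (\<phi> \<circ> c)) s = (\<psi> \<circ> c) s" if "s \<in> T \<inter> c -` V" for s
    using that chart_inv[OF assms(1)] assms(3) by auto
  ultimately have "smooth_on (T \<inter> c -` V) (\<psi> \<circ> c)" by (rule smooth_on_eq) (assumption, rule op)
  with op show "open (T \<inter> c -` V) \<and> smooth_on (T \<inter> c -` V) (\<psi> \<circ> c)" by blast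
qed

end

section \<open>Tangent vectors\<close>

lemma tscale_apply [simp]: "(a *\<^sub>t v) f = a * v f"
  by (simp add: tscale_def)

lemma tvec_sum_apply [simp]: "(\<Sum>i\<in>A. v i :: 'a tvec) f = (\<Sum>i\<in>A. v i f)"
  by (induction A rule: infinite_finite_induct) auto

lemma tvec_diff_apply [simp]: "(v - w :: 'a tvec) f = v f - w f"
  and tvec_uminus_apply [simp]: "(- v :: 'a tvec) f = - v f"
  by auto

lemma tscale_simps [simp]:
  "0 *\<^sub>t v = 0" "1 *\<^sub>t v = v" "a *\<^sub>t (0 :: 'a tvec) = 0" "a *\<^sub>t b *\<^sub>t v = (a * b) *\<^sub>t v"
  "(-1) *\<^sub>t v = - v"
  by (auto simp: fun_eq_iff)

lemma tscale_distrib: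
  "(a + b) *\<^sub>t v = a *\<^sub>t v + b *\<^sub>t v" "a *\<^sub>t (v + w) = a *\<^sub>t v + a *\<^sub>t w"
  "(a - b) *\<^sub>t v = a *\<^sub>t v - b *\<^sub>t v" "a *\<^sub>t (v - w) = a *\<^sub>t v - a *\<^sub>t w"
  "(- a) *\<^sub>t v = - (a *\<^sub>t v)" "a *\<^sub>t (- v) = - (a *\<^sub>t v)"
  by (auto simp: fun_eq_iff algebra_simps)

lemma tscale_sum:
  "a *\<^sub>t (\<Sum>i\<in>A. w i) = (\<Sum>i\<in>A. a *\<^sub>t w i)" "(\<Sum>i\<in>A. b i) *\<^sub>t v = (\<Sum>i\<in>A. b i *\<^sub>t v)"
  by (auto simp: fun_eq_iff sum_distrib_left sum_distrib_right)

text \<open>The coordinate vector field with constant components \<open>b\<close>. It is linear in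
  \<open>b\<close>, which gives tangent spaces the linear structure that velocities of curves do not
  show. The value 0 on other functions matches the convention in \<open>velocity\<close>.\<close>

definition chart_vec ::
    "('a, 'e::euclidean_space) chart set \<Rightarrow> 'a set \<Rightarrow> ('a \<Rightarrow> 'e) \<Rightarrow> 'e \<Rightarrow> 'a \<Rightarrow> 'a tvec" where
  "chart_vec \<A> U \<phi> b y =
     (\<lambda>f. if smooth_near \<A> y f then frechet_derivative (f \<circ> inv_into U \<phi>) (at (\<phi> y)) b else 0)"

lemma tangent_inE:
  assumes "v \<in> tangent_in \<A> Q x"
  obtains c \<epsilon> where "v = velocity \<A> c" "\<epsilon> > 0" "smooth_curve \<A> {-\<epsilon><..<\<epsilon>} c" "c 0 = x"
    "c ` {-\<epsilon><..<\<epsilon>} \<subseteq> Q"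
  using assms unfolding tangent_in_def by blast

lemma tangent_inI:
  "\<epsilon> > 0 \<Longrightarrow> smooth_curve \<A> {-\<epsilon><..<\<epsilon>} c \<Longrightarrow> c 0 = x \<Longrightarrow> c ` {-\<epsilon><..<\<epsilon>} \<subseteq> Q \<Longrightarrow>
    velocity \<A> c \<in> tangent_in \<A> Q x"
  unfolding tangent_in_def by blast

lemma tangent_in_subset_tangent_space: "tangent_in \<A> Q x \<subseteq> tangent_space \<A> x"
  unfolding tangent_in_def smooth_curve_def by blast

lemma tangent_in_base:
  assumes "v \<in> tangent_in \<A> Q x"
  shows "x \<in> Q" "x \<in> carrier_of \<A>"
  using assms unfolding tangent_in_def smooth_curve_def by (auto simp: image_subset_iff)

lemma open_interval_around_0:
  assumes "open S" "(0::real) \<in> S"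
  shows "\<exists>\<delta>>0. {-\<delta><..<\<delta>} \<subseteq> S \<and> (\<forall>t. \<bar>t\<bar> < \<delta> \<longrightarrow> t \<in> S)"
proof -
  obtain \<delta> where d: "\<delta> > 0" "ball 0 \<delta> \<subseteq> S" using assms open_contains_ball by blast
  have "t \<in> S" if "\<bar>t\<bar> < \<delta>" for t using d(2) that by (auto simp: subset_iff dist_real_def)
  with d show ?thesis by (intro exI[of _ \<delta>]) (auto simp: ball_eq_greaterThanLessThan)
qed

context atlas_manifold
begin

lemma smooth_curve_shrink:
  assumes "smooth_curve \<A> {-\<epsilon><..<\<epsilon>} c" "\<epsilon> > 0" "open_in \<A> W" "c 0 \<in> W"
  obtains \<delta> where "0 < \<delta>" "\<delta> \<le> \<epsilon>" "c ` {-\<delta><..<\<delta>} \<subseteq> W" "smooth_curve \<A> {-\<delta><..<\<delta>} c"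
proof -
  obtain \<delta> where d: "\<delta> > 0" "{-\<delta><..<\<delta>} \<subseteq> {-\<epsilon><..<\<epsilon>} \<inter> c -` W"
    using open_interval_around_0[OF smooth_curve_vimage_open[OF assms(1,3)]] assms(2,4)
    by (auto simp del: Int_subset_iff)
  have "smooth_curve \<A> {-min \<delta> \<epsilon><..<min \<delta> \<epsilon>} c"
    by (intro smooth_curve_restrict[OF assms(1)]) auto
  moreover have "c ` {-min \<delta> \<epsilon><..<min \<delta> \<epsilon>} \<subseteq> W"
  proof clarify
    fix t assume "t \<in> {-min \<delta> \<epsilon><..<min \<delta> \<epsilon>}"
    then have "t \<in> {-\<delta><..<\<delta>}" by auto
    then show "c t \<in> W" using d(2) by auto
  qed
  ultimately show ?thesis using that[of "min \<delta> \<epsilon>"] assms(2) d(1) by simp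
qed

text \<open>The chain rule for \<open>f \<circ> c\<close>, split as
  \<open>f \<circ> inv_into U \<phi>\<close> after \<open>\<phi> \<circ> c\<close>. The last
  conclusion says that the \<open>deriv\<close> in \<open>velocity\<close> is a genuine derivative
  and not an arbitrary value.\<close>

lemma velocity_eq_chart_vec:
  assumes "smooth_curve \<A> T c" "open T" "0 \<in> T" "(U, \<phi>) \<in> \<A>" "c 0 \<in> U"
  shows "((\<phi> \<circ> c) has_vector_derivative vector_derivative (\<phi> \<circ> c) (at 0)) (at 0)"
    and "velocity \<A> c = chart_vec \<A> U \<phi> (vector_derivative (\<phi> \<circ> c) (at 0)) (c 0)"
    and "smooth_near \<A> (c 0) f \<Longrightarrow> ((f \<circ> c) has_real_derivative velocity \<A> c f) (at 0)"
proof -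
  let ?S = "T \<inter> c -` U"
  have S: "open ?S" "0 \<in> ?S" "smooth_on ?S (\<phi> \<circ> c)"
    using smooth_curve_chart[OF assms(1,4)] assms(3,5) by auto
  have "(\<phi> \<circ> c) differentiable (at 0)"
    using smooth_on_has_derivative[OF S(3,2)] unfolding differentiable_def by blast
  then show d: "((\<phi> \<circ> c) has_vector_derivative vector_derivative (\<phi> \<circ> c) (at 0)) (at 0)"
    using vector_derivative_works by blast
  have key: "((f \<circ> c) has_real_derivative
      frechet_derivative (f \<circ> inv_into U \<phi>) (at (\<phi> (c 0))) (vector_derivative (\<phi> \<circ> c) (at 0))) (at 0)"
    if "smooth_near \<A> (c 0) f" for f
  proof -
    let ?D = "frechet_derivative (f \<circ> inv_into U \<phi>) (at (\<phi> (c 0)))"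
    have D: "((f \<circ> inv_into U \<phi>) has_derivative ?D) (at ((\<phi> \<circ> c) 0))"
      using smooth_near_differentiable[OF assms(4,5) that] by simp
    have "((f \<circ> inv_into U \<phi>) \<circ> (\<phi> \<circ> c) has_derivative
        (?D \<circ> (\<lambda>t. t *\<^sub>R vector_derivative (\<phi> \<circ> c) (at 0)))) (at 0)"
      using diff_chain_at[OF d[unfolded has_vector_derivative_def] D] .
    then have "(f \<circ> c has_derivative
        (?D \<circ> (\<lambda>t. t *\<^sub>R vector_derivative (\<phi> \<circ> c) (at 0)))) (at 0)"
      by (rule has_derivative_transform_within_open[OF _ S(1,2)])
        (auto simp: chart_inv[OF assms(4)])
    moreover have "?D \<circ> (\<lambda>t. t *\<^sub>R vector_derivative (\<phi> \<circ> c) (at 0)) = (*) (?D (vector_derivative (\<phi> \<circ> c) (at 0)))"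
      using linear_scale[OF has_derivative_linear[OF D]] by (auto simp: fun_eq_iff)
    ultimately show ?thesis unfolding has_field_derivative_def by simp
  qed
  show "velocity \<A> c = chart_vec \<A> U \<phi> (vector_derivative (\<phi> \<circ> c) (at 0)) (c 0)"
    unfolding velocity_def chart_vec_def using DERIV_imp_deriv[OF key] by auto
  show "((f \<circ> c) has_real_derivative velocity \<A> c f) (at 0)" if "smooth_near \<A> (c 0) f"
    using key[OF that] DERIV_imp_deriv[OF key[OF that]] that by (simp add: velocity_def)
qed

lemma velocity_has_derivative:
  assumes "smooth_curve \<A> {-\<epsilon><..<\<epsilon>} c" "\<epsilon> > 0" "smooth_near \<A> (c 0) f"
  shows "((f \<circ> c) has_real_derivative velocity \<A> c f) (at 0)"
proof -
  obtain U \<phi> where "(U, \<phi>) \<in> \<A>" "c 0 \<in> U"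
    using carrierE[OF smooth_curve_carrier[OF assms(1), of 0]] assms(2) by auto
  then show ?thesis using velocity_eq_chart_vec(3)[OF assms(1) _ _ _ _ assms(3)] assms(2) by auto
qed

lemma chart_vec_add:
  assumes "(U, \<phi>) \<in> \<A>" "y \<in> U"
  shows "chart_vec \<A> U \<phi> (b + b') y = chart_vec \<A> U \<phi> b y + chart_vec \<A> U \<phi> b' y"
  using linear_add[OF has_derivative_linear[OF smooth_near_differentiable[OF assms]]]
  by (auto simp: chart_vec_def fun_eq_iff)

lemma chart_vec_scale:
  assumes "(U, \<phi>) \<in> \<A>" "y \<in> U"
  shows "chart_vec \<A> U \<phi> (r *\<^sub>R b) y = r *\<^sub>t chart_vec \<A> U \<phi> b y"
  using linear_scale[OF has_derivative_linear[OF smooth_near_differentiable[OF assms]]]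
  by (auto simp: chart_vec_def fun_eq_iff)

lemma chart_vec_sum:
  assumes "(U, \<phi>) \<in> \<A>" "y \<in> U"
  shows "chart_vec \<A> U \<phi> (\<Sum>i\<in>A. b i) y = (\<Sum>i\<in>A. chart_vec \<A> U \<phi> (b i) y)"
  using linear_sum[OF has_derivative_linear[OF smooth_near_differentiable[OF assms]]]
  by (auto simp: chart_vec_def fun_eq_iff)

lemma chart_vec_coord:
  assumes "(U, \<phi>) \<in> \<A>" "y \<in> U"
  shows "chart_vec \<A> U \<phi> b y (\<lambda>z. \<phi> z \<bullet> e) = b \<bullet> e"
proof -
  have "((\<lambda>z. z \<bullet> e) has_derivative (\<lambda>b. b \<bullet> e)) (at (\<phi> y))"
    by (auto intro!: derivative_eq_intros)
  then have "(((\<lambda>z. \<phi> z \<bullet> e) \<circ> inv_into U \<phi>) has_derivative (\<lambda>b. b \<bullet> e)) (at (\<phi> y))"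
    by (rule has_derivative_transform_within_open[OF _ chart_open[OF assms(1)]])
      (use assms in \<open>auto simp: chart_inv[OF assms(1)]\<close>)
  then have "frechet_derivative ((\<lambda>z. \<phi> z \<bullet> e) \<circ> inv_into U \<phi>) (at (\<phi> y)) = (\<lambda>b. b \<bullet> e)"
    using frechet_derivative_at by metis
  then show ?thesis using smooth_near_chart[OF assms] by (simp add: chart_vec_def)
qed

text \<open>The witness is the straight line through the image of \<open>y\<close> in direction
  \<open>b\<close>, carried back by the chart; it stays in \<open>M\<close> by the last
  hypothesis.\<close>

lemma chart_vec_in_tangent_in:
  assumes "(U, \<phi>) \<in> \<A>" "y \<in> U" "\<delta> > 0" "\<And>t. \<bar>t\<bar> < \<delta> \<Longrightarrow> \<phi> y + t *\<^sub>R b \<in> \<phi> ` (U \<inter> M)"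
  shows "chart_vec \<A> U \<phi> b y \<in> tangent_in \<A> M y"
proof -
  let ?T = "{-\<delta><..<\<delta>}"
  let ?c = "\<lambda>t. inv_into U \<phi> (\<phi> y + t *\<^sub>R b)"
  have c: "\<phi> (?c t) = \<phi> y + t *\<^sub>R b" "?c t \<in> U \<inter> M" if "t \<in> ?T" for t
  proof -
    have "\<bar>t\<bar> < \<delta>" using that by auto
    then obtain z where "z \<in> U \<inter> M" "\<phi> y + t *\<^sub>R b = \<phi> z" using assms(4) by blast
    then show "\<phi> (?c t) = \<phi> y + t *\<^sub>R b" "?c t \<in> U \<inter> M" using chart_inv[OF assms(1)] by auto
  qed
  have sm: "smooth_on ?T (\<lambda>t. \<phi> y + t *\<^sub>R b)"
    by (intro smooth_on_add smooth_on_const smooth_on_scaleR smooth_on_ident) auto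
  then have sm: "smooth_on ?T (\<phi> \<circ> ?c)"
    by (rule smooth_on_eq) (auto simp: c)
  have curve: "smooth_curve \<A> ?T ?c"
    by (rule smooth_curveI[OF assms(1) _ _ sm]) (use c in auto)
  have c0: "?c 0 = y" using chart_inv[OF assms(1,2)] by simp
  have "((\<lambda>t. \<phi> y + t *\<^sub>R b) has_vector_derivative b) (at 0)"
    by (auto intro!: derivative_eq_intros)
  then have "((\<phi> \<circ> ?c) has_vector_derivative b) (at 0)"
    by (rule has_vector_derivative_transform_within_open[where S="?T"]) (use c assms(3) in auto)
  then have "velocity \<A> ?c = chart_vec \<A> U \<phi> b y"
    using velocity_eq_chart_vec(2)[OF curve _ _ assms(1)] c0 assms(2,3) vector_derivative_at by fastforce
  then show ?thesis using tangent_inI[OF assms(3) curve c0, of M] c by force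
qed

lemma chart_vec_in_tangent_space:
  assumes "(U, \<phi>) \<in> \<A>" "y \<in> U"
  shows "chart_vec \<A> U \<phi> b y \<in> tangent_space \<A> y"
proof -
  have "open ((\<lambda>t::real. \<phi> y + t *\<^sub>R b) -` (\<phi> ` U))"
    by (intro continuous_open_vimage[OF chart_open[OF assms(1)]] continuous_intros)
  then have "\<exists>\<delta>>0. \<forall>t. \<bar>t\<bar> < \<delta> \<longrightarrow> t \<in> (\<lambda>t::real. \<phi> y + t *\<^sub>R b) -` (\<phi> ` U)"
    using open_interval_around_0 assms(2) by (metis (no_types, lifting) add.right_neutral imageI scaleR_zero_left vimageI)
  then obtain \<delta> where "\<delta> > 0" "\<And>t. \<bar>t\<bar> < \<delta> \<Longrightarrow> t \<in> (\<lambda>t. \<phi> y + t *\<^sub>R b) -` (\<phi> ` U)"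
    by blast
  then show ?thesis
    using chart_carrier[OF assms(1)]
    by (intro chart_vec_in_tangent_in[OF assms, of \<delta>]) (auto simp: Int_absorb2)
qed

lemma tangent_space_chart_vec:
  assumes "(U, \<phi>) \<in> \<A>" "y \<in> U" "v \<in> tangent_space \<A> y"
  shows "v = chart_vec \<A> U \<phi> (\<Sum>e\<in>Basis. v (\<lambda>z. \<phi> z \<bullet> e) *\<^sub>R e) y"
proof -
  obtain c \<epsilon> where c: "v = velocity \<A> c" "\<epsilon> > 0" "smooth_curve \<A> {-\<epsilon><..<\<epsilon>} c" "c 0 = y"
    using tangent_inE[OF assms(3)] by metis
  then obtain b where b: "v = chart_vec \<A> U \<phi> b y"
    using velocity_eq_chart_vec(2)[OF c(3) _ _ assms(1)] assms(2) by auto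
  have "(\<Sum>e\<in>Basis. v (\<lambda>z. \<phi> z \<bullet> e) *\<^sub>R e) = b"
    unfolding b using chart_vec_coord[OF assms(1,2)] by (simp add: euclidean_representation)
  then show ?thesis using b by simp
qed

lemma tangent_space_eq_chart_vec:
  assumes "(U, \<phi>) \<in> \<A>" "y \<in> U"
  shows "tangent_space \<A> y = range (\<lambda>b. chart_vec \<A> U \<phi> b y)"
  using tangent_space_chart_vec[OF assms] chart_vec_in_tangent_space[OF assms] by auto

text \<open>In a slice chart \<open>M\<close> is cut out by linear equations, with \<open>E\<close>
  the set of their normal vectors. So the velocities of curves in \<open>M\<close> form a linear
  subspace, which the definition does not show.\<close>

lemma tangent_slice:
  assumes "(U, \<phi>) \<in> \<A>" "y \<in> U" "y \<in> M" "\<phi> ` (U \<inter> M) = \<phi> ` U \<inter> {b. \<forall>e\<in>E. b \<bullet> e = 0}"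
  shows "tangent_in \<A> M y = (\<lambda>b. chart_vec \<A> U \<phi> b y) ` {b. \<forall>e\<in>E. b \<bullet> e = 0}"
proof (intro equalityI subsetI)
  fix v assume "v \<in> tangent_in \<A> M y"
  then obtain c \<epsilon> where c: "v = velocity \<A> c" "\<epsilon> > 0" "smooth_curve \<A> {-\<epsilon><..<\<epsilon>} c" "c 0 = y"
    "c ` {-\<epsilon><..<\<epsilon>} \<subseteq> M" by (rule tangent_inE)
  obtain \<delta> where d: "0 < \<delta>" "\<delta> \<le> \<epsilon>" "c ` {-\<delta><..<\<delta>} \<subseteq> U"
    using smooth_curve_shrink[OF c(3,2) open_in_chart[OF assms(1)]] c(4) assms(2) by metis
  let ?b = "vector_derivative (\<phi> \<circ> c) (at 0)"
  note vel = velocity_eq_chart_vec[OF c(3) _ _ assms(1), unfolded c(4), OF _ _ assms(2)]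
  have b: "((\<phi> \<circ> c) has_vector_derivative ?b) (at 0)" "v = chart_vec \<A> U \<phi> ?b y"
    using vel(1,2) c(1,2) by auto
  \<comment> \<open>The curve stays in \<open>M\<close>, so near time 0 its product with
    \<open>e\<close> is constantly 0, and so is the derivative.\<close>
  have "?b \<bullet> e = 0" if "e \<in> E" for e
  proof -
    have h: "((\<lambda>t. (\<phi> \<circ> c) t \<bullet> e) has_vector_derivative ?b \<bullet> e) (at 0)"
      by (rule bounded_linear.has_vector_derivative[OF bounded_linear_inner_left b(1)])
    have z: "(\<phi> \<circ> c) t \<bullet> e = 0" if "t \<in> {-\<delta><..<\<delta>}" for t
    proof -
      have "c t \<in> U \<inter> M" using c(5) d that by (auto simp: image_subset_iff)
      then show ?thesis using assms(4) \<open>e \<in> E\<close> by auto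
    qed
    have "((\<lambda>t. 0) has_vector_derivative ?b \<bullet> e) (at 0)"
      by (rule has_vector_derivative_transform_within_open[where S="{-\<delta><..<\<delta>}", OF h])
        (simp_all only: z, use d(1) in auto)
    then show ?thesis using vector_derivative_unique_at has_vector_derivative_const by metis
  qed
  then show "v \<in> (\<lambda>b. chart_vec \<A> U \<phi> b y) ` {b. \<forall>e\<in>E. b \<bullet> e = 0}" using b(2) by blast
next
  fix v assume "v \<in> (\<lambda>b. chart_vec \<A> U \<phi> b y) ` {b. \<forall>e\<in>E. b \<bullet> e = 0}"
  then obtain b where b: "v = chart_vec \<A> U \<phi> b y" "\<forall>e\<in>E. b \<bullet> e = 0" by blast
  have "open ((\<lambda>t::real. \<phi> y + t *\<^sub>R b) -` (\<phi> ` U))"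
    by (intro continuous_open_vimage[OF chart_open[OF assms(1)]] continuous_intros)
  then have "\<exists>\<delta>>0. \<forall>t. \<bar>t\<bar> < \<delta> \<longrightarrow> t \<in> (\<lambda>t::real. \<phi> y + t *\<^sub>R b) -` (\<phi> ` U)"
    using open_interval_around_0 assms(2) by (metis (no_types, lifting) add.right_neutral imageI scaleR_zero_left vimageI)
  then obtain \<delta> where d: "\<delta> > 0" "\<And>t. \<bar>t\<bar> < \<delta> \<Longrightarrow> t \<in> (\<lambda>t. \<phi> y + t *\<^sub>R b) -` (\<phi> ` U)"
    by blast
  have "\<phi> y \<in> \<phi> ` (U \<inter> M)" using assms(2,3) by auto
  then have "\<forall>e\<in>E. (\<phi> y + t *\<^sub>R b) \<bullet> e = 0" for t using assms(4) b(2) by (simp add: inner_add_left)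
  then have "\<phi> y + t *\<^sub>R b \<in> \<phi> ` (U \<inter> M)" if "\<bar>t\<bar> < \<delta>" for t
    using d(2)[OF that] unfolding assms(4) by auto
  then show "v \<in> tangent_in \<A> M y" using chart_vec_in_tangent_in[OF assms(1,2) d(1)] b(1) by blast
qed

lemma tangent_space_add: "v \<in> tangent_space \<A> y \<Longrightarrow> w \<in> tangent_space \<A> y \<Longrightarrow> v + w \<in> tangent_space \<A> y"
  and tangent_space_scale: "v \<in> tangent_space \<A> y \<Longrightarrow> a *\<^sub>t v \<in> tangent_space \<A> y"
  and tangent_space_zero: "y \<in> carrier_of \<A> \<Longrightarrow> 0 \<in> tangent_space \<A> y"
proof -
  have "\<exists>U \<phi>. (U, \<phi>) \<in> \<A> \<and> y \<in> U" if "y \<in> carrier_of \<A>"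
    using carrierE[OF that] by metis
  note * = this[OF tangent_in_base(2)] this
  show scale: "a *\<^sub>t v \<in> tangent_space \<A> y" if "v \<in> tangent_space \<A> y" for a v
    using *(1)[OF that] that chart_vec_scale by (auto simp: tangent_space_eq_chart_vec) (metis rangeI)
  show "v + w \<in> tangent_space \<A> y" if "v \<in> tangent_space \<A> y" "w \<in> tangent_space \<A> y"
    using *(1)[OF that(1)] that chart_vec_add by (auto simp: tangent_space_eq_chart_vec) (metis rangeI)
  show "0 \<in> tangent_space \<A> y" if "y \<in> carrier_of \<A>"
    using *(2)[OF that] scale[of _ 0] chart_vec_in_tangent_space by fastforce
qed

lemma tangent_space_sum:
  "y \<in> carrier_of \<A> \<Longrightarrow> (\<And>i. i \<in> A \<Longrightarrow> v i \<in> tangent_space \<A> y) \<Longrightarrow> (\<Sum>i\<in>A. v i) \<in> tangent_space \<A> y"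
  by (induction A rule: infinite_finite_induct) (auto intro: tangent_space_zero tangent_space_add)

lemma tangent_space_uminus: "v \<in> tangent_space \<A> y \<Longrightarrow> - v \<in> tangent_space \<A> y"
  using tangent_space_scale[of v y "-1"] by simp

text \<open>\<open>v\<close> is the velocity of a curve inside \<open>M\<close>, so it sees only the
  restriction of a function to \<open>M\<close>. This is why the values of a section off
  \<open>M\<close> do not matter; with \<open>M\<close> the whole carrier it is locality.\<close>

lemma tangent_in_cong_on:
  assumes "v \<in> tangent_in \<A> M y" "open_in \<A> W" "y \<in> W"
    and "smooth_near \<A> y f" "smooth_near \<A> y h" "\<And>z. z \<in> W \<inter> M \<Longrightarrow> f z = h z"
  shows "v f = v h"
proof -
  obtain c \<epsilon> where c: "v = velocity \<A> c" "\<epsilon> > 0" "smooth_curve \<A> {-\<epsilon><..<\<epsilon>} c" "c 0 = y"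
    "c ` {-\<epsilon><..<\<epsilon>} \<subseteq> M" using tangent_inE[OF assms(1)] by metis
  obtain \<delta> where d: "0 < \<delta>" "\<delta> \<le> \<epsilon>" "c ` {-\<delta><..<\<delta>} \<subseteq> W"
    using smooth_curve_shrink[OF c(3,2) assms(2)] c(4) assms(3) by metis
  have "((f \<circ> c) has_real_derivative v f) (at 0)" "((h \<circ> c) has_real_derivative v h) (at 0)"
    using velocity_has_derivative[OF c(3,2)] c(1,4) assms(4,5) by auto
  moreover from this(1) have "((h \<circ> c) has_real_derivative v f) (at 0)"
    by (rule has_field_derivative_transform_within_open[where S="{-\<delta><..<\<delta>}"])
      (use c(5) d assms(6) in \<open>auto simp: image_subset_iff\<close>)
  ultimately show ?thesis using DERIV_unique by blast
qed

lemma tangent_const: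
  assumes "v \<in> tangent_space \<A> y"
  shows "v (\<lambda>z. c) = 0"
  using assms by (auto simp: tangent_in_def velocity_def comp_def)

section \<open>Vector fields\<close>

lemma smooth_vf_open: "smooth_vf \<A> W Y \<Longrightarrow> open_in \<A> W"
  and smooth_vf_tangent: "smooth_vf \<A> W Y \<Longrightarrow> y \<in> W \<Longrightarrow> Y y \<in> tangent_space \<A> y"
  unfolding smooth_vf_def by auto

lemma smooth_vf_fun:
  "smooth_vf \<A> W Y \<Longrightarrow> open_in \<A> W' \<Longrightarrow> W' \<subseteq> W \<Longrightarrow> smooth_fun \<A> W' f \<Longrightarrow> smooth_fun \<A> W' (\<lambda>y. Y y f)"
  unfolding smooth_vf_def by auto

lemma smooth_vf_subset: "smooth_vf \<A> W Y \<Longrightarrow> open_in \<A> W' \<Longrightarrow> W' \<subseteq> W \<Longrightarrow> smooth_vf \<A> W' Y"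
  unfolding smooth_vf_def by auto

lemma smooth_vf_add: "smooth_vf \<A> W Y \<Longrightarrow> smooth_vf \<A> W Z \<Longrightarrow> smooth_vf \<A> W (\<lambda>y. Y y + Z y)"
  unfolding smooth_vf_def by (auto intro!: tangent_space_add smooth_fun_add)

lemma smooth_vf_scale:
  "smooth_vf \<A> W Y \<Longrightarrow> smooth_fun \<A> W f \<Longrightarrow> smooth_vf \<A> W (\<lambda>y. f y *\<^sub>t Y y)"
  unfolding smooth_vf_def by (auto intro!: tangent_space_scale smooth_fun_mult intro: smooth_fun_subset)

lemma smooth_vf_sum:
  assumes "open_in \<A> W" "\<And>i. i \<in> A \<Longrightarrow> smooth_vf \<A> W (Y i)"
  shows "smooth_vf \<A> W (\<lambda>y. \<Sum>i\<in>A. Y i y)"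
proof -
  have "smooth_vf \<A> W (\<lambda>y. 0)"
    using assms(1) open_in_carrierD[OF assms(1)] smooth_fun_const[of _ 0]
    by (auto simp: smooth_vf_def intro!: tangent_space_zero)
  then show ?thesis
    using assms(2) by (induction A rule: infinite_finite_induct) (auto intro: smooth_vf_add)
qed

lemma smooth_vf_uminus: "smooth_vf \<A> W Y \<Longrightarrow> smooth_vf \<A> W (\<lambda>y. - Y y)"
  using smooth_vf_scale[of W Y "\<lambda>_. -1"] smooth_fun_const by simp

lemma smooth_vf_chart_vec:
  assumes "(U, \<phi>) \<in> \<A>"
  shows "smooth_vf \<A> U (chart_vec \<A> U \<phi> b)"
  unfolding smooth_vf_def
proof (intro conjI allI impI ballI)
  show "open_in \<A> U" by (rule open_in_chart[OF assms])
  show "chart_vec \<A> U \<phi> b y \<in> tangent_space \<A> y" if "y \<in> U" for y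
    using chart_vec_in_tangent_space[OF assms that] .
  fix W f assume W: "open_in \<A> W \<and> W \<subseteq> U \<and> smooth_fun \<A> W f"
  then have op: "open (\<phi> ` W)" using open_in_chartD[OF _ assms, of W] by (simp add: Int_absorb2)
  have "smooth_on (\<phi> ` W) (f \<circ> inv_into U \<phi>)"
    using smooth_funD[OF _ assms, of W f] W by (simp add: Int_absorb2)
  then have "smooth_on (\<phi> ` W) (\<lambda>z. frechet_derivative (f \<circ> inv_into U \<phi>) (at z) b)"
    by (rule smooth_on_derivative)
  then have "smooth_on (\<phi> ` W) ((\<lambda>y. chart_vec \<A> U \<phi> b y f) \<circ> inv_into U \<phi>)"
  proof (rule smooth_on_eq[OF _ _ op])
    fix z assume "z \<in> \<phi> ` W"
    then obtain y where y: "y \<in> W" "z = \<phi> y" by blast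
    then have "inv_into U \<phi> z = y" using W chart_inv[OF assms] by auto
    moreover have "smooth_near \<A> y f" using smooth_nearI[OF _ y(1)] W by blast
    ultimately show "frechet_derivative (f \<circ> inv_into U \<phi>) (at z) b = ((\<lambda>y. chart_vec \<A> U \<phi> b y f) \<circ> inv_into U \<phi>) z"
      using y by (simp add: chart_vec_def)
  qed
  then show "smooth_fun \<A> W (\<lambda>y. chart_vec \<A> U \<phi> b y f)"
    using smooth_fun_chartI[OF assms _ op] W by blast
qed

end

section \<open>Adding a compatible chart\<close>

text \<open>A slice chart for \<open>M\<close> need not belong to the atlas, it is only compatible
  with it. Adding one compatible chart changes none of the notions that enter the construction of
  local frames, so there the slice chart may be treated as a member of the atlas.\<close>

locale compatible_chart = ins: atlas_manifold "insert (U0, \<phi>0) \<A>"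
  for \<A> :: "('a, 'e::euclidean_space) chart set" and U0 :: "'a set" and \<phi>0 :: "'a \<Rightarrow> 'e" +
  assumes U0: "U0 \<subseteq> carrier_of \<A>"
begin

abbreviation "\<A>' \<equiv> insert (U0, \<phi>0) \<A>"

sublocale atlas_manifold \<A>
proof unfold_locales
  show "smooth_atlas \<A>" using ins.atlas unfolding smooth_atlas_def by blast
qed

lemma carrier_of_insert: "carrier_of \<A>' = carrier_of \<A>"
  using U0 unfolding carrier_of_def by auto

lemma open_in_insert: "open_in \<A>' W \<longleftrightarrow> open_in \<A> W"
proof
  assume "open_in \<A>' W"
  then show "open_in \<A> W" unfolding open_in_def carrier_of_insert by auto
next
  assume W: "open_in \<A> W"
  \<comment> \<open>\<open>W\<close> is cut into pieces inside old chart domains. Such a piece is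
    open in one chart, hence open for the enlarged atlas, and so has an open image under the new
    chart.\<close>
  have "open (\<phi>0 ` ((W \<inter> fst C) \<inter> U0))" if "C \<in> \<A>" for C
  proof -
    obtain V \<psi> where C: "C = (V, \<psi>)" by force
    then have "open (\<psi> ` (W \<inter> V))" using open_in_chartD[OF W] that by auto
    then have "open_in \<A>' (W \<inter> V)"
      using ins.open_in_chartI[of V \<psi> "W \<inter> V"] that C by auto
    then show ?thesis using ins.open_in_chartD[of "W \<inter> V" U0 \<phi>0] C by simp
  qed
  then have "open (\<Union>C\<in>\<A>. \<phi>0 ` ((W \<inter> fst C) \<inter> U0))" by blast
  moreover have "(\<Union>C\<in>\<A>. \<phi>0 ` ((W \<inter> fst C) \<inter> U0)) = \<phi>0 ` (W \<inter> U0 \<inter> (\<Union>C\<in>\<A>. fst C))"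
    by blast
  moreover have "W \<inter> U0 \<inter> (\<Union>C\<in>\<A>. fst C) = W \<inter> U0"
    using U0 unfolding carrier_of_def split_def by blast
  ultimately have "open (\<phi>0 ` (W \<inter> U0))" by simp
  then show "open_in \<A>' W"
    using W unfolding open_in_def carrier_of_insert by auto
qed

lemma smooth_fun_insert:
  assumes "open_in \<A> W"
  shows "smooth_fun \<A>' W f \<longleftrightarrow> smooth_fun \<A> W f"
proof
  show "smooth_fun \<A> W f" if "smooth_fun \<A>' W f"
    using that unfolding smooth_fun_def by auto
next
  assume f: "smooth_fun \<A> W f"
  show "smooth_fun \<A>' W f"
  proof (rule ins.smooth_fun_local)
    fix y assume y: "y \<in> W"
    then obtain V \<psi> where V: "(V, \<psi>) \<in> \<A>" "y \<in> V"
      using carrierE open_in_carrierD[OF assms] by blast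
    have op: "open_in \<A> (W \<inter> V)" using open_in_Int[OF assms open_in_chart[OF V(1)]] .
    have "smooth_fun \<A>' (W \<inter> V) f"
      using V(1) open_in_chartD[OF assms V(1)] smooth_funD[OF f V(1)]
      by (intro ins.smooth_fun_chartI[of V \<psi>]) auto
    then show "\<exists>W'. open_in \<A>' W' \<and> y \<in> W' \<and> smooth_fun \<A>' W' f"
      using op y V(2) open_in_insert by blast
  qed
qed

lemma smooth_near_insert: "smooth_near \<A>' = smooth_near \<A>"
  unfolding smooth_near_def fun_eq_iff using open_in_insert smooth_fun_insert by blast

lemma smooth_curve_insert: "smooth_curve \<A>' T c \<longleftrightarrow> smooth_curve \<A> T c"
proof
  show "smooth_curve \<A> T c" if "smooth_curve \<A>' T c"
    using that unfolding smooth_curve_def carrier_of_insert by auto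
next
  assume c: "smooth_curve \<A> T c"
  have U: "open_in \<A> U0" using ins.open_in_chart[of U0 \<phi>0] open_in_insert by auto
  have op: "open (T \<inter> c -` U0)" using smooth_curve_vimage_open[OF c U] .
  \<comment> \<open>The coordinates of the new chart are smooth functions for the old atlas, so a
    smooth curve is smooth in them.\<close>
  moreover have "smooth_on (T \<inter> c -` U0) (\<phi>0 \<circ> c)"
  proof (rule smooth_on_euclidean[OF op])
    fix b :: 'e
    have "smooth_fun \<A> U0 (\<lambda>y. \<phi>0 y \<bullet> b)"
      using ins.smooth_fun_chart[of U0 \<phi>0 b] smooth_fun_insert[OF U] by simp
    from smooth_curve_fun[OF c U this]
    show "smooth_on (T \<inter> c -` U0) (\<lambda>t. (\<phi>0 \<circ> c) t \<bullet> b)" by (simp add: comp_def)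
  qed
  ultimately show "smooth_curve \<A>' T c"
    using c unfolding smooth_curve_def carrier_of_insert by auto
qed

lemma tangent_in_insert: "tangent_in \<A>' = tangent_in \<A>"
  unfolding tangent_in_def velocity_def smooth_curve_insert smooth_near_insert ..

lemma smooth_vf_insert: "smooth_vf \<A>' W Y \<longleftrightarrow> smooth_vf \<A> W Y"
  unfolding smooth_vf_def tangent_in_insert carrier_of_insert open_in_insert
  using smooth_fun_insert by auto

lemma riemannian_metric_insert:
  "riemannian_metric \<A>' g \<longleftrightarrow> riemannian_metric \<A> g"
  unfolding riemannian_metric_def tangent_in_insert carrier_of_insert smooth_vf_insert
  by (intro arg_cong2[where f="(\<and>)"] all_cong1 imp_cong refl) (auto simp: smooth_fun_insert smooth_vf_open)

end

section \<open>Riemannian metrics and local orthonormal frames\<close>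

definition tvec_subspace :: "'a tvec set \<Rightarrow> bool" where
  "tvec_subspace S \<longleftrightarrow> 0 \<in> S \<and> (\<forall>v\<in>S. \<forall>w\<in>S. v + w \<in> S) \<and> (\<forall>a. \<forall>v\<in>S. a *\<^sub>t v \<in> S)"

lemma tvec_subspace_add: "tvec_subspace S \<Longrightarrow> v \<in> S \<Longrightarrow> w \<in> S \<Longrightarrow> v + w \<in> S"
  and tvec_subspace_scale: "tvec_subspace S \<Longrightarrow> v \<in> S \<Longrightarrow> a *\<^sub>t v \<in> S"
  and tvec_subspace_zero: "tvec_subspace S \<Longrightarrow> 0 \<in> S"
  by (auto simp: tvec_subspace_def)

lemma tvec_subspace_diff: "tvec_subspace S \<Longrightarrow> v \<in> S \<Longrightarrow> w \<in> S \<Longrightarrow> v - w \<in> S"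
  using tvec_subspace_add[of S v "(-1) *\<^sub>t w"] tvec_subspace_scale[of S w "-1"] by simp

lemma tvec_subspace_sum: "tvec_subspace S \<Longrightarrow> (\<And>i. i \<in> A \<Longrightarrow> v i \<in> S) \<Longrightarrow> (\<Sum>i\<in>A. v i) \<in> S"
  by (induction A rule: infinite_finite_induct) (auto intro: tvec_subspace_zero tvec_subspace_add)

section \<open>Linear combinations of the vectors of a frame\<close>

lemma frame_map_add: "frame_map u (a + b) = frame_map u a + frame_map u b"
  and frame_map_scale: "frame_map u (r *\<^sub>R a) = r *\<^sub>t frame_map u a"
  by (simp_all add: frame_map_def tscale_distrib sum.distrib tscale_sum)

lemma frame_map_zero: "frame_map u 0 = 0"
  by (simp add: frame_map_def)

lemma tscale_if: "(if P then a else b) *\<^sub>t v = (if P then a *\<^sub>t v else b *\<^sub>t v)"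
  by simp

lemma frame_map_axis: "frame_map u (axis i r) = r *\<^sub>t u i"
  by (simp add: frame_map_def axis_def tscale_if cong: if_cong)

lemma frame_map_subset:
  "frame_map u a = (\<Sum>j\<in>J. (a $ j) *\<^sub>t u j)" if "\<forall>j\<in>-J. a $ j = 0" for u :: "'m::finite \<Rightarrow> 'a tvec"
  unfolding frame_map_def by (rule sum.mono_neutral_right) (use that in auto)

abbreviation coord_subspace :: "'m set \<Rightarrow> (real ^ 'm::finite) set" where
  "coord_subspace I \<equiv> {a. \<forall>j\<in>-I. a $ j = 0}"

lemma tvec_subspace_frame_map: "tvec_subspace (frame_map u ` coord_subspace I)"
  unfolding tvec_subspace_def
proof (intro conjI ballI allI)
  show "0 \<in> frame_map u ` coord_subspace I"
    by (rule image_eqI[of _ _ 0]) (auto simp: frame_map_zero)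
  fix v assume "v \<in> frame_map u ` coord_subspace I"
  then obtain a where a: "v = frame_map u a" "a \<in> coord_subspace I" by blast
  show "r *\<^sub>t v \<in> frame_map u ` coord_subspace I" for r
    by (rule image_eqI[of _ _ "r *\<^sub>R a"]) (use a in \<open>auto simp: frame_map_scale\<close>)
  fix w assume "w \<in> frame_map u ` coord_subspace I"
  then obtain b where b: "w = frame_map u b" "b \<in> coord_subspace I" by blast
  show "v + w \<in> frame_map u ` coord_subspace I"
    by (rule image_eqI[of _ _ "a + b"]) (use a b in \<open>auto simp: frame_map_add\<close>)
qed

lemma frame_map_in_subspace: "tvec_subspace S \<Longrightarrow> (\<And>j. j \<in> I \<Longrightarrow> u j \<in> S) \<Longrightarrow> a \<in> coord_subspace I \<Longrightarrow> frame_map u a \<in> S"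
  by (subst frame_map_subset[of I]) (auto intro!: tvec_subspace_sum tvec_subspace_scale)

locale riemannian_manifold = atlas_manifold \<A>
  for \<A> :: "('a, 'e::euclidean_space) chart set" +
  fixes g :: "'a metric"
  assumes metric: "riemannian_metric \<A> g"
begin

lemma metric_sym: "v \<in> tangent_space \<A> y \<Longrightarrow> w \<in> tangent_space \<A> y \<Longrightarrow> g y v w = g y w v"
  and metric_scale: "v \<in> tangent_space \<A> y \<Longrightarrow> w \<in> tangent_space \<A> y \<Longrightarrow> g y (a *\<^sub>t v) w = a * g y v w"
  and metric_add: "v \<in> tangent_space \<A> y \<Longrightarrow> v' \<in> tangent_space \<A> y \<Longrightarrow> w \<in> tangent_space \<A> y \<Longrightarrow>
    g y (v + v') w = g y v w + g y v' w"
  using metric tangent_in_base(2)[of v \<A> "carrier_of \<A>" y] unfolding riemannian_metric_def by blast+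

lemma metric_smooth: "smooth_vf \<A> W Y \<Longrightarrow> smooth_vf \<A> W Z \<Longrightarrow> smooth_fun \<A> W (\<lambda>y. g y (Y y) (Z y))"
  using metric unfolding riemannian_metric_def by simp

lemma metric_zero: "w \<in> tangent_space \<A> y \<Longrightarrow> g y 0 w = 0"
  using metric_scale[of w y w 0] by simp

lemma metric_diff:
  "v \<in> tangent_space \<A> y \<Longrightarrow> v' \<in> tangent_space \<A> y \<Longrightarrow> w \<in> tangent_space \<A> y \<Longrightarrow>
    g y (v - v') w = g y v w - g y v' w"
  using metric_add[of v y "(-1) *\<^sub>t v'" w] metric_scale[of v' y w "-1"] tangent_space_uminus[of v' y] by simp

lemma metric_sum:
  assumes "w \<in> tangent_space \<A> y" "\<And>i. i \<in> A \<Longrightarrow> v i \<in> tangent_space \<A> y"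
  shows "g y (\<Sum>i\<in>A. v i) w = (\<Sum>i\<in>A. g y (v i) w)"
  using assms(2)
proof (induction A rule: infinite_finite_induct)
  case (insert i A)
  then have "(\<Sum>i\<in>A. v i) \<in> tangent_space \<A> y"
    by (intro tangent_space_sum tangent_in_base(2)[OF assms(1)]) auto
  then have "g y (v i + (\<Sum>i\<in>A. v i)) w = g y (v i) w + g y (\<Sum>i\<in>A. v i) w"
    using insert.prems by (intro metric_add assms(1)) auto
  moreover have "g y (\<Sum>i\<in>A. v i) w = (\<Sum>i\<in>A. g y (v i) w)"
    using insert.IH insert.prems by blast
  ultimately show ?case by (simp only: sum.insert[OF insert.hyps])
qed (simp_all add: metric_zero[OF assms(1)])

lemma metric_frame_map:
  assumes "\<And>i j. g y (u i) (u j) = (if i = j then 1 else 0)" "\<And>i. u i \<in> tangent_space \<A> y"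
  shows "g y (frame_map u a) (u k) = a $ k" "g y (u k) (frame_map u a) = a $ k"
proof -
  show *: "g y (frame_map u a) (u k) = a $ k"
    unfolding frame_map_def
    by (subst metric_sum) (auto simp: metric_scale assms tangent_space_scale if_distrib[of "(*) _"] cong: if_cong)
  have "frame_map u a \<in> tangent_space \<A> y" unfolding frame_map_def
    by (intro tangent_space_sum tangent_space_scale assms(2) tangent_in_base(2)[OF assms(2)])
  then show "g y (u k) (frame_map u a) = a $ k" using * metric_sym assms(2) by metis
qed

text \<open>By the last conjunct, the two families span the same subspace at every point of \<open>W\<close>.\<close>

definition orthonormalization :: "'a \<Rightarrow> ('m \<Rightarrow> 'a \<Rightarrow> 'a tvec) \<Rightarrow> 'm set \<Rightarrow> ('m \<Rightarrow> 'a \<Rightarrow> 'a tvec) \<Rightarrow> 'a set \<Rightarrow> bool" where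
  "orthonormalization x e J \<sigma> W \<longleftrightarrow>
     open_in \<A> W \<and> x \<in> W \<and> (\<forall>j\<in>J. smooth_vf \<A> W (\<sigma> j)) \<and>
     (\<forall>y\<in>W. \<forall>i\<in>J. \<forall>j\<in>J. g y (\<sigma> i y) (\<sigma> j y) = (if i = j then 1 else 0)) \<and>
     (\<forall>j\<in>J. \<sigma> j x = e j x) \<and>
     (\<forall>y\<in>W. \<forall>S. tvec_subspace S \<longrightarrow> (\<forall>j\<in>J. \<sigma> j y \<in> S) \<longleftrightarrow> (\<forall>j\<in>J. e j y \<in> S))"

text \<open>At \<open>x\<close> the next vector is already a unit vector orthogonal to the earlier
  ones, so the step leaves it unchanged there and prescribed values at \<open>x\<close> survive. By
  continuity its remainder stays nonzero near \<open>x\<close>, and \<open>W\<close> is shrunk to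
  that region.\<close>

lemma gram_schmidt_step:
  fixes e :: "'m::finite \<Rightarrow> 'a \<Rightarrow> 'a tvec"
  assumes on: "orthonormalization x e J \<sigma> W" and "k \<notin> J" and ek: "smooth_vf \<A> W (e k)"
    and gx: "\<And>i j. g x (e i x) (e j x) = (if i = j then 1 else 0)"
  obtains W' s where "W' \<subseteq> W" "orthonormalization x e (insert k J) (\<sigma>(k := s)) W'"
proof -
  have W: "open_in \<A> W" "x \<in> W" and sm: "\<And>j. j \<in> J \<Longrightarrow> smooth_vf \<A> W (\<sigma> j)"
    and orth: "\<And>y i j. y \<in> W \<Longrightarrow> i \<in> J \<Longrightarrow> j \<in> J \<Longrightarrow> g y (\<sigma> i y) (\<sigma> j y) = (if i = j then 1 else 0)"
    and at_x: "\<And>j. j \<in> J \<Longrightarrow> \<sigma> j x = e j x"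
    and sub: "\<And>y S. y \<in> W \<Longrightarrow> tvec_subspace S \<Longrightarrow> (\<forall>j\<in>J. \<sigma> j y \<in> S) \<longleftrightarrow> (\<forall>j\<in>J. e j y \<in> S)"
    using on unfolding orthonormalization_def by blast+
  \<comment> \<open>\<open>P\<close> is the projection of \<open>e k\<close> onto the span of the
    vectors built so far, \<open>V\<close> the remainder to be normalised.\<close>
  define P where "P y = (\<Sum>j\<in>J. g y (e k y) (\<sigma> j y) *\<^sub>t \<sigma> j y)" for y
  define V where "V y = e k y - P y" for y
  have smP: "smooth_vf \<A> W P"
    unfolding P_def by (intro smooth_vf_sum[OF W(1)] smooth_vf_scale sm metric_smooth ek)
  have smV: "smooth_vf \<A> W V"
    unfolding V_def using smooth_vf_add[OF ek smooth_vf_uminus[OF smP]] by simp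
  define q where "q y = g y (V y) (V y)" for y
  have smq: "smooth_fun \<A> W q" unfolding q_def by (intro metric_smooth smV)
  \<comment> \<open>Positivity of \<open>q\<close> is an open condition and is what
    \<open>powr\<close> with exponent -1/2 needs; it holds at \<open>x\<close>, where
    \<open>q\<close> is 1.\<close>
  define W' where "W' = {y \<in> W. q y \<in> {0<..}}"
  have W': "open_in \<A> W'" "W' \<subseteq> W"
    unfolding W'_def by (intro open_in_preimage[OF W(1) smq]) auto
  have "g x (e k x) (\<sigma> j x) = 0" if "j \<in> J" for j
    using at_x[OF that] gx assms(2) that by auto
  then have "P x = 0" unfolding P_def by (intro sum.neutral) auto
  then have Vx: "V x = e k x" "q x = 1" using gx by (auto simp: V_def q_def)
  define s where "s y = (q y powr (-1/2)) *\<^sub>t V y" for y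
  have sms: "smooth_vf \<A> W' s"
    unfolding s_def
    by (intro smooth_vf_scale smooth_vf_subset[OF smV] W'
        smooth_fun_compose[OF _ smooth_fun_subset[OF smq] smooth_on_powr]) (auto simp: W'_def)
  have tan: "\<sigma> j y \<in> tangent_space \<A> y" "V y \<in> tangent_space \<A> y" "e k y \<in> tangent_space \<A> y" "P y \<in> tangent_space \<A> y"
    if "y \<in> W" "j \<in> J" for y j
    using smooth_vf_tangent sm smV ek smP that by blast+
  have tanV: "V y \<in> tangent_space \<A> y" if "y \<in> W" for y
    using smooth_vf_tangent[OF smV that] .
  have Vorth: "g y (V y) (\<sigma> j y) = 0" if y: "y \<in> W" and j: "j \<in> J" for y j
  proof -
    have "g y (P y) (\<sigma> j y) = (\<Sum>i\<in>J. g y (g y (e k y) (\<sigma> i y) *\<^sub>t \<sigma> i y) (\<sigma> j y))"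
      unfolding P_def by (rule metric_sum) (use tan y j tangent_space_scale in auto)
    also have "\<dots> = (\<Sum>i\<in>J. if i = j then g y (e k y) (\<sigma> j y) else 0)"
      by (rule sum.cong) (use tan y j orth in \<open>auto simp: metric_scale\<close>)
    also have "\<dots> = g y (e k y) (\<sigma> j y)" using j by simp
    finally show ?thesis unfolding V_def using tan[OF y j] by (simp add: metric_diff)
  qed
  have sorth: "g y (s y) (\<sigma> j y) = 0" "g y (\<sigma> j y) (s y) = 0" if "y \<in> W" "j \<in> J" for y j
  proof -
    show "g y (s y) (\<sigma> j y) = 0" unfolding s_def using tan[OF that] Vorth[OF that] by (simp add: metric_scale)
    then show "g y (\<sigma> j y) (s y) = 0" using metric_sym tan[OF that] tangent_space_scale by (metis s_def)
  qed
  have sunit: "g y (s y) (s y) = 1" if "y \<in> W'" for y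
  proof -
    have y: "y \<in> W" "q y > 0" using that by (auto simp: W'_def)
    have "g y (s y) (s y) = (q y powr (-1/2)) * g y (V y) (s y)"
      unfolding s_def using tanV[OF y(1)] tangent_space_scale by (simp add: metric_scale)
    also have "g y (V y) (s y) = g y (s y) (V y)"
      unfolding s_def using tanV[OF y(1)] tangent_space_scale metric_sym by blast
    also have "g y (s y) (V y) = (q y powr (-1/2)) * q y"
      unfolding s_def q_def using tanV[OF y(1)] by (simp add: metric_scale)
    finally show ?thesis using y(2) by (simp add: powr_minus powr_half_sqrt field_simps)
  qed
  \<comment> \<open>Up to a combination of the earlier vectors, \<open>s\<close> and
    \<open>e k\<close> differ by a positive factor, so they lie in the same subspaces among those
    containing the earlier vectors.\<close>
  have sS: "s y \<in> S \<longleftrightarrow> e k y \<in> S" if y: "y \<in> W'" and S: "tvec_subspace S" and J: "\<forall>j\<in>J. \<sigma> j y \<in> S" for y S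
  proof -
    have P: "P y \<in> S" unfolding P_def using S J by (intro tvec_subspace_sum tvec_subspace_scale) auto
    have "V y = (q y powr (1/2)) *\<^sub>t s y"
      unfolding s_def using y by (simp add: powr_add[symmetric] W'_def)
    then have "s y \<in> S \<longleftrightarrow> V y \<in> S" using tvec_subspace_scale[OF S] s_def by metis
    also have "\<dots> \<longleftrightarrow> e k y \<in> S"
      using tvec_subspace_add[OF S _ P, of "V y"] tvec_subspace_diff[OF S _ P, of "e k y"] by (auto simp: V_def)
    finally show ?thesis .
  qed
  have "orthonormalization x e (insert k J) (\<sigma>(k := s)) W'"
    unfolding orthonormalization_def
  proof (intro conjI)
    show "\<forall>y\<in>W'. \<forall>S. tvec_subspace S \<longrightarrow> (\<forall>j\<in>insert k J. (\<sigma>(k := s)) j y \<in> S) \<longleftrightarrow> (\<forall>j\<in>insert k J. e j y \<in> S)"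
    proof (intro ballI allI impI)
      fix y and S :: "'a tvec set" assume yS: "y \<in> W'" "tvec_subspace S"
      have "(\<forall>j\<in>insert k J. (\<sigma>(k := s)) j y \<in> S) \<longleftrightarrow> s y \<in> S \<and> (\<forall>j\<in>J. \<sigma> j y \<in> S)"
        using assms(2) by auto
      then show "(\<forall>j\<in>insert k J. (\<sigma>(k := s)) j y \<in> S) \<longleftrightarrow> (\<forall>j\<in>insert k J. e j y \<in> S)"
        using sS[OF yS] sub[of y S] yS W'(2) by blast
    qed
    show "\<forall>j\<in>insert k J. smooth_vf \<A> W' ((\<sigma>(k := s)) j)"
      using sms smooth_vf_subset[OF sm W'] by auto
    show "\<forall>y\<in>W'. \<forall>i\<in>insert k J. \<forall>j\<in>insert k J. g y ((\<sigma>(k := s)) i y) ((\<sigma>(k := s)) j y) = (if i = j then 1 else 0)"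
      using sorth sunit orth W'(2) by (auto simp: subset_iff)
    show "\<forall>j\<in>insert k J. (\<sigma>(k := s)) j x = e j x" using at_x Vx by (auto simp: s_def)
    show "x \<in> W'" using W(2) Vx(2) by (simp add: W'_def)
  qed (fact W')
  then show thesis using that W'(2) by blast
qed

text \<open>Vectors already treated are kept, so the process can be run first on the indices in
  \<open>I\<close> and then on the others. This order keeps the span of the first block equal to the
  tangent space along \<open>M\<close>.\<close>

lemma gram_schmidt:
  fixes e :: "'m::finite \<Rightarrow> 'a \<Rightarrow> 'a tvec"
  assumes "orthonormalization x e J \<sigma> W" "J \<inter> K = {}" "\<And>k. smooth_vf \<A> W (e k)"
    and "\<And>i j. g x (e i x) (e j x) = (if i = j then 1 else 0)"
  shows "\<exists>W' \<sigma>'. W' \<subseteq> W \<and> orthonormalization x e (J \<union> K) \<sigma>' W' \<and> (\<forall>j\<in>J. \<sigma>' j = \<sigma> j)"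
proof -
  have "finite K" by simp
  then show ?thesis
    using assms(2)
  proof (induction K)
    case empty
    then show ?case using assms(1) by auto
  next
    case (insert k K)
    then obtain W1 \<sigma>1 where 1: "W1 \<subseteq> W" "orthonormalization x e (J \<union> K) \<sigma>1 W1" "\<forall>j\<in>J. \<sigma>1 j = \<sigma> j"
      by auto
    have "smooth_vf \<A> W1 (e k)"
      using smooth_vf_subset[OF assms(3) _ 1(1)] 1(2) unfolding orthonormalization_def by blast
    then obtain W2 s where "W2 \<subseteq> W1" "orthonormalization x e (insert k (J \<union> K)) (\<sigma>1(k := s)) W2"
      using gram_schmidt_step[OF 1(2) _ _ assms(4), of k] insert.hyps(2) insert.prems by blast
    moreover have "\<forall>j\<in>J. (\<sigma>1(k := s)) j = \<sigma> j" using 1(3) insert.prems by auto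
    ultimately show ?case using 1(1) by (metis Un_insert_right subset_trans)
  qed
qed

end

section \<open>Local orthonormal frames adapted to a submanifold\<close>

text \<open>Adaptedness is stated as an equality of spaces, so that the components outside
  \<open>I\<close> of a vector tangent to \<open>M\<close> can be read off as zero.\<close>

definition local_frame ::
    "('a, real ^ 'm::finite) chart set \<Rightarrow> 'a metric \<Rightarrow> 'a set \<Rightarrow> 'm set \<Rightarrow> 'a set \<Rightarrow>
     ('m \<Rightarrow> 'a \<Rightarrow> 'a tvec) \<Rightarrow> bool" where
  "local_frame \<A> g M I W \<sigma> \<longleftrightarrow>
     open_in \<A> W \<and> (\<forall>j. smooth_vf \<A> W (\<sigma> j)) \<and>
     (\<forall>y\<in>W. \<forall>i j. g y (\<sigma> i y) (\<sigma> j y) = (if i = j then 1 else 0)) \<and>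
     (\<forall>y\<in>W. tangent_space \<A> y = range (frame_map (\<lambda>j. \<sigma> j y))) \<and>
     (\<forall>y\<in>W \<inter> M. tangent_in \<A> M y = frame_map (\<lambda>j. \<sigma> j y) ` coord_subspace I)"

text \<open>The hypothesis says that the two families have the same span. It is applied with
  \<open>S\<close> the span of the other family.\<close>

lemma frame_map_image_eq:
  fixes u w :: "'m::finite \<Rightarrow> 'a tvec"
  assumes "\<And>S. tvec_subspace S \<Longrightarrow> (\<forall>j\<in>J. u j \<in> S) \<longleftrightarrow> (\<forall>j\<in>J. w j \<in> S)"
  shows "frame_map u ` coord_subspace J = frame_map w ` coord_subspace J"
proof -
  have "frame_map u ` coord_subspace J \<subseteq> frame_map w ` coord_subspace J"
    if "\<And>S. tvec_subspace S \<Longrightarrow> (\<forall>j\<in>J. u j \<in> S) \<longleftrightarrow> (\<forall>j\<in>J. w j \<in> S)" for u w :: "'m \<Rightarrow> 'a tvec"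
  proof -
    let ?S = "frame_map w ` coord_subspace J"
    have "w j \<in> ?S" if "j \<in> J" for j
    proof (rule image_eqI)
      show "w j = frame_map w (axis j 1)" by (simp add: frame_map_axis)
    qed (use that in \<open>auto simp: axis_def\<close>)
    then have "\<forall>j\<in>J. u j \<in> ?S" using that[OF tvec_subspace_frame_map] by blast
    then show ?thesis
      using frame_map_in_subspace[OF tvec_subspace_frame_map[of w J], of J u] by (intro image_subsetI) simp
  qed
  from this[of u w] this[of w u] show ?thesis using assms by blast
qed

locale vec_manifold = atlas_manifold \<A> for \<A> :: "('a, real ^ 'm::finite) chart set"

locale vec_riemannian_manifold = vec_manifold \<A> + riemannian_manifold \<A> g
  for \<A> :: "('a, real ^ 'm::finite) chart set" and g :: "'a metric"

text \<open>The chart components of the \<open>u j\<close> are frozen to give fields with constant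
  coefficients. These are adapted along the whole slice because the slice is linear; Gram-Schmidt
  then makes them orthonormal without changing their values at \<open>x\<close>.\<close>

lemma (in vec_riemannian_manifold) ex_local_frame_slice:
  assumes U: "(U, \<phi>) \<in> \<A>" "x \<in> U" and slice: "\<phi> ` (U \<inter> M) = \<phi> ` U \<inter> coord_subspace I"
    and xM: "x \<in> M" and u: "\<And>j. u j \<in> tangent_space \<A> x" "\<And>i. i \<in> I \<Longrightarrow> u i \<in> tangent_in \<A> M x"
    and orth: "\<And>i j. g x (u i) (u j) = (if i = j then 1 else 0)"
  obtains W \<sigma> where "x \<in> W" "W \<subseteq> U" "local_frame \<A> g M I W \<sigma>" "\<And>j. \<sigma> j x = u j"
proof -
  let ?v = "chart_vec \<A> U \<phi>"
  have coord: "coord_subspace J = {b. \<forall>e\<in>(\<lambda>j. axis j 1) ` (- J). b \<bullet> e = 0}" for J :: "'m set"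
    by (auto simp: inner_axis)
  have TM: "tangent_in \<A> M y = (\<lambda>b. ?v b y) ` coord_subspace I" if "y \<in> U" "y \<in> M" for y
    using tangent_slice[OF U(1) that, of "(\<lambda>j. axis j 1) ` (- I)"] slice unfolding coord by blast
  have TN: "tangent_space \<A> y = (\<lambda>b. ?v b y) ` coord_subspace UNIV" if "y \<in> U" for y
    using tangent_space_eq_chart_vec[OF U(1) that] by simp
  \<comment> \<open>A vector tangent to \<open>M\<close> gets components within the slice
    directions, so that its frozen field is tangent to \<open>M\<close> at every point of the
    slice.\<close>
  have "\<exists>b. u j = ?v b x \<and> (j \<in> I \<longrightarrow> b \<in> coord_subspace I)" for j
    using u(1)[of j] u(2)[of j] unfolding TM[OF U(2) xM] TN[OF U(2)] by (cases "j \<in> I") blast+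
  then have "\<exists>b. \<forall>j. u j = ?v (b j) x \<and> (j \<in> I \<longrightarrow> b j \<in> coord_subspace I)"
    by (intro choice allI)
  then obtain b where b: "\<And>j. u j = ?v (b j) x" "\<And>j. j \<in> I \<Longrightarrow> b j \<in> coord_subspace I"
    by blast
  define e where "e j y = ?v (b j) y" for j y
  define F where "F a = (\<Sum>j\<in>UNIV. (a $ j) *\<^sub>R b j)" for a :: "real ^ 'm"
  have linF: "linear F"
    unfolding F_def by (rule linearI) (simp_all add: scaleR_add_left sum.distrib scaleR_sum_right)
  have vF: "?v (F a) y = frame_map (\<lambda>j. e j y) a" if "y \<in> U" for a y
    unfolding F_def frame_map_def e_def
    by (simp only: chart_vec_sum[OF U(1) that] chart_vec_scale[OF U(1) that])
  \<comment> \<open>Orthonormality at the single point \<open>x\<close> makes the \<open>b j\<close>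
    independent, and because \<open>F\<close> is independent of the point this serves the whole
    chart.\<close>
  have "F a = 0 \<Longrightarrow> a = 0" for a
  proof -
    assume "F a = 0"
    then have "frame_map u a = ?v 0 x" using vF[OF U(2), of a] by (simp add: e_def b(1)[symmetric])
    also have "\<dots> = 0" using chart_vec_scale[OF U, of 0 0] by simp
    finally have "a $ k = 0" for k
      using metric_frame_map(1)[OF orth u(1), of a k] metric_zero[OF u(1)[of k]]
      by (simp only:)
    then show "a = 0" by (simp add: vec_eq_iff)
  qed
  then have injF: "inj F" using linear_injective_0[OF linF] by blast
  \<comment> \<open>An injective linear map of a finite-dimensional space into itself is onto. With
    \<open>J = I\<close> this yields the tangent spaces of \<open>M\<close>, with
    \<open>J = UNIV\<close> those of the whole manifold.\<close>
  have FC: "F ` coord_subspace J = coord_subspace J" if J: "\<And>j. j \<in> J \<Longrightarrow> b j \<in> coord_subspace J" for J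
  proof (rule subspace_dim_equal)
    show sub: "subspace (coord_subspace J)" by (auto simp: subspace_def)
    then show "subspace (F ` coord_subspace J)" by (rule linear_subspace_image[OF linF])
    show "F ` coord_subspace J \<subseteq> coord_subspace J"
    proof (rule image_subsetI)
      fix a :: "real ^ 'm" assume a: "a \<in> coord_subspace J"
      have "F a $ k = 0" if k: "k \<in> - J" for k
      proof -
        have "a $ j * b j $ k = 0" for j using a J[of j] k by (cases "j \<in> J") auto
        then show ?thesis by (simp add: F_def sum.neutral del: mult_eq_0_iff)
      qed
      then show "F a \<in> coord_subspace J" by simp
    qed
    show "dim (coord_subspace J) \<le> dim (F ` coord_subspace J)"
      using dim_image_eq[OF linF inj_on_subset[OF injF subset_UNIV], of "coord_subspace J"] by (rule eq_refl[OF sym])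
  qed
  have TM': "tangent_in \<A> M y = frame_map (\<lambda>j. e j y) ` coord_subspace I" if "y \<in> U" "y \<in> M" for y
  proof -
    have "tangent_in \<A> M y = (\<lambda>b. ?v b y) ` F ` coord_subspace I"
      using TM[OF that] FC[OF b(2)] by simp
    then show ?thesis using vF[OF that(1)] by (simp add: image_image)
  qed
  have TN': "tangent_space \<A> y = frame_map (\<lambda>j. e j y) ` coord_subspace UNIV" if "y \<in> U" for y
  proof -
    have "tangent_space \<A> y = (\<lambda>b. ?v b y) ` F ` coord_subspace UNIV"
      using TN[OF that] FC[of UNIV] by simp
    then show ?thesis using vF[OF that(1)] by (simp add: image_image)
  qed
  have sme: "smooth_vf \<A> U (e k)" for k
    using smooth_vf_chart_vec[OF U(1), of "b k"] unfolding e_def .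
  have ex: "e j x = u j" for j by (simp add: e_def b(1))
  have orth': "g x (e i x) (e j x) = (if i = j then 1 else 0)" for i j
    using orth by (simp add: ex)
  have "orthonormalization x e {} e U"
    unfolding orthonormalization_def using open_in_chart[OF U(1)] U(2) by auto
  then obtain W1 \<sigma>1 where 1: "W1 \<subseteq> U" "orthonormalization x e I \<sigma>1 W1"
    using gram_schmidt[of x e "{}" e U I] sme orth' by auto
  have sme1: "smooth_vf \<A> W1 (e k)" for k
    using 1(2) unfolding orthonormalization_def by (intro smooth_vf_subset[OF sme _ 1(1)]) simp
  \<comment> \<open>The second stage keeps the vectors indexed by \<open>I\<close>, so the span
    found for them in the first stage remains valid.\<close>
  obtain W \<sigma> where 2: "W \<subseteq> W1" "orthonormalization x e UNIV \<sigma> W" "\<And>j. j \<in> I \<Longrightarrow> \<sigma> j = \<sigma>1 j"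
    using gram_schmidt[of x e I \<sigma>1 W1 "- I"] 1(2) sme1 orth' by auto
  have "local_frame \<A> g M I W \<sigma>"
    unfolding local_frame_def
  proof (intro conjI ballI)
    show "tangent_space \<A> y = range (frame_map (\<lambda>j. \<sigma> j y))" if "y \<in> W" for y
    proof -
      have "frame_map (\<lambda>j. \<sigma> j y) ` coord_subspace UNIV = frame_map (\<lambda>j. e j y) ` coord_subspace UNIV"
        by (rule frame_map_image_eq) (use 2(2) that in \<open>auto simp: orthonormalization_def\<close>)
      then show ?thesis using TN' that 1(1) 2(1) by auto
    qed
    show "tangent_in \<A> M y = frame_map (\<lambda>j. \<sigma> j y) ` coord_subspace I" if "y \<in> W \<inter> M" for y
    proof -
      have "y \<in> W1" using that 2(1) by blast
      then have "frame_map (\<lambda>j. \<sigma> j y) ` coord_subspace I = frame_map (\<lambda>j. e j y) ` coord_subspace I"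
        using 1(2) unfolding orthonormalization_def
        by (intro frame_map_image_eq) (simp add: 2(3))
      then show ?thesis using TM'[of y] that 1(1) 2(1) by auto
    qed
  qed (use 2(2) in \<open>auto simp: orthonormalization_def\<close>)
  moreover have "x \<in> W" "\<And>j. \<sigma> j x = u j" using 2(2) by (auto simp: orthonormalization_def ex)
  ultimately show thesis using that 1(1) 2(1) by blast
qed

lemma linear_frames_carrier: "q \<in> linear_frames \<A> \<Longrightarrow> fst q \<in> carrier_of \<A>"
  by (auto simp: linear_frames_def)

lemma linear_frames_tangent: "(x, u) \<in> linear_frames \<A> \<Longrightarrow> u j \<in> tangent_space \<A> x"
proof -
  assume "(x, u) \<in> linear_frames \<A>"
  then have "frame_map u (axis j 1) \<in> tangent_space \<A> x"
    by (auto simp: linear_frames_def bij_betw_def)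
  then show ?thesis by (simp add: frame_map_axis)
qed

lemma adapted_framesD:
  assumes "(x, u) \<in> adapted_frames \<A> g M I"
  shows "x \<in> M" "x \<in> carrier_of \<A>" "u j \<in> tangent_space \<A> x" "i \<in> I \<Longrightarrow> u i \<in> tangent_in \<A> M x"
    "g x (u j) (u k) = (if j = k then 1 else 0)" "(x, u) \<in> linear_frames \<A>"
proof -
  show "x \<in> M" "x \<in> carrier_of \<A>" "i \<in> I \<Longrightarrow> u i \<in> tangent_in \<A> M x"
    "g x (u j) (u k) = (if j = k then 1 else 0)" "(x, u) \<in> linear_frames \<A>"
    using assms by (auto simp: adapted_frames_def orthonormal_frames_def linear_frames_def)
  then show "u j \<in> tangent_space \<A> x" by (intro linear_frames_tangent)
qed

lemma (in vec_riemannian_manifold) ex_local_frame: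
  assumes "submanifold \<A> I M"
    and xu: "(x, u) \<in> adapted_frames \<A> g M I"
  obtains W \<sigma> where "x \<in> W" "local_frame \<A> g M I W \<sigma>" "\<And>j. \<sigma> j x = u j"
proof -
  obtain U \<phi> where U: "x \<in> U" "U \<subseteq> carrier_of \<A>" and atlas': "smooth_atlas (insert (U, \<phi>) \<A>)"
    and slice: "\<phi> ` (U \<inter> M) = \<phi> ` U \<inter> coord_subspace I"
    using bspec[OF assms(1)[unfolded submanifold_def] adapted_framesD(1)[OF xu]] by (elim exE conjE)
  interpret compatible_chart \<A> U \<phi> using atlas' U(2) by unfold_locales
  note ins = tangent_in_insert carrier_of_insert riemannian_metric_insert open_in_insert smooth_vf_insert
  interpret R: vec_riemannian_manifold "insert (U, \<phi>) \<A>" g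
    using metric by unfold_locales (simp add: ins)
  have "local_frame (insert (U, \<phi>) \<A>) g M I W \<sigma> \<longleftrightarrow> local_frame \<A> g M I W \<sigma>" for W \<sigma>
    unfolding local_frame_def ins ..
  moreover obtain W \<sigma> where "x \<in> W" "local_frame (insert (U, \<phi>) \<A>) g M I W \<sigma>" "\<And>j. \<sigma> j x = u j"
    by (rule R.ex_local_frame_slice[of U \<phi> x M I u])
      (use U slice adapted_framesD[OF xu] in \<open>auto simp: ins\<close>)
  ultimately show thesis using that by blast
qed

section \<open>The frame bundle\<close>

lemma open_det_nz: "open {A :: real ^ 'm::finite ^ 'm. det A \<noteq> 0}"
proof -
  have "{A :: real ^ 'm ^ 'm. det A \<noteq> 0} = det -` (-{0})" by auto
  moreover have "continuous_on UNIV (det :: real ^ 'm ^ 'm \<Rightarrow> real)"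
    unfolding det_def by (intro continuous_intros)
  then have "open (det -` (-{0}) :: (real ^ 'm ^ 'm) set)"
    by (intro open_vimage) auto
  ultimately show ?thesis by simp
qed

section \<open>The frame bundle as a manifold\<close>

lemma bounded_bilinear_matrix_mult:
  "bounded_bilinear ((**) :: real ^ 'm::finite ^ 'm \<Rightarrow> real ^ 'm ^ 'm \<Rightarrow> real ^ 'm ^ 'm)"
  unfolding bilinear_conv_bounded_bilinear[symmetric] bilinear_def
  by (auto intro!: linearI simp: matrix_matrix_mult_def vec_eq_iff sum.distrib sum_distrib_left algebra_simps)

lemma bounded_linear_transpose: "bounded_linear (transpose :: real ^ 'm::finite ^ 'm \<Rightarrow> real ^ 'm ^ 'm)"
  unfolding linear_conv_bounded_linear[symmetric]
  by (rule linearI) (auto simp: transpose_def vec_eq_iff)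

lemma has_vector_derivative_matrix_mult:
  fixes f h :: "real \<Rightarrow> real ^ 'm::finite ^ 'm"
  assumes "(f has_vector_derivative f') (at t)" "(h has_vector_derivative h') (at t)"
  shows "((\<lambda>s. f s ** h s) has_vector_derivative f t ** h' + f' ** h t) (at t)"
proof -
  note bil = bounded_bilinear_matrix_mult
  have "(\<lambda>s. f t ** (s *\<^sub>R h') + s *\<^sub>R f' ** h t) = (\<lambda>s. s *\<^sub>R (f t ** h' + f' ** h t))"
    by (simp add: bounded_bilinear.scaleR_left[OF bil] bounded_bilinear.scaleR_right[OF bil] scaleR_add_right)
  then show ?thesis
    using bounded_bilinear.FDERIV[OF bil assms[unfolded has_vector_derivative_def]]
    unfolding has_vector_derivative_def by simp
qed

definition frame_dom :: "('a, real ^ 'm::finite) chart set \<Rightarrow> 'a set \<Rightarrow> ('a, 'm) fpoint set" where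
  "frame_dom \<A> U = {(x, u) \<in> linear_frames \<A>. x \<in> U}"

definition frame_coord :: "('a \<Rightarrow> real ^ 'm) \<Rightarrow> ('a, 'm::finite) fpoint \<Rightarrow> (real ^ 'm) \<times> (real ^ 'm ^ 'm)" where
  "frame_coord \<phi> = (\<lambda>(x, u). (\<phi> x, \<chi> j i. u j (\<lambda>y. \<phi> y $ i)))"

text \<open>The inverse of the bundle chart. Row \<open>j\<close> of \<open>A\<close> holds the
  components of the vector \<open>j\<close>, so the right action by \<open>a\<close> becomes left
  multiplication by \<open>transpose a\<close>.\<close>

definition frame_pt ::
    "('a, real ^ 'm::finite) chart set \<Rightarrow> 'a set \<Rightarrow> ('a \<Rightarrow> real ^ 'm) \<Rightarrow> 'a \<Rightarrow> real ^ 'm ^ 'm \<Rightarrow> ('a, 'm) fpoint" where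
  "frame_pt \<A> U \<phi> y A = (y, \<lambda>j. chart_vec \<A> U \<phi> (A $ j) y)"

lemma frame_atlas_eq: "frame_atlas \<A> = (\<lambda>(U, \<phi>). (frame_dom \<A> U, frame_coord \<phi>)) ` \<A>"
  unfolding frame_atlas_def frame_dom_def frame_coord_def ..

lemma frame_atlasI: "(U, \<phi>) \<in> \<A> \<Longrightarrow> (frame_dom \<A> U, frame_coord \<phi>) \<in> frame_atlas \<A>"
  unfolding frame_atlas_eq by force

lemma frame_atlasE:
  assumes "C \<in> frame_atlas \<A>"
  obtains U \<phi> where "(U, \<phi>) \<in> \<A>" "C = (frame_dom \<A> U, frame_coord \<phi>)"
  using assms unfolding frame_atlas_eq by force

lemma frame_dom_Int: "frame_dom \<A> U \<inter> frame_dom \<A> V = frame_dom \<A> (U \<inter> V)"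
  unfolding frame_dom_def by auto

context vec_manifold
begin

abbreviation "\<F> \<equiv> frame_atlas \<A>"

lemma smooth_fun_chart_nth: "(U, \<phi>) \<in> \<A> \<Longrightarrow> smooth_fun \<A> U (\<lambda>y. \<phi> y $ i)"
  using smooth_fun_chart[of U \<phi> "axis i 1"] by (simp add: inner_axis)

lemma chart_vec_nth: "(U, \<phi>) \<in> \<A> \<Longrightarrow> y \<in> U \<Longrightarrow> chart_vec \<A> U \<phi> b y (\<lambda>z. \<phi> z $ i) = b $ i"
  using chart_vec_coord[of U \<phi> y b "axis i 1"] by (simp add: inner_axis)

lemma tangent_space_chart_vec_nth:
  assumes "(U, \<phi>) \<in> \<A>" "y \<in> U" "v \<in> tangent_space \<A> y"
  shows "chart_vec \<A> U \<phi> (\<chi> i. v (\<lambda>z. \<phi> z $ i)) y = v"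
proof -
  obtain b where b: "v = chart_vec \<A> U \<phi> b y"
    using assms(3) tangent_space_eq_chart_vec[OF assms(1,2)] by auto
  have "(\<chi> i. v (\<lambda>z. \<phi> z $ i)) = b"
    unfolding b by (simp add: chart_vec_nth[OF assms(1,2)])
  then show ?thesis using b by simp
qed

lemma frame_map_chart_vec:
  assumes "(U, \<phi>) \<in> \<A>" "y \<in> U"
  shows "frame_map (\<lambda>j. chart_vec \<A> U \<phi> (A $ j) y) a = chart_vec \<A> U \<phi> (transpose A *v a) y"
proof -
  have "transpose A *v a = (\<Sum>j\<in>UNIV. (a $ j) *\<^sub>R (A $ j))"
    by (simp add: matrix_vector_mult_def transpose_def vec_eq_iff mult.commute)
  then show ?thesis
    by (simp only: frame_map_def chart_vec_sum[OF assms] chart_vec_scale[OF assms])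
qed

lemma chart_vec_inj:
  assumes "(U, \<phi>) \<in> \<A>" "y \<in> U" "chart_vec \<A> U \<phi> b y = chart_vec \<A> U \<phi> b' y"
  shows "b = b'"
  using chart_vec_nth[OF assms(1,2)] assms(3) by (metis vec_eq_iff)

text \<open>The frame map is the coordinate isomorphism of the tangent space composed with
  \<open>transpose A\<close>, so it is bijective exactly when \<open>A\<close> is invertible. This
  identifies the fibre of the bundle chart with an open set of matrices.\<close>

lemma frame_pt_linear_frames:
  assumes "(U, \<phi>) \<in> \<A>" "y \<in> U"
  shows "frame_pt \<A> U \<phi> y A \<in> linear_frames \<A> \<longleftrightarrow> det A \<noteq> 0"
proof -
  let ?v = "\<lambda>b. chart_vec \<A> U \<phi> b y"
  have y: "y \<in> carrier_of \<A>" using chart_carrier[OF assms(1)] assms(2) by blast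
  have bij: "bij_betw ?v UNIV (tangent_space \<A> y)"
    using chart_vec_inj[OF assms] tangent_space_eq_chart_vec[OF assms]
    by (auto simp: bij_betw_def inj_on_def)
  have "frame_map (\<lambda>j. ?v (A $ j)) = ?v \<circ> (*v) (transpose A)"
    by (rule ext) (simp only: frame_map_chart_vec[OF assms] o_apply)
  then have "frame_pt \<A> U \<phi> y A \<in> linear_frames \<A> \<longleftrightarrow> bij_betw (?v \<circ> (*v) (transpose A)) UNIV (tangent_space \<A> y)"
    using y by (simp add: frame_pt_def linear_frames_def)
  also have "\<dots> \<longleftrightarrow> bij ((*v) (transpose A))"
    using bij_betw_comp_iff2[OF bij, of "(*v) (transpose A)" UNIV] by simp
  also have "\<dots> \<longleftrightarrow> invertible (transpose A)"
  proof
    assume "bij ((*v) (transpose A))"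
    then show "invertible (transpose A)"
      unfolding invertible_left_inverse matrix_left_invertible_injective by (simp add: bij_def)
  next
    assume i: "invertible (transpose A)"
    then have "inj ((*v) (transpose A))"
      unfolding invertible_left_inverse matrix_left_invertible_injective by simp
    moreover have "surj ((*v) (transpose A))"
      using i unfolding invertible_right_inverse matrix_right_invertible_surjective by simp
    ultimately show "bij ((*v) (transpose A))" by (simp add: bij_def)
  qed
  finally show ?thesis by (simp add: invertible_det_nz det_transpose)
qed

lemma frame_coord_frame_pt:
  "(U, \<phi>) \<in> \<A> \<Longrightarrow> y \<in> U \<Longrightarrow> frame_coord \<phi> (frame_pt \<A> U \<phi> y A) = (\<phi> y, A)"
  by (simp add: frame_coord_def frame_pt_def chart_vec_nth vec_eq_iff)

lemma frame_pt_frame_coord: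
  assumes "(U, \<phi>) \<in> \<A>" "q \<in> frame_dom \<A> U"
  shows "frame_pt \<A> U \<phi> (fst q) (snd (frame_coord \<phi> q)) = q"
proof -
  obtain y u where q: "q = (y, u)" by force
  then have "y \<in> U" "(y, u) \<in> linear_frames \<A>" using assms(2) by (auto simp: frame_dom_def)
  then show ?thesis
    using tangent_space_chart_vec_nth[OF assms(1) _ linear_frames_tangent] unfolding q
    by (simp add: frame_pt_def frame_coord_def)
qed

lemma frame_dom_iff:
  assumes "(U, \<phi>) \<in> \<A>" "W \<subseteq> U"
  shows "q \<in> frame_dom \<A> W \<longleftrightarrow> (\<exists>y A. y \<in> W \<and> det A \<noteq> 0 \<and> q = frame_pt \<A> U \<phi> y A)"
proof
  assume q: "q \<in> frame_dom \<A> W"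
  then have "q \<in> frame_dom \<A> U" "fst q \<in> W" "q \<in> linear_frames \<A>" using assms(2) by (auto simp: frame_dom_def)
  then show "\<exists>y A. y \<in> W \<and> det A \<noteq> 0 \<and> q = frame_pt \<A> U \<phi> y A"
    using frame_pt_frame_coord[OF assms(1)] frame_pt_linear_frames[OF assms(1)] assms(2) by (metis subsetD)
next
  assume "\<exists>y A. y \<in> W \<and> det A \<noteq> 0 \<and> q = frame_pt \<A> U \<phi> y A"
  then show "q \<in> frame_dom \<A> W"
    using frame_pt_linear_frames[OF assms(1)] assms(2) by (auto simp: frame_dom_def frame_pt_def)
qed

lemma frame_coord_image:
  assumes "(U, \<phi>) \<in> \<A>" "W \<subseteq> U"
  shows "frame_coord \<phi> ` frame_dom \<A> W = \<phi> ` W \<times> {A :: real ^ 'm ^ 'm. det A \<noteq> 0}"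
proof (intro equalityI subsetI)
  fix p assume "p \<in> frame_coord \<phi> ` frame_dom \<A> W"
  then show "p \<in> \<phi> ` W \<times> {A :: real ^ 'm ^ 'm. det A \<noteq> 0}"
    using assms by (auto simp: frame_dom_iff[OF assms] frame_coord_frame_pt subset_iff)
next
  fix p assume "p \<in> \<phi> ` W \<times> {A :: real ^ 'm ^ 'm. det A \<noteq> 0}"
  then obtain y A where yA: "p = (\<phi> y, A)" "y \<in> W" "det A \<noteq> 0" by auto
  show "p \<in> frame_coord \<phi> ` frame_dom \<A> W"
    by (rule image_eqI[of _ _ "frame_pt \<A> U \<phi> y A"])
      (use yA assms frame_dom_iff[OF assms] in \<open>auto simp: frame_coord_frame_pt subset_iff\<close>)
qed

lemma frame_coord_inj: "(U, \<phi>) \<in> \<A> \<Longrightarrow> inj_on (frame_coord \<phi>) (frame_dom \<A> U)"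
proof (rule inj_onI)
  fix q q' assume U: "(U, \<phi>) \<in> \<A>" and q: "q \<in> frame_dom \<A> U" "q' \<in> frame_dom \<A> U"
    and eq: "frame_coord \<phi> q = frame_coord \<phi> q'"
  have "\<phi> (fst q) = \<phi> (fst q')" using eq by (simp add: frame_coord_def split_def)
  moreover have "fst q \<in> U" "fst q' \<in> U" using q by (auto simp: frame_dom_def)
  ultimately have "fst q = fst q'" using chart_inj[OF U] by (auto dest: inj_onD)
  then show "q = q'" using frame_pt_frame_coord[OF U q(1)] frame_pt_frame_coord[OF U q(2)] eq by metis
qed

lemma inv_into_frame_coord:
  assumes "(U, \<phi>) \<in> \<A>" "y \<in> U" "det A \<noteq> 0"
  shows "inv_into (frame_dom \<A> U) (frame_coord \<phi>) (\<phi> y, A) = frame_pt \<A> U \<phi> y A"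
proof -
  have "frame_pt \<A> U \<phi> y A \<in> frame_dom \<A> U" using frame_dom_iff[OF assms(1) subset_refl] assms by blast
  then show ?thesis
    using inv_into_f_f[OF frame_coord_inj[OF assms(1)]] frame_coord_frame_pt[OF assms(1,2)] by metis
qed

lemma smooth_atlas_frame_atlas: "smooth_atlas \<F>"
proof -
  have 1: "open (frame_coord \<phi> ` frame_dom \<A> U)" if "(U, \<phi>) \<in> \<A>" for U \<phi>
    unfolding frame_coord_image[OF that subset_refl]
    by (intro open_Times chart_open[OF that] open_det_nz)
  have 2: "open (frame_coord \<phi> ` (frame_dom \<A> U \<inter> frame_dom \<A> V))" (is "open ?S")
    and 3: "smooth_on (frame_coord \<phi> ` (frame_dom \<A> U \<inter> frame_dom \<A> V))
      (frame_coord \<psi> \<circ> inv_into (frame_dom \<A> U) (frame_coord \<phi>))"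
    if U: "(U, \<phi>) \<in> \<A>" and V: "(V, \<psi>) \<in> \<A>" for U \<phi> V \<psi>
  proof -
    let ?O = "\<phi> ` (U \<inter> V)" and ?S = "\<phi> ` (U \<inter> V) \<times> {A :: real ^ 'm ^ 'm. det A \<noteq> 0}"
    have S: "frame_coord \<phi> ` (frame_dom \<A> U \<inter> frame_dom \<A> V) = ?S"
      unfolding frame_dom_Int using frame_coord_image[OF U] by auto
    have op: "open ?S" by (intro open_Times transition_open[OF U V] open_det_nz)
    show "open (frame_coord \<phi> ` (frame_dom \<A> U \<inter> frame_dom \<A> V))" using S op by simp
    \<comment> \<open>In the fibre the transition map is multiplication by the Jacobian, hence
      linear in the matrix with coefficients smooth in the base point. \<open>D i\<close> is the
      differential of coordinate \<open>i\<close>.\<close>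
    define D where "D i z = frechet_derivative ((\<lambda>y. \<psi> y $ i) \<circ> inv_into U \<phi>) (at z)" for i z
    have smi: "smooth_on ?O ((\<lambda>y. \<psi> y $ i) \<circ> inv_into U \<phi>)" for i
      using smooth_funD[OF smooth_fun_chart_nth[OF V] U] by (simp add: Int_commute)
    have fst_in: "smooth_on ?S (h \<circ> fst)" if "smooth_on ?O h" for h :: "real ^ 'm \<Rightarrow> real"
      by (rule smooth_on_compose[OF op _ that]) (auto intro: smooth_on_bounded_linear[OF op bounded_linear_fst smooth_on_ident])
    have fst_in': "smooth_on ?S (h \<circ> fst)" if "smooth_on ?O h" for h :: "real ^ 'm \<Rightarrow> real ^ 'm"
      by (rule smooth_on_compose[OF op _ that]) (auto intro: smooth_on_bounded_linear[OF op bounded_linear_fst smooth_on_ident])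
    have entry: "smooth_on ?S (\<lambda>p. snd p $ j $ k)" for j k
      by (rule smooth_on_bounded_linear[OF op _ smooth_on_ident])
        (intro bounded_linear_compose[OF bounded_linear_vec_nth] bounded_linear_compose[OF bounded_linear_vec_nth] bounded_linear_snd)
    have sm: "smooth_on ?S (\<lambda>p. ((\<psi> \<circ> inv_into U \<phi>) (fst p),
        \<chi> j i. \<Sum>k\<in>UNIV. (snd p $ j $ k) * D i (fst p) (axis k 1)))"
    proof (intro smooth_on_Pair[OF op] smooth_on_vec[OF op] smooth_on_sum[OF op] smooth_on_mult[OF op])
      show "smooth_on ?S (\<lambda>p. (\<psi> \<circ> inv_into U \<phi>) (fst p))"
        using fst_in'[OF transition_smooth[OF U V]] by (simp add: comp_def)
      show "smooth_on ?S (\<lambda>p. snd p $ j $ k)" for j k by (rule entry)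
      show "smooth_on ?S (\<lambda>p. D i (fst p) (axis k 1))" for i k
        using fst_in[OF smooth_on_derivative[OF smi]] by (simp add: comp_def D_def)
    qed
    show "smooth_on (frame_coord \<phi> ` (frame_dom \<A> U \<inter> frame_dom \<A> V))
      (frame_coord \<psi> \<circ> inv_into (frame_dom \<A> U) (frame_coord \<phi>))"
      unfolding S
    proof (rule smooth_on_eq[OF sm _ op])
      fix p assume "p \<in> ?S"
      then obtain y A where p: "p = (\<phi> y, A)" "y \<in> U" "y \<in> V" "det A \<noteq> 0" by auto
      have "(\<Sum>k\<in>UNIV. (A $ j $ k) * D i (\<phi> y) (axis k 1)) = chart_vec \<A> U \<phi> (A $ j) y (\<lambda>y. \<psi> y $ i)" for i j
      proof -
        have near: "smooth_near \<A> y (\<lambda>y. \<psi> y $ i)"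
          using smooth_nearI[OF open_in_chart[OF V] p(3) smooth_fun_chart_nth[OF V]] .
        have "linear (D i (\<phi> y))"
          unfolding D_def by (rule has_derivative_linear[OF smooth_near_differentiable[OF U p(2) near]])
        then have "D i (\<phi> y) (\<Sum>k\<in>UNIV. (A $ j $ k) *\<^sub>R axis k 1) = (\<Sum>k\<in>UNIV. (A $ j $ k) * D i (\<phi> y) (axis k 1))"
          by (simp add: linear_sum linear_scale)
        moreover have "(\<Sum>k\<in>UNIV. (A $ j $ k) *\<^sub>R axis k 1) = A $ j"
          by (simp add: basis_expansion scalar_mult_eq_scaleR[symmetric])
        ultimately show ?thesis using near by (simp add: chart_vec_def D_def)
      qed
      then show "((\<psi> \<circ> inv_into U \<phi>) (fst p), \<chi> j i. \<Sum>k\<in>UNIV. (snd p $ j $ k) * D i (fst p) (axis k 1))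
        = (frame_coord \<psi> \<circ> inv_into (frame_dom \<A> U) (frame_coord \<phi>)) p"
        using p inv_into_frame_coord[OF U p(2,4)] chart_inv[OF U p(2)]
        by (simp add: frame_coord_def frame_pt_def)
    qed
  qed
  show ?thesis
    unfolding smooth_atlas_def
    by (auto elim!: frame_atlasE intro: frame_coord_inj 1 2 3)
qed

sublocale F: atlas_manifold \<F>
  by unfold_locales (rule smooth_atlas_frame_atlas)

lemma carrier_of_frame_atlas: "carrier_of \<F> = linear_frames \<A>"
  unfolding carrier_of_def frame_atlas_eq frame_dom_def linear_frames_def by fastforce

lemma open_in_frame_dom:
  assumes "open_in \<A> W"
  shows "open_in \<F> (frame_dom \<A> W)"
  unfolding open_in_def carrier_of_frame_atlas
proof (intro conjI ballI; clarify?)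
  fix U' \<phi>' assume "(U', \<phi>') \<in> \<F>"
  then obtain U \<phi> where U: "(U, \<phi>) \<in> \<A>" "U' = frame_dom \<A> U" "\<phi>' = frame_coord \<phi>" by (auto elim: frame_atlasE)
  have "open (\<phi> ` (W \<inter> U) \<times> {A :: real ^ 'm ^ 'm. det A \<noteq> 0})"
    by (intro open_Times open_in_chartD[OF assms U(1)] open_det_nz)
  then show "open (\<phi>' ` (frame_dom \<A> W \<inter> U'))"
    unfolding U(2,3) frame_dom_Int using frame_coord_image[OF U(1), of "W \<inter> U"] by simp
qed (auto simp: frame_dom_def)

lemma smooth_fun_fst:
  assumes "open_in \<A> W" "smooth_fun \<A> W f"
  shows "smooth_fun \<F> (frame_dom \<A> W) (f \<circ> fst)"
  unfolding smooth_fun_def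
proof (intro conjI ballI; clarify?)
  fix U' \<phi>' assume "(U', \<phi>') \<in> \<F>"
  then obtain U \<phi> where U: "(U, \<phi>) \<in> \<A>" "U' = frame_dom \<A> U" "\<phi>' = frame_coord \<phi>" by (auto elim: frame_atlasE)
  let ?S = "\<phi> ` (W \<inter> U) \<times> {A :: real ^ 'm ^ 'm. det A \<noteq> 0}"
  have op: "open ?S"
    by (intro open_Times open_in_chartD[OF assms(1) U(1)] open_det_nz)
  have "smooth_on ?S ((f \<circ> inv_into U \<phi>) \<circ> fst)"
    by (rule smooth_on_compose[OF op _ smooth_funD[OF assms(2) U(1)]])
      (auto intro: smooth_on_bounded_linear[OF op bounded_linear_fst smooth_on_ident])
  then have "smooth_on ?S (f \<circ> fst \<circ> inv_into (frame_dom \<A> U) (frame_coord \<phi>))"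
  proof (rule smooth_on_eq[OF _ _ op])
    fix p assume "p \<in> ?S"
    then obtain y A where p: "p = (\<phi> y, A)" "y \<in> U" "det A \<noteq> 0" by auto
    then show "((f \<circ> inv_into U \<phi>) \<circ> fst) p = (f \<circ> fst \<circ> inv_into (frame_dom \<A> U) (frame_coord \<phi>)) p"
      using inv_into_frame_coord[OF U(1) p(2,3)] chart_inv[OF U(1) p(2)] by (simp add: frame_pt_def)
  qed
  then show "smooth_on (\<phi>' ` (frame_dom \<A> W \<inter> U')) (f \<circ> fst \<circ> inv_into U' \<phi>')"
    unfolding U(2,3) frame_dom_Int using frame_coord_image[OF U(1), of "W \<inter> U"] by simp
qed

lemma smooth_curve_fst:
  assumes "smooth_curve \<F> T \<gamma>"
  shows "smooth_curve \<A> T (fst \<circ> \<gamma>)"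
  unfolding smooth_curve_def
proof (intro conjI ballI; clarify?)
  have LF: "\<gamma> t \<in> linear_frames \<A>" if "t \<in> T" for t
    using assms that unfolding smooth_curve_def carrier_of_frame_atlas by blast
  show "(fst \<circ> \<gamma>) t \<in> carrier_of \<A>" if "t \<in> T" for t
    using LF[OF that] by (auto simp: linear_frames_def)
  fix U \<phi> assume U: "(U, \<phi>) \<in> \<A>"
  have eq: "T \<inter> (fst \<circ> \<gamma>) -` U = T \<inter> \<gamma> -` frame_dom \<A> U" using LF by (force simp: frame_dom_def)
  note chart = F.smooth_curve_chart[OF assms frame_atlasI[OF U]]
  have "smooth_on (T \<inter> \<gamma> -` frame_dom \<A> U) (\<lambda>t. fst ((frame_coord \<phi> \<circ> \<gamma>) t))"
    by (rule smooth_on_bounded_linear[OF chart(1) bounded_linear_fst chart(2)])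
  moreover have "(\<lambda>t. fst ((frame_coord \<phi> \<circ> \<gamma>) t)) = \<phi> \<circ> (fst \<circ> \<gamma>)"
    by (auto simp: frame_coord_def split_def)
  ultimately show "open (T \<inter> (fst \<circ> \<gamma>) -` U) \<and> smooth_on (T \<inter> (fst \<circ> \<gamma>) -` U) (\<phi> \<circ> (fst \<circ> \<gamma>))"
    using chart(1) eq by simp
qed

text \<open>On a function \<open>f\<close> smooth near the base point both sides are the same
  derivative. What has to be checked is that \<open>f \<circ> fst\<close> is smooth near the frame,
  since otherwise the left side would be 0 by convention.\<close>

lemma differential_fst_velocity:
  assumes "\<gamma> 0 \<in> linear_frames \<A>"
  shows "differential \<A> fst (\<gamma> 0) (velocity \<F> \<gamma>) = velocity \<A> (fst \<circ> \<gamma>)"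
proof -
  have "smooth_near \<F> (\<gamma> 0) (f \<circ> fst)" if "smooth_near \<A> (fst (\<gamma> 0)) f" for f
  proof -
    obtain W where W: "open_in \<A> W" "fst (\<gamma> 0) \<in> W" "smooth_fun \<A> W f"
      using \<open>smooth_near \<A> (fst (\<gamma> 0)) f\<close> unfolding smooth_near_def by blast
    have "\<gamma> 0 \<in> frame_dom \<A> W" using W(2) assms by (auto simp: frame_dom_def)
    then show ?thesis
      using F.smooth_nearI[OF open_in_frame_dom[OF W(1)] _ smooth_fun_fst[OF W(1,3)]] by blast
  qed
  then show ?thesis
    by (auto simp: differential_def velocity_def fun_eq_iff comp_assoc)
qed

section \<open>The right action and its fundamental vectors in bundle coordinates\<close>

lemma frame_coord_frame_act:
  "frame_coord \<phi> (frame_act a q) = (\<phi> (fst q), transpose a ** snd (frame_coord \<phi> q))"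
  by (auto simp: frame_coord_def frame_act_def split_def matrix_matrix_mult_def transpose_def vec_eq_iff)

lemma frame_act_linear_frames:
  assumes "q \<in> linear_frames \<A>" "det a \<noteq> 0"
  shows "frame_act a q \<in> linear_frames \<A>"
proof -
  obtain U \<phi> where U: "(U, \<phi>) \<in> \<A>" "fst q \<in> U"
    using carrierE[OF linear_frames_carrier[OF assms(1)]] by blast
  have q: "q \<in> frame_dom \<A> U" using U assms(1) by (auto simp: frame_dom_def)
  obtain y A where yA: "y \<in> U" "det A \<noteq> 0" "q = frame_pt \<A> U \<phi> y A"
    using q frame_dom_iff[OF U(1) subset_refl] by blast
  have "(\<Sum>l\<in>UNIV. (a $ l $ k) *\<^sub>t chart_vec \<A> U \<phi> (A $ l) y) = chart_vec \<A> U \<phi> ((transpose a ** A) $ k) y" for k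
  proof -
    have "(transpose a ** A) $ k = (\<Sum>l\<in>UNIV. (a $ l $ k) *\<^sub>R (A $ l))"
      by (simp add: matrix_matrix_mult_def transpose_def vec_eq_iff)
    then show ?thesis
      by (simp only: chart_vec_sum[OF U(1) yA(1)] chart_vec_scale[OF U(1) yA(1)])
  qed
  then have "frame_act a q = frame_pt \<A> U \<phi> y (transpose a ** A)"
    unfolding yA(3) by (simp add: frame_act_def frame_pt_def)
  then show ?thesis
    using frame_pt_linear_frames[OF U(1) yA(1)] yA(2) assms(2) by (simp add: det_mul det_transpose)
qed

text \<open>In coordinates the orbit map sends \<open>a\<close> to \<open>transpose a ** N\<close>
  over a fixed base point. This is linear in \<open>a\<close>, so its differential in direction
  \<open>C\<close> is \<open>transpose C ** N\<close>.\<close>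

lemma fundamental_eq_chart_vec:
  assumes U: "(U, \<phi>) \<in> \<A>" and q: "q \<in> frame_dom \<A> U"
  shows "fundamental \<A> C q = chart_vec \<F> (frame_dom \<A> U) (frame_coord \<phi>)
    (0, transpose C ** snd (frame_coord \<phi> q)) q"
proof -
  let ?inv = "inv_into (frame_dom \<A> U) (frame_coord \<phi>)"
  let ?N = "snd (frame_coord \<phi> q)"
  have "frechet_derivative (\<lambda>a. f (frame_act a q)) (at (mat 1)) C
      = frechet_derivative (f \<circ> ?inv) (at (frame_coord \<phi> q)) (0, transpose C ** ?N)"
    if near: "smooth_near \<F> q f" for f
  proof -
    let ?D = "frechet_derivative (f \<circ> ?inv) (at (frame_coord \<phi> q))"
    let ?h = "\<lambda>a :: real ^ 'm ^ 'm. (\<phi> (fst q), transpose a ** ?N)"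
    have h1: "?h (mat 1) = frame_coord \<phi> q" by (simp add: frame_coord_def split_def transpose_mat)
    have lin: "bounded_linear (\<lambda>a :: real ^ 'm ^ 'm. transpose a ** ?N)"
      using bounded_linear_compose[OF bounded_bilinear.bounded_linear_left[OF bounded_bilinear_matrix_mult, of ?N]
          bounded_linear_transpose] .
    have "(?h has_derivative (\<lambda>a. (0, transpose a ** ?N))) (at (mat 1))"
      by (intro has_derivative_Pair has_derivative_const bounded_linear_imp_has_derivative[OF lin])
    moreover have "((f \<circ> ?inv) has_derivative ?D) (at (?h (mat 1)))"
      unfolding h1 by (rule F.smooth_near_differentiable[OF frame_atlasI[OF U] q near])
    ultimately have "((f \<circ> ?inv) \<circ> ?h has_derivative (?D \<circ> (\<lambda>a. (0, transpose a ** ?N)))) (at (mat 1))"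
      by (rule diff_chain_at)
    then have "((\<lambda>a. f (frame_act a q)) has_derivative (?D \<circ> (\<lambda>a. (0, transpose a ** ?N)))) (at (mat 1))"
    \<comment> \<open>Singular matrices lead out of the frame bundle, so the two functions are
      compared only on the open set of invertible matrices around the identity.\<close>
    proof (rule has_derivative_transform_within_open[OF _ open_det_nz])
      fix a :: "real ^ 'm ^ 'm" assume "a \<in> {A :: real ^ 'm ^ 'm. det A \<noteq> 0}"
      then have "frame_act a q \<in> frame_dom \<A> U"
        using frame_act_linear_frames[of q a] q by (auto simp: frame_dom_def frame_act_def)
      then show "((f \<circ> ?inv) \<circ> ?h) a = f (frame_act a q)"
        using inv_into_f_f[OF frame_coord_inj[OF U]] frame_coord_frame_act[of \<phi> a q] by (metis comp_apply)
    qed simp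
    then have "?D \<circ> (\<lambda>a. (0, transpose a ** ?N)) = frechet_derivative (\<lambda>a. f (frame_act a q)) (at (mat 1))"
      by (rule frechet_derivative_at)
    then show ?thesis by (metis comp_apply)
  qed
  then show ?thesis unfolding fundamental_def chart_vec_def by auto
qed

lemma fundamental_linear:
  assumes "q \<in> linear_frames \<A>"
  shows "fundamental \<A> (C + C') q = fundamental \<A> C q + fundamental \<A> C' q"
    and "fundamental \<A> (r *\<^sub>R C) q = r *\<^sub>t fundamental \<A> C q"
    and "fundamental \<A> 0 q = 0"
proof -
  obtain U \<phi> where U: "(U, \<phi>) \<in> \<A>" "fst q \<in> U"
    using carrierE[OF linear_frames_carrier[OF assms(1)]] by blast
  have q: "q \<in> frame_dom \<A> U" using U assms(1) by (auto simp: frame_dom_def)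
  note lin = F.chart_vec_add[OF frame_atlasI[OF U(1)] q]
    F.chart_vec_scale[OF frame_atlasI[OF U(1)] q]
  note bil = bounded_bilinear_matrix_mult
  have "(0, transpose (C + C') ** N) = (0, transpose C ** N) + ((0::real ^ 'm), transpose C' ** N)" for N :: "real ^ 'm ^ 'm"
    by (simp add: linear_add[OF bounded_linear.linear[OF bounded_linear_transpose]] bounded_bilinear.add_left[OF bil])
  then show "fundamental \<A> (C + C') q = fundamental \<A> C q + fundamental \<A> C' q"
    by (simp only: fundamental_eq_chart_vec[OF U(1) q] lin)
  have "(0, transpose (r *\<^sub>R C) ** N) = r *\<^sub>R ((0::real ^ 'm), transpose C ** N)" for r and C N :: "real ^ 'm ^ 'm"
    by (simp add: linear_scale[OF bounded_linear.linear[OF bounded_linear_transpose]] bounded_bilinear.scaleR_left[OF bil])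
  then show scale: "fundamental \<A> (r *\<^sub>R C) q = r *\<^sub>t fundamental \<A> C q" for r and C :: "real ^ 'm ^ 'm"
    by (simp only: fundamental_eq_chart_vec[OF U(1) q] lin)
  show "fundamental \<A> 0 q = 0" using scale[of 0 0] by simp
qed

end

section \<open>Curves of orthogonal matrices\<close>

definition block_diagonal :: "'m set \<Rightarrow> real ^ 'm::finite ^ 'm \<Rightarrow> bool" where
  "block_diagonal I B \<longleftrightarrow> (\<forall>i j. (i \<in> I) \<noteq> (j \<in> I) \<longrightarrow> B $ i $ j = 0)"

lemma block_diagonal_mult:
  assumes "block_diagonal I A" "block_diagonal I B"
  shows "block_diagonal I (A ** B)"
  unfolding block_diagonal_def
proof (intro allI impI)
  fix i j assume ij: "(i \<in> I) \<noteq> (j \<in> I)"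
  have "A $ i $ k * B $ k $ j = 0" for k
    using assms ij unfolding block_diagonal_def by (cases "(i \<in> I) = (k \<in> I)") auto
  then show "(A ** B) $ i $ j = 0"
    by (simp add: matrix_matrix_mult_def sum.neutral del: mult_eq_0_iff)
qed

text \<open>Velocities at the identity of curves of orthogonal matrices that preserve the two
  blocks. The curves are global, so that sums are realised by products and multiples by rescaling
  time; the aim is to reach every skew-symmetric block-diagonal matrix.\<close>

definition orthogonal_velocity :: "'m set \<Rightarrow> real ^ 'm::finite ^ 'm \<Rightarrow> bool" where
  "orthogonal_velocity I B \<longleftrightarrow>
     (\<exists>R. smooth_on UNIV R \<and> R 0 = mat 1 \<and> (R has_vector_derivative B) (at 0) \<and>
        (\<forall>t. transpose (R t) ** R t = mat 1 \<and> block_diagonal I (R t)))"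

lemma orthogonal_velocity_add:
  assumes "orthogonal_velocity I A" "orthogonal_velocity I B"
  shows "orthogonal_velocity I (A + B)"
proof -
  obtain R S where R: "smooth_on UNIV R" "R 0 = mat 1" "(R has_vector_derivative A) (at 0)"
      "\<And>t. transpose (R t) ** R t = mat 1" "\<And>t. block_diagonal I (R t)"
    and S: "smooth_on UNIV S" "S 0 = mat 1" "(S has_vector_derivative B) (at 0)"
      "\<And>t. transpose (S t) ** S t = mat 1" "\<And>t. block_diagonal I (S t)"
    using assms unfolding orthogonal_velocity_def by auto
  have "transpose (R t ** S t) ** (R t ** S t) = mat 1" for t
  proof -
    have "transpose (R t ** S t) ** (R t ** S t) = transpose (S t) ** (transpose (R t) ** R t) ** S t"
      by (simp add: matrix_transpose_mul matrix_mul_assoc)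
    then show ?thesis by (simp add: R(4) S(4))
  qed
  moreover have "smooth_on UNIV (\<lambda>t. R t ** S t)"
    by (rule smooth_on_bounded_bilinear[OF open_UNIV bounded_bilinear_matrix_mult R(1) S(1)])
  moreover have "((\<lambda>t. R t ** S t) has_vector_derivative A + B) (at 0)"
    using has_vector_derivative_matrix_mult[OF R(3) S(3)] R(2) S(2) by (simp add: add.commute)
  ultimately show ?thesis
    unfolding orthogonal_velocity_def
    by (intro exI[of _ "\<lambda>t. R t ** S t"]) (auto simp: R(2) S(2) block_diagonal_mult R(5) S(5))
qed

lemma orthogonal_velocity_scale:
  assumes "orthogonal_velocity I A"
  shows "orthogonal_velocity I (r *\<^sub>R A)"
proof -
  obtain R where R: "smooth_on UNIV R" "R 0 = mat 1" "(R has_vector_derivative A) (at 0)"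
      "\<And>t. transpose (R t) ** R t = mat 1" "\<And>t. block_diagonal I (R t)"
    using assms unfolding orthogonal_velocity_def by auto
  have "smooth_on UNIV (\<lambda>t. r * t)"
    by (intro smooth_on_mult smooth_on_const smooth_on_ident) auto
  then have "smooth_on UNIV (R \<circ> (\<lambda>t. r * t))"
    by (rule smooth_on_compose[OF open_UNIV _ R(1)]) auto
  moreover have "((\<lambda>t. r * t) has_vector_derivative r) (at 0)"
    by (auto intro!: derivative_eq_intros)
  then have "(R \<circ> (\<lambda>t. r * t) has_vector_derivative r *\<^sub>R A) (at 0)"
    using R(3) by (intro vector_diff_chain_at) auto
  ultimately show ?thesis
    unfolding orthogonal_velocity_def
    by (intro exI[of _ "R \<circ> (\<lambda>t. r * t)"]) (simp add: R)
qed

lemma block_diagonal_mat: "block_diagonal I (mat 1)"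
  by (auto simp: block_diagonal_def mat_def)

lemma orthogonal_velocity_zero: "orthogonal_velocity I 0"
  unfolding orthogonal_velocity_def
  by (intro exI[of _ "\<lambda>t. mat 1"]) (auto simp: smooth_on_const transpose_mat block_diagonal_mat)

lemma orthogonal_velocity_sum:
  "(\<And>i. i \<in> A \<Longrightarrow> orthogonal_velocity I (B i)) \<Longrightarrow> orthogonal_velocity I (\<Sum>i\<in>A. B i)"
  by (induction A rule: infinite_finite_induct) (auto intro: orthogonal_velocity_zero orthogonal_velocity_add)

lemma matE_mult: "matE a b ** matE c d = (if b = c then matE a d else 0)"
  by (auto simp: matE_def matrix_matrix_mult_def vec_eq_iff if_distrib[of "\<lambda>x. x * _"] sum.neutral
      if_distrib[of "(*) _"] cong: if_cong intro!: sum.neutral)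

lemma transpose_matE: "transpose (matE i j) = matE j i"
  by (auto simp: matE_def transpose_def vec_eq_iff)

text \<open>\<open>P\<close> stands for the projection onto a plane and \<open>K\<close> for a
  quarter turn in it. With \<alpha> = cos t - 1 and s = sin t the last hypothesis is cos^2 + sin^2 =
  1.\<close>

lemma rotation_orthogonal:
  fixes P K :: "real ^ 'm::finite ^ 'm" and \<alpha> s :: real
  assumes "P ** P = P" "P ** K = K" "K ** P = K" "K ** K = - P" and "2 * \<alpha> + \<alpha>\<^sup>2 + s\<^sup>2 = 0"
  shows "(mat 1 + \<alpha> *\<^sub>R P - s *\<^sub>R K) ** (mat 1 + \<alpha> *\<^sub>R P + s *\<^sub>R K) = mat 1"
proof -
  note bil = bounded_bilinear_matrix_mult
  have "(mat 1 + \<alpha> *\<^sub>R P - s *\<^sub>R K) ** (mat 1 + \<alpha> *\<^sub>R P + s *\<^sub>R K) = mat 1 + (\<alpha> *\<^sub>R P + \<alpha> *\<^sub>R P + (\<alpha> * \<alpha>) *\<^sub>R P + (s * s) *\<^sub>R P)"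
    by (simp add: bounded_bilinear.add_left[OF bil] bounded_bilinear.add_right[OF bil]
        bounded_bilinear.diff_left[OF bil] bounded_bilinear.scaleR_left[OF bil]
        bounded_bilinear.scaleR_right[OF bil] assms(1-4) scaleR_add_right scaleR_diff_right mult.commute)
  also have "\<dots> = mat 1 + (2 * \<alpha> + \<alpha>\<^sup>2 + s\<^sup>2) *\<^sub>R P"
    by (simp only: scaleR_add_left[symmetric] mult_2 power2_eq_square)
  finally show ?thesis by (simp add: assms(5))
qed

lemma orthogonal_velocity_matE:
  assumes "(i \<in> I) = (j \<in> I)"
  shows "orthogonal_velocity I (matE i j - matE j i)"
proof (cases "i = j")
  case True
  then show ?thesis by (simp add: orthogonal_velocity_zero)
next
  case False
  define P where "P = matE i i + matE j j"
  define K where "K = matE i j - matE j i"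
  \<comment> \<open>The rotation by \<open>t\<close> in the plane of the axes \<open>i\<close> and
    \<open>j\<close>, which is the exponential of \<open>t *\<^sub>R K\<close>. It respects the
    blocks because both axes lie in the same one.\<close>
  define R where "R t = mat 1 + (cos t - 1) *\<^sub>R P + sin t *\<^sub>R K" for t
  note bil = bounded_bilinear_matrix_mult
  have PK: "P ** P = P" "P ** K = K" "K ** P = K" "K ** K = - P"
    using False unfolding P_def K_def
    by (simp_all add: bounded_bilinear.add_left[OF bil] bounded_bilinear.add_right[OF bil]
        bounded_bilinear.diff_left[OF bil] bounded_bilinear.diff_right[OF bil] matE_mult)
  have tr: "transpose (R t) = mat 1 + (cos t - 1) *\<^sub>R P - sin t *\<^sub>R K" for t
  proof -
    note lin = bounded_linear.linear[OF bounded_linear_transpose]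
    have "transpose P = P" "transpose K = - K"
      by (simp_all add: P_def K_def linear_add[OF lin] linear_diff[OF lin] transpose_matE)
    then show ?thesis
      by (simp add: R_def linear_add[OF lin] linear_scale[OF lin] transpose_mat)
  qed
  have "2 * (cos t - 1) + (cos t - 1)\<^sup>2 + (sin t)\<^sup>2 = 0" for t :: real
    using sin_cos_squared_add[of t] by (simp add: power2_eq_square algebra_simps)
  then have "transpose (R t) ** R t = mat 1" for t
    unfolding tr unfolding R_def by (rule rotation_orthogonal[OF PK])
  moreover have "smooth_on UNIV R"
  proof -
    have "smooth_on UNIV (\<lambda>t::real. (cos t + (-1)) *\<^sub>R P)" "smooth_on UNIV (\<lambda>t::real. sin t *\<^sub>R K)"
      by (intro smooth_on_scaleR smooth_on_add smooth_on_const smooth_on_cos smooth_on_sin open_UNIV)+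
    then have "smooth_on UNIV (\<lambda>t. mat 1 + (cos t + (-1)) *\<^sub>R P + sin t *\<^sub>R K)"
      by (intro smooth_on_add smooth_on_const open_UNIV)
    then show ?thesis unfolding R_def[abs_def] by simp
  qed
  moreover have "(R has_vector_derivative K) (at 0)"
    unfolding R_def[abs_def] by (auto intro!: derivative_eq_intros)
  moreover have "block_diagonal I (R t)" for t
    unfolding block_diagonal_def
  proof (intro allI impI)
    fix r c assume "(r \<in> I) \<noteq> (c \<in> I)"
    then have "r \<noteq> c" "\<not> (r = i \<and> c = j)" "\<not> (r = j \<and> c = i)" using assms by auto
    moreover from this(1) have "\<not> (r = k \<and> c = k)" for k by blast
    ultimately show "R t $ r $ c = 0"
      by (simp only: R_def P_def K_def matE_def mat_def vector_add_component vector_minus_component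
          vector_scaleR_component vec_lambda_beta if_False) simp
  qed
  ultimately show ?thesis
    unfolding orthogonal_velocity_def K_def[symmetric] by (intro exI[of _ R]) (auto simp: R_def)
qed

text \<open>The matrices \<open>matE i j - matE j i\<close> with both indices in one block span the
  skew-symmetric block-diagonal matrices, and each is the velocity of a plane rotation.\<close>

lemma orthogonal_velocity_antisymmetric:
  fixes B :: "real ^ 'm::finite ^ 'm"
  assumes "transpose B = - B" "block_diagonal I B"
  shows "orthogonal_velocity I B"
proof -
  have anti: "B $ c $ r = - B $ r $ c" for r c
    using arg_cong[OF assms(1), of "\<lambda>A. A $ r $ c"] by (simp add: transpose_def)
  \<comment> \<open>The half accounts for each pair occurring twice in the double sum. Pairs from
    different blocks have coefficient 0, so no rotation mixing the blocks is used.\<close>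
  have "orthogonal_velocity I ((B $ i $ j / 2) *\<^sub>R (matE i j - matE j i))" for i j
  proof (cases "(i \<in> I) = (j \<in> I)")
    case True
    then show ?thesis by (intro orthogonal_velocity_scale orthogonal_velocity_matE)
  next
    case False
    then have "B $ i $ j = 0" using assms(2) by (simp add: block_diagonal_def)
    then show ?thesis by (simp add: orthogonal_velocity_zero)
  qed
  then have "orthogonal_velocity I (\<Sum>i\<in>UNIV. \<Sum>j\<in>UNIV. (B $ i $ j / 2) *\<^sub>R (matE i j - matE j i))"
    by (intro orthogonal_velocity_sum)
  also have "(\<Sum>i\<in>UNIV. \<Sum>j\<in>UNIV. (B $ i $ j / 2) *\<^sub>R (matE i j - matE j i)) = B"
  proof -
    have "(\<Sum>i\<in>UNIV. \<Sum>j\<in>UNIV. (B $ i $ j / 2) *\<^sub>R (matE i j - matE j i)) $ r $ c = B $ r $ c" for r c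
    proof -
      have "(\<Sum>i\<in>UNIV. \<Sum>j\<in>UNIV. (B $ i $ j / 2) *\<^sub>R (matE i j - matE j i)) $ r $ c
        = (\<Sum>i\<in>UNIV. \<Sum>j\<in>UNIV. (if i = r then if j = c then B $ r $ c / 2 else 0 else 0))
          - (\<Sum>i\<in>UNIV. \<Sum>j\<in>UNIV. (if i = c then if j = r then B $ c $ r / 2 else 0 else 0))"
        unfolding sum_subtractf[symmetric] by (auto simp: matE_def intro!: sum.cong)
      also have "\<dots> = B $ r $ c / 2 - B $ c $ r / 2"
      proof -
        have "(\<Sum>j\<in>UNIV. if P then if j = c then z else 0 else 0) = (if P then z else 0)"
          for P and c :: 'm and z :: real by simp
        then show ?thesis by simp
      qed
      finally show ?thesis by (simp add: anti[of c r])
    qed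
    then show ?thesis by (simp add: vec_eq_iff)
  qed
  finally show ?thesis .
qed

section \<open>Curves of frames in a local trivialization\<close>

abbreviation sec :: "('m \<Rightarrow> 'a \<Rightarrow> 'a tvec) \<Rightarrow> 'a \<Rightarrow> ('a, 'm) fpoint" where
  "sec \<sigma> \<equiv> \<lambda>y. (y, \<lambda>k. \<sigma> k y)"

lemma velocity_cong:
  assumes "\<delta> > 0" "\<And>t. t \<in> {-\<delta><..<\<delta>} \<Longrightarrow> c t = c' t"
  shows "velocity \<A> c = velocity \<A> c'"
proof -
  have "eventually (\<lambda>t. t \<in> {-\<delta><..<\<delta>}) (nhds (0::real))"
    using assms(1) by (intro eventually_nhds_in_open) auto
  then have "deriv (f \<circ> c) 0 = deriv (f \<circ> c') 0" for f
    by (intro deriv_cong_ev) (auto elim!: eventually_mono simp: assms(2))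
  moreover have "c 0 = c' 0" using assms by auto
  ultimately show ?thesis by (simp only: velocity_def)
qed

locale linear_frame_field = vec_manifold \<A>
  for \<A> :: "('a, real ^ 'm::finite) chart set" +
  fixes \<sigma> :: "'m \<Rightarrow> 'a \<Rightarrow> 'a tvec" and W :: "'a set"
  assumes W: "open_in \<A> W" and \<sigma>: "\<And>j. smooth_vf \<A> W (\<sigma> j)"
    and LF: "\<And>y. y \<in> W \<Longrightarrow> sec \<sigma> y \<in> linear_frames \<A>"
begin

lemma smooth_fun_section_entry:
  assumes U: "(U, \<phi>) \<in> \<A>"
  shows "smooth_fun \<A> (W \<inter> U) (\<lambda>y. \<sigma> j y (\<lambda>z. \<phi> z $ i))"
  using smooth_fun_subset[OF smooth_fun_chart_nth[OF U], of "W \<inter> U" i]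
  by (intro smooth_vf_fun[OF \<sigma>] open_in_Int[OF W open_in_chart[OF U]]) auto

lemma frame_section_dom: "y \<in> W \<inter> U \<Longrightarrow> sec \<sigma> y \<in> frame_dom \<A> U"
  using LF by (auto simp: frame_dom_def)

text \<open>Smoothness of the section as a map into the frame bundle. It is stated for pulled-back
  functions since \<open>differential\<close> and \<open>velocity\<close> test exactly
  these.\<close>

lemma smooth_near_frame_section:
  assumes "x \<in> W" "smooth_near \<F> (sec \<sigma> x) f"
  shows "smooth_near \<A> x (f \<circ> sec \<sigma>)"
proof -
  let ?s = "sec \<sigma>"
  obtain W' where W': "open_in \<F> W'" "?s x \<in> W'" "smooth_fun \<F> W' f"
    using assms(2) unfolding smooth_near_def by blast
  obtain U \<phi> where U: "(U, \<phi>) \<in> \<A>" "x \<in> U"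
    using carrierE open_in_carrierD[OF W] assms(1) by blast
  let ?C = "frame_coord \<phi> \<circ> ?s \<circ> inv_into U \<phi>"
  have opWU: "open (\<phi> ` (W \<inter> U))" by (rule open_in_chartD[OF W U(1)])
  have entry: "smooth_on (\<phi> ` (W \<inter> U)) ((\<lambda>y. \<sigma> j y (\<lambda>z. \<phi> z $ i)) \<circ> inv_into U \<phi>)" for j i
    using smooth_funD[OF smooth_fun_section_entry[OF U(1)] U(1), of j i] by (simp add: Int_assoc)
  have "smooth_on (\<phi> ` (W \<inter> U)) (\<lambda>z. (z, \<chi> j i. ((\<lambda>y. \<sigma> j y (\<lambda>z. \<phi> z $ i)) \<circ> inv_into U \<phi>) z))"
    by (intro smooth_on_Pair[OF opWU] smooth_on_vec[OF opWU] smooth_on_ident entry)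
  then have C: "smooth_on (\<phi> ` (W \<inter> U)) ?C"
    by (rule smooth_on_eq[OF _ _ opWU]) (auto simp: frame_coord_def chart_inv[OF U(1)])
  \<comment> \<open>The part of the chart that the section maps into the domain of \<open>f\<close>.
    Its openness amounts to continuity of the section and is checked in bundle coordinates.\<close>
  define V where "V = {y \<in> W \<inter> U. ?s y \<in> W'}"
  have "\<phi> ` V = {z \<in> \<phi> ` (W \<inter> U). ?C z \<in> frame_coord \<phi> ` (W' \<inter> frame_dom \<A> U)}"
  proof (intro equalityI subsetI)
    fix z assume "z \<in> \<phi> ` V"
    then obtain y where "y \<in> W \<inter> U" "?s y \<in> W'" "z = \<phi> y" by (auto simp: V_def)
    then show "z \<in> {z \<in> \<phi> ` (W \<inter> U). ?C z \<in> frame_coord \<phi> ` (W' \<inter> frame_dom \<A> U)}"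
      using frame_section_dom[of y U] chart_inv[OF U(1), of y] by auto
  next
    fix z assume z: "z \<in> {z \<in> \<phi> ` (W \<inter> U). ?C z \<in> frame_coord \<phi> ` (W' \<inter> frame_dom \<A> U)}"
    then obtain y where y: "y \<in> W \<inter> U" "z = \<phi> y" by blast
    then have "frame_coord \<phi> (?s y) \<in> frame_coord \<phi> ` (W' \<inter> frame_dom \<A> U)"
      using z chart_inv[OF U(1), of y] by auto
    then have "?s y \<in> W'"
      using frame_section_dom[OF y(1)] inj_onD[OF frame_coord_inj[OF U(1)]] by blast
    then show "z \<in> \<phi> ` V" using y by (auto simp: V_def)
  qed
  moreover have "open \<dots>"
    by (intro continuous_on_open_Collect opWU smooth_on_imp_continuous_on[OF C]
        F.open_in_chartD[OF W'(1) frame_atlasI[OF U(1)]])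
  ultimately have opV: "open (\<phi> ` V)" by simp
  have "smooth_on (\<phi> ` V) ((f \<circ> inv_into (frame_dom \<A> U) (frame_coord \<phi>)) \<circ> ?C)"
  proof (rule smooth_on_compose[OF opV _ F.smooth_funD[OF W'(3) frame_atlasI[OF U(1)]]])
    show "smooth_on (\<phi> ` V) ?C" by (rule smooth_on_subset[OF C]) (auto simp: V_def)
    show "?C ` \<phi> ` V \<subseteq> frame_coord \<phi> ` (W' \<inter> frame_dom \<A> U)"
      using frame_section_dom by (auto simp: V_def chart_inv[OF U(1)])
  qed
  then have "smooth_on (\<phi> ` V) ((f \<circ> ?s) \<circ> inv_into U \<phi>)"
  proof (rule smooth_on_eq[OF _ _ opV])
    fix z assume "z \<in> \<phi> ` V"
    then obtain y where y: "y \<in> W \<inter> U" "z = \<phi> y" by (auto simp: V_def)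
    show "((f \<circ> inv_into (frame_dom \<A> U) (frame_coord \<phi>)) \<circ> ?C) z = ((f \<circ> ?s) \<circ> inv_into U \<phi>) z"
      using y inv_into_f_f[OF frame_coord_inj[OF U(1)] frame_section_dom[OF y(1)]]
        chart_inv[OF U(1), of y] by simp
  qed
  moreover have "V \<subseteq> U" "x \<in> V" using U(2) assms(1) W'(2) by (auto simp: V_def)
  ultimately show ?thesis
    using smooth_nearI[OF open_in_chartI[OF U(1) _ opV] _ smooth_fun_chartI[OF U(1) _ opV]] by blast
qed

lemma smooth_curve_frame_act:
  assumes U: "(U, \<phi>) \<in> \<A>" and c: "smooth_curve \<A> T c" "open T" "c ` T \<subseteq> W \<inter> U"
    and a: "smooth_on T a" "\<And>t. t \<in> T \<Longrightarrow> det (a t) \<noteq> 0"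
  shows "smooth_curve \<F> T (\<lambda>t. frame_act (a t) (sec \<sigma> (c t)))"
proof (rule F.smooth_curveI[OF frame_atlasI[OF U] c(2)])
  have T: "T \<inter> c -` (W \<inter> U) = T" "T \<inter> c -` U = T" using c(3) by auto
  show "(\<lambda>t. frame_act (a t) (sec \<sigma> (c t))) ` T \<subseteq> frame_dom \<A> U"
  proof (rule image_subsetI)
    fix t assume t: "t \<in> T"
    then have "c t \<in> W" "c t \<in> U" using c(3) by auto
    then show "frame_act (a t) (sec \<sigma> (c t)) \<in> frame_dom \<A> U"
      using frame_act_linear_frames[OF LF a(2)[OF t]] by (auto simp: frame_dom_def frame_act_def)
  qed
  have entry: "smooth_on T (\<lambda>t. \<sigma> j (c t) (\<lambda>z. \<phi> z $ i))" for j i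
    using smooth_curve_fun[OF c(1) open_in_Int[OF W open_in_chart[OF U]] smooth_fun_section_entry[OF U]]
    unfolding T by (simp add: comp_def)
  have tr: "smooth_on T (\<lambda>t. transpose (a t))"
    by (rule smooth_on_bounded_linear[OF c(2) bounded_linear_transpose a(1)])
  have N: "smooth_on T (\<lambda>t. \<chi> j i. \<sigma> j (c t) (\<lambda>z. \<phi> z $ i))"
    by (intro smooth_on_vec[OF c(2)] entry)
  have \<phi>c: "smooth_on T (\<lambda>t. \<phi> (c t))"
    using smooth_curve_chart(2)[OF c(1) U] unfolding T by (simp add: comp_def)
  have "smooth_on T (\<lambda>t. (\<phi> (c t), transpose (a t) ** (\<chi> j i. \<sigma> j (c t) (\<lambda>z. \<phi> z $ i))))"
    by (rule smooth_on_Pair[OF c(2) \<phi>c smooth_on_bounded_bilinear[OF c(2) bounded_bilinear_matrix_mult tr N]])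
  then show "smooth_on T (frame_coord \<phi> \<circ> (\<lambda>t. frame_act (a t) (sec \<sigma> (c t))))"
  proof (rule smooth_on_eq)
    have "frame_coord \<phi> (sec \<sigma> y) = (\<phi> y, \<chi> j i. \<sigma> j y (\<lambda>z. \<phi> z $ i))" for y
      by (simp add: frame_coord_def)
    then show "(\<phi> (c t), transpose (a t) ** (\<chi> j i. \<sigma> j (c t) (\<lambda>z. \<phi> z $ i)))
      = (frame_coord \<phi> \<circ> (\<lambda>t. frame_act (a t) (sec \<sigma> (c t)))) t" for t
      by (simp add: frame_coord_frame_act)
  qed (rule c(2))
qed

text \<open>The product rule in bundle coordinates: as \<open>a 0 = mat 1\<close>, the derivative of
  \<open>transpose (a t) ** N t\<close> at 0 is the derivative of \<open>N\<close> plus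
  \<open>transpose C ** N 0\<close>. The first summand belongs to the section along
  \<open>c\<close>, the second to the fundamental vector.\<close>

lemma velocity_frame_act:
  assumes U: "(U, \<phi>) \<in> \<A>" and c: "smooth_curve \<A> {-\<delta><..<\<delta>} c" "\<delta> > 0" "c ` {-\<delta><..<\<delta>} \<subseteq> W \<inter> U" "c 0 = x"
    and a: "smooth_on {-\<delta><..<\<delta>} a" "\<And>t. t \<in> {-\<delta><..<\<delta>} \<Longrightarrow> det (a t) \<noteq> 0" "a 0 = mat 1"
      "(a has_vector_derivative C) (at 0)"
  shows "velocity \<F> (\<lambda>t. frame_act (a t) (sec \<sigma> (c t)))
    = differential \<F> (sec \<sigma>) x (velocity \<A> c) + fundamental \<A> C (sec \<sigma> x)"
proof -
  let ?T = "{-\<delta><..<\<delta>}" and ?s = "sec \<sigma>" and ?F = \<F>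
  let ?v = "chart_vec ?F (frame_dom \<A> U) (frame_coord \<phi>)"
  let ?\<gamma> = "\<lambda>t. frame_act (a t) (?s (c t))"
  have T: "open ?T" "0 \<in> ?T" and x: "x \<in> W" "x \<in> U" using c by auto
  have act1: "frame_act (mat 1) q = q" for q :: "('a, 'm) fpoint"
  proof -
    have "(\<Sum>l\<in>UNIV. (mat 1 :: real ^ 'm ^ 'm) $ l $ k *\<^sub>t w l) = w k" for w :: "'m \<Rightarrow> 'a tvec" and k
      by (simp add: mat_def tscale_if cong: if_cong)
    then show ?thesis by (simp add: frame_act_def split_def)
  qed
  have sc: "smooth_curve ?F ?T (?s \<circ> c)"
    using smooth_curve_frame_act[OF U c(1) T(1) c(3) smooth_on_const[of _ "mat 1"]] act1 by (simp add: comp_def)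
  have dom: "?s x \<in> frame_dom \<A> U" using frame_section_dom x by blast
  define d where "d = vector_derivative (frame_coord \<phi> \<circ> (?s \<circ> c)) (at 0)"
  have d: "((frame_coord \<phi> \<circ> (?s \<circ> c)) has_vector_derivative d) (at 0)"
    and vs: "velocity ?F (?s \<circ> c) = ?v d (?s x)"
    using F.velocity_eq_chart_vec(1,2)[OF sc T frame_atlasI[OF U]] dom c(4) unfolding d_def by auto
  have \<gamma>: "smooth_curve ?F ?T ?\<gamma>" by (rule smooth_curve_frame_act[OF U c(1) T(1) c(3) a(1,2)])
  have \<gamma>0: "?\<gamma> 0 = ?s x" using a(3) c(4) act1 by simp
  define N where "N t = snd (frame_coord \<phi> (?s (c t)))" for t
  have N': "(N has_vector_derivative snd d) (at 0)" and \<phi>': "((\<lambda>t. \<phi> (c t)) has_vector_derivative fst d) (at 0)"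
    using bounded_linear.has_vector_derivative[OF bounded_linear_snd d]
      bounded_linear.has_vector_derivative[OF bounded_linear_fst d]
    by (simp_all add: N_def[abs_def] comp_def frame_coord_def)
  have "((\<lambda>t. transpose (a t)) has_vector_derivative transpose C) (at 0)"
    by (rule bounded_linear.has_vector_derivative[OF bounded_linear_transpose a(4)])
  from has_vector_derivative_Pair[OF \<phi>' has_vector_derivative_matrix_mult[OF this N']]
  have "((\<lambda>t. (\<phi> (c t), transpose (a t) ** N t)) has_vector_derivative (fst d, snd d + transpose C ** N 0)) (at 0)"
    by (simp add: a(3) transpose_mat)
  moreover have "(\<lambda>t. (\<phi> (c t), transpose (a t) ** N t)) = frame_coord \<phi> \<circ> ?\<gamma>"
    by (auto simp: frame_coord_frame_act N_def)
  moreover have "(fst d, snd d + transpose C ** N 0) = d + (0, transpose C ** N 0)"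
    by (simp add: prod_eq_iff)
  ultimately have "((frame_coord \<phi> \<circ> ?\<gamma>) has_vector_derivative d + (0, transpose C ** N 0)) (at 0)"
    by simp
  then have "vector_derivative (frame_coord \<phi> \<circ> ?\<gamma>) (at 0) = d + (0, transpose C ** N 0)"
    by (rule vector_derivative_at)
  then have "velocity ?F ?\<gamma> = ?v (d + (0, transpose C ** N 0)) (?s x)"
    using F.velocity_eq_chart_vec(2)[OF \<gamma> T frame_atlasI[OF U]] dom unfolding \<gamma>0 by simp
  also have "\<dots> = ?v d (?s x) + ?v (0, transpose C ** N 0) (?s x)"
    by (rule F.chart_vec_add[OF frame_atlasI[OF U] dom])
  also have "?v (0, transpose C ** N 0) (?s x) = fundamental \<A> C (?s x)"
    using fundamental_eq_chart_vec[OF U dom] c(4) by (simp add: N_def)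
  \<comment> \<open>The section pulls smooth functions back to smooth ones, so the conventional
    zeros on both sides agree.\<close>
  also have "?v d (?s x) = differential ?F ?s x (velocity \<A> c)"
    unfolding vs[symmetric] differential_def velocity_def
    using smooth_near_frame_section[OF x(1)] c(4) by (auto simp: fun_eq_iff comp_assoc)
  finally show ?thesis .
qed

end

lemma frame_act_eq: "frame_act a (y, u) = (y, \<lambda>k. frame_map u (column k a))"
  by (simp add: frame_act_def frame_map_def column_def)

lemma orthogonal_det_nz: "transpose a ** a = mat 1 \<Longrightarrow> det (a :: real ^ 'm::finite ^ 'm) \<noteq> 0"
proof
  assume "transpose a ** a = mat 1" "det a = 0"
  then have "det (transpose a ** a) = 1" by simp
  then show False using \<open>det a = 0\<close> by (simp add: det_mul)
qed

lemma frame_map_diff: "frame_map u (a - b) = frame_map u a - frame_map u b"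
  and frame_map_uminus: "frame_map u (- a) = - frame_map u a"
  by (simp_all add: frame_map_def tscale_distrib sum_subtractf sum_negf)

context vec_riemannian_manifold
begin

lemma metric_frame_map_inner:
  assumes "\<And>i j. g y (u i) (u j) = (if i = j then 1 else 0)" "\<And>i. u i \<in> tangent_space \<A> y"
  shows "g y (frame_map u a) (frame_map u b) = a \<bullet> (b :: real ^ 'm)"
proof -
  have b: "frame_map u b \<in> tangent_space \<A> y" unfolding frame_map_def
    by (intro tangent_space_sum tangent_space_scale assms(2) tangent_in_base(2)[OF assms(2)])
  have "g y (frame_map u a) (frame_map u b) = (\<Sum>i\<in>UNIV. g y ((a $ i) *\<^sub>t u i) (frame_map u b))"
    unfolding frame_map_def[of u a] using b assms(2) tangent_space_scale
    by (intro metric_sum) auto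
  also have "\<dots> = (\<Sum>i\<in>UNIV. a $ i * b $ i)"
    by (intro sum.cong refl)
      (simp only: metric_scale[OF assms(2) b] metric_frame_map(2)[OF assms])
  finally show ?thesis by (simp add: inner_vec_def)
qed

lemma orthonormal_framesD:
  assumes "(y, u) \<in> orthonormal_frames \<A> g"
  shows "g y (u i) (u j) = (if i = j then 1 else 0)" "u i \<in> tangent_space \<A> y" "(y, u) \<in> linear_frames \<A>"
  using assms linear_frames_tangent by (auto simp: orthonormal_frames_def)

lemma frame_act_orthonormal:
  assumes "(y, u) \<in> orthonormal_frames \<A> g" "transpose R ** R = mat 1"
  shows "frame_act R (y, u) \<in> orthonormal_frames \<A> g"
proof -
  note u = orthonormal_framesD[OF assms(1)]
  have "column i R \<bullet> column j R = (transpose R ** R) $ i $ j" for i j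
    by (simp add: inner_vec_def column_def matrix_matrix_mult_def transpose_def)
  then have "g y (frame_map u (column i R)) (frame_map u (column j R)) = (if i = j then 1 else 0)" for i j
    using metric_frame_map_inner[OF u(1,2)] assms(2) by (simp add: mat_def)
  then show ?thesis
    using frame_act_linear_frames[OF u(3) orthogonal_det_nz[OF assms(2)]]
    by (simp add: orthonormal_frames_def frame_act_eq)
qed

end

locale adapted_frame_field = vec_riemannian_manifold \<A> g
  for \<A> :: "('a, real ^ 'm::finite) chart set" and g :: "'a metric" +
  fixes M W :: "'a set" and I :: "'m set" and \<sigma> :: "'m \<Rightarrow> 'a \<Rightarrow> 'a tvec"
  assumes frame: "local_frame \<A> g M I W \<sigma>"
begin

abbreviation "\<Phi> y \<equiv> frame_map (\<lambda>j. \<sigma> j y)"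

lemma frame_open: "open_in \<A> W"
  and frame_smooth: "smooth_vf \<A> W (\<sigma> j)"
  and frame_orthonormal: "y \<in> W \<Longrightarrow> g y (\<sigma> i y) (\<sigma> j y) = (if i = j then 1 else 0)"
  and frame_tangent_space: "y \<in> W \<Longrightarrow> tangent_space \<A> y = range (\<Phi> y)"
  and frame_tangent_in: "y \<in> W \<Longrightarrow> y \<in> M \<Longrightarrow> tangent_in \<A> M y = \<Phi> y ` coord_subspace I"
  using frame unfolding local_frame_def by auto

lemma frame_tangent: "y \<in> W \<Longrightarrow> \<sigma> j y \<in> tangent_space \<A> y"
  using smooth_vf_tangent[OF frame_smooth] .

lemma frame_coeff: "y \<in> W \<Longrightarrow> g y (\<Phi> y a) (\<sigma> k y) = a $ k"
  using metric_frame_map(1)[OF frame_orthonormal frame_tangent] by simp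

lemma frame_expand:
  assumes "y \<in> W" "v \<in> tangent_space \<A> y"
  shows "v = \<Phi> y (\<chi> k. g y v (\<sigma> k y))"
proof -
  obtain a where a: "v = \<Phi> y a" using assms frame_tangent_space by blast
  then have "(\<chi> k. g y v (\<sigma> k y)) = a" by (simp add: vec_eq_iff frame_coeff[OF assms(1)])
  then show ?thesis using a by simp
qed

lemma frame_map_frame_inj: "y \<in> W \<Longrightarrow> inj (\<Phi> y)"
  using frame_coeff by (intro injI) (metis vec_eq_iff)

lemma frame_section_orthonormal: "y \<in> W \<Longrightarrow> sec \<sigma> y \<in> orthonormal_frames \<A> g"
  using frame_map_frame_inj frame_tangent_space frame_orthonormal open_in_carrierD[OF frame_open]
  by (auto simp: orthonormal_frames_def linear_frames_def bij_betw_def)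

lemma frame_section_linear: "y \<in> W \<Longrightarrow> sec \<sigma> y \<in> linear_frames \<A>"
  using frame_section_orthonormal by (auto simp: orthonormal_frames_def)

sublocale linear_frame_field \<A> \<sigma> W
  by unfold_locales (rule frame_open frame_smooth frame_section_linear; assumption?)+

lemma frame_act_adapted:
  assumes "y \<in> W" "y \<in> M" "transpose R ** R = mat 1" "block_diagonal I R"
  shows "frame_act R (sec \<sigma> y) \<in> adapted_frames \<A> g M I"
proof -
  have "\<Phi> y (column i R) \<in> tangent_in \<A> M y" if "i \<in> I" for i
    unfolding frame_tangent_in[OF assms(1,2)]
    using that assms(4) by (intro imageI) (auto simp: column_def block_diagonal_def)
  then show ?thesis
    using frame_act_orthonormal[OF frame_section_orthonormal[OF assms(1)] assms(3)] assms(2)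
    by (simp add: adapted_frames_def frame_act_eq)
qed

text \<open>One half of the description of tangent vectors: the curve is the section along a curve
  with velocity \<open>X\<close>, turned by orthogonal matrices with velocity \<open>C\<close>. The
  parameters \<open>M'\<close>, \<open>J\<close> and \<open>Q\<close> let one proof cover O(N), its
  restriction to \<open>M\<close>, and O(M,N).\<close>

lemma tangent_frame_section:
  assumes x: "x \<in> W" and X: "X \<in> tangent_in \<A> M' x"
    and C: "transpose C = - C" "block_diagonal J C"
    and Q: "\<And>y R. y \<in> W \<Longrightarrow> y \<in> M' \<Longrightarrow> transpose R ** R = mat 1 \<Longrightarrow> block_diagonal J R \<Longrightarrow>
      frame_act R (sec \<sigma> y) \<in> Q"
  defines "Z \<equiv> differential \<F> (sec \<sigma>) x X + fundamental \<A> C (sec \<sigma> x)"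
  shows "Z \<in> tangent_in \<F> Q (sec \<sigma> x)"
    and "differential \<A> fst (sec \<sigma> x) Z = X"
proof -
  obtain c \<epsilon> where c: "X = velocity \<A> c" "\<epsilon> > 0" "smooth_curve \<A> {-\<epsilon><..<\<epsilon>} c" "c 0 = x" "c ` {-\<epsilon><..<\<epsilon>} \<subseteq> M'"
    using tangent_inE[OF X] by metis
  obtain U \<phi> where U: "(U, \<phi>) \<in> \<A>" "x \<in> U"
    using carrierE open_in_carrierD[OF frame_open] x by blast
  have WU: "open_in \<A> (W \<inter> U)" by (rule open_in_Int[OF frame_open open_in_chart[OF U(1)]])
  obtain \<delta> where \<delta>: "0 < \<delta>" "\<delta> \<le> \<epsilon>" "c ` {-\<delta><..<\<delta>} \<subseteq> W \<inter> U" "smooth_curve \<A> {-\<delta><..<\<delta>} c"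
    using smooth_curve_shrink[OF c(3,2) WU] c(4) x U(2) by auto
  obtain R where R: "smooth_on UNIV R" "R 0 = mat 1" "(R has_vector_derivative C) (at 0)"
      "\<And>t. transpose (R t) ** R t = mat 1" "\<And>t. block_diagonal J (R t)"
    using orthogonal_velocity_antisymmetric[OF C] unfolding orthogonal_velocity_def by auto
  let ?T = "{-\<delta><..<\<delta>}" and ?\<gamma> = "\<lambda>t. frame_act (R t) (sec \<sigma> (c t))"
  have det: "det (R t) \<noteq> 0" for t by (rule orthogonal_det_nz[OF R(4)])
  have smR: "smooth_on ?T R" by (rule smooth_on_subset[OF R(1)]) simp
  have curve: "smooth_curve \<F> ?T ?\<gamma>"
    by (rule smooth_curve_frame_act[OF U(1) \<delta>(4) _ \<delta>(3) smR])
      (auto simp: det)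
  have Z: "velocity \<F> ?\<gamma> = Z"
    unfolding Z_def c(1)
    by (rule velocity_frame_act[OF U(1) \<delta>(4,1,3) c(4) smR det R(2,3)])
  have 0: "?\<gamma> 0 = sec \<sigma> x"
    using R(2) c(4) by (simp add: frame_act_def mat_def tscale_if cong: if_cong)
  have "?\<gamma> ` ?T \<subseteq> Q"
  proof (rule image_subsetI)
    fix t assume "t \<in> ?T"
    then have "c t \<in> W" "c t \<in> M'" using \<delta> c(5) by (auto simp: image_subset_iff)
    then show "?\<gamma> t \<in> Q" using Q R(4,5) by blast
  qed
  then show "Z \<in> tangent_in \<F> Q (sec \<sigma> x)"
    using tangent_inI[OF \<delta>(1) curve 0] Z by simp
  have "fst \<circ> ?\<gamma> = c" by (auto simp: frame_act_def)
  then show "differential \<A> fst (sec \<sigma> x) Z = X"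
    using differential_fst_velocity[of ?\<gamma>] frame_section_linear[OF x] unfolding 0 Z c(1) by simp
qed

text \<open>The converse half: near time 0 a curve of orthonormal frames is the section along its
  base curve, turned by its matrices of components \<open>a\<close>, and \<open>C\<close> is the
  velocity of \<open>a\<close>.\<close>

lemma frame_curve_decomposition:
  assumes \<gamma>: "smooth_curve \<F> {-\<epsilon><..<\<epsilon>} \<gamma>" "\<epsilon> > 0" "\<gamma> ` {-\<epsilon><..<\<epsilon>} \<subseteq> orthonormal_frames \<A> g"
    and \<gamma>0: "\<gamma> 0 = sec \<sigma> x" "x \<in> W"
  shows "\<exists>C. velocity \<F> \<gamma> = differential \<F> (sec \<sigma>) x (velocity \<A> (fst \<circ> \<gamma>))
      + fundamental \<A> C (sec \<sigma> x) \<and> transpose C = - C \<and>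
      (\<gamma> ` {-\<epsilon><..<\<epsilon>} \<subseteq> adapted_frames \<A> g M I \<longrightarrow> block_diagonal I C)"
proof -
  define c where "c = fst \<circ> \<gamma>"
  have c: "smooth_curve \<A> {-\<epsilon><..<\<epsilon>} c" "c 0 = x"
    unfolding c_def using smooth_curve_fst[OF \<gamma>(1)] \<gamma>0 by auto
  obtain U \<phi> where U: "(U, \<phi>) \<in> \<A>" "x \<in> U"
    using carrierE open_in_carrierD[OF frame_open] \<gamma>0(2) by blast
  have WU: "open_in \<A> (W \<inter> U)" by (rule open_in_Int[OF frame_open open_in_chart[OF U(1)]])
  obtain \<delta> where \<delta>: "0 < \<delta>" "\<delta> \<le> \<epsilon>" "c ` {-\<delta><..<\<delta>} \<subseteq> W \<inter> U" "smooth_curve \<A> {-\<delta><..<\<delta>} c"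
    using smooth_curve_shrink[OF c(1) \<gamma>(2) WU] c(2) \<gamma>0(2) U(2) by auto
  let ?T = "{-\<delta><..<\<delta>}"
  have cT: "c t \<in> W" "c t \<in> U" if "t \<in> ?T" for t using \<delta>(3) that by auto
  have \<gamma>T: "(c t, snd (\<gamma> t)) \<in> orthonormal_frames \<A> g" "\<gamma> t = (c t, snd (\<gamma> t))" if "t \<in> ?T" for t
  proof -
    show "\<gamma> t = (c t, snd (\<gamma> t))" by (simp add: c_def)
    have "t \<in> {-\<epsilon><..<\<epsilon>}" using \<delta>(2) that by auto
    then show "(c t, snd (\<gamma> t)) \<in> orthonormal_frames \<A> g" using \<gamma>(3) by (auto simp: c_def)
  qed
  note uT = orthonormal_framesD[OF \<gamma>T(1)]
  \<comment> \<open>Entry \<open>l\<close>, \<open>j\<close> is the component of the moving vector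
    \<open>j\<close> along \<open>\<sigma> l\<close>, so column \<open>j\<close> expands that vector
    in the frame field.\<close>
  define a where "a t = (\<chi> l j. g (c t) (snd (\<gamma> t) j) (\<sigma> l (c t)))" for t
  have u: "snd (\<gamma> t) j = \<Phi> (c t) (column j (a t))" if "t \<in> ?T" for t j
    using frame_expand[OF cT(1)[OF that] uT(2)[OF that]] by (simp add: column_def a_def)
  have \<gamma>_act: "\<gamma> t = frame_act (a t) (sec \<sigma> (c t))" if "t \<in> ?T" for t
    using \<gamma>T(2)[OF that] u[OF that] by (simp add: frame_act_eq prod_eq_iff fun_eq_iff)
  have orth: "transpose (a t) ** a t = mat 1" if t: "t \<in> ?T" for t
  proof -
    have "(transpose (a t) ** a t) $ i $ j = column i (a t) \<bullet> column j (a t)" for i j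
      by (simp add: inner_vec_def column_def matrix_matrix_mult_def transpose_def)
    also have "\<dots> i j = g (c t) (snd (\<gamma> t) i) (snd (\<gamma> t) j)" for i j
      unfolding u[OF t]
      using metric_frame_map_inner[OF frame_orthonormal[OF cT(1)[OF t]] frame_tangent[OF cT(1)[OF t]]] by simp
    also have "\<dots> i j = mat 1 $ i $ j" for i j using uT(1)[OF t] by (simp add: mat_def)
    finally show ?thesis by (simp add: vec_eq_iff)
  qed
  have dom: "?T \<subseteq> {-\<epsilon><..<\<epsilon>} \<inter> \<gamma> -` frame_dom \<A> U"
  proof
    fix t assume t: "t \<in> ?T"
    then have "\<gamma> t \<in> frame_dom \<A> U" using uT(3)[OF t] cT(2)[OF t] \<gamma>T(2)[OF t] by (auto simp: frame_dom_def)
    then show "t \<in> {-\<epsilon><..<\<epsilon>} \<inter> \<gamma> -` frame_dom \<A> U" using t \<delta>(2) by auto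
  qed
  have smu: "smooth_on ?T (\<lambda>t. snd (\<gamma> t) j (\<lambda>z. \<phi> z $ k))" for j k
  proof -
    have bl: "bounded_linear (\<lambda>p :: (real ^ 'm) \<times> (real ^ 'm ^ 'm). snd p $ j $ k)"
      by (intro bounded_linear_compose[OF bounded_linear_vec_nth] bounded_linear_compose[OF bounded_linear_vec_nth] bounded_linear_snd)
    have sm: "smooth_on ?T (frame_coord \<phi> \<circ> \<gamma>)"
      using smooth_on_subset[OF F.smooth_curve_chart(2)[OF \<gamma>(1) frame_atlasI[OF U(1)]] dom] .
    have "smooth_on ?T (\<lambda>t. snd ((frame_coord \<phi> \<circ> \<gamma>) t) $ j $ k)"
      by (rule smooth_on_bounded_linear[OF _ bl sm]) simp
    then show ?thesis by (simp add: frame_coord_def split_def)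
  qed
  \<comment> \<open>The metric is known to be smooth only on vector fields over open sets, not along
    curves. The moving vectors are therefore expanded in coordinate fields, whose products with the
    frame field are smooth functions of the base point.\<close>
  let ?e = "\<lambda>k. chart_vec \<A> U \<phi> (axis k 1)"
  have sme: "smooth_on ?T (\<lambda>t. g (c t) (?e k (c t)) (\<sigma> l (c t)))" for k l
  proof -
    have "smooth_vf \<A> (W \<inter> U) (?e k)" "smooth_vf \<A> (W \<inter> U) (\<sigma> l)"
      using smooth_vf_subset[OF smooth_vf_chart_vec[OF U(1)] WU]
        smooth_vf_subset[OF frame_smooth WU] by auto
    then have "smooth_fun \<A> (W \<inter> U) (\<lambda>y. g y (?e k y) (\<sigma> l y))" by (rule metric_smooth)
    from smooth_curve_fun[OF \<delta>(4) WU this] show ?thesis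
      using \<delta>(3) by (simp add: comp_def image_subset_iff_subset_vimage Int_absorb2)
  qed
  have a_eq: "(\<Sum>k\<in>UNIV. snd (\<gamma> t) j (\<lambda>z. \<phi> z $ k) * g (c t) (?e k (c t)) (\<sigma> l (c t))) = a t $ l $ j"
    if t: "t \<in> ?T" for t l j
  proof -
    have e: "?e k (c t) \<in> tangent_space \<A> (c t)" for k by (rule chart_vec_in_tangent_space[OF U(1) cT(2)[OF t]])
    have "snd (\<gamma> t) j = chart_vec \<A> U \<phi> (\<chi> k. snd (\<gamma> t) j (\<lambda>z. \<phi> z $ k)) (c t)"
      using tangent_space_chart_vec_nth[OF U(1) cT(2)[OF t] uT(2)[OF t, of j]] by simp
    also have "(\<chi> k. snd (\<gamma> t) j (\<lambda>z. \<phi> z $ k)) = (\<Sum>k\<in>UNIV. snd (\<gamma> t) j (\<lambda>z. \<phi> z $ k) *\<^sub>R axis k 1)"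
      by (simp add: vec_eq_iff axis_def if_distrib[of "(*) _"] cong: if_cong)
    also have "chart_vec \<A> U \<phi> \<dots> (c t) = (\<Sum>k\<in>UNIV. snd (\<gamma> t) j (\<lambda>z. \<phi> z $ k) *\<^sub>t ?e k (c t))"
      by (simp only: chart_vec_sum[OF U(1) cT(2)[OF t]] chart_vec_scale[OF U(1) cT(2)[OF t]])
    finally have v: "snd (\<gamma> t) j = (\<Sum>k\<in>UNIV. snd (\<gamma> t) j (\<lambda>z. \<phi> z $ k) *\<^sub>t ?e k (c t))" .
    have "a t $ l $ j = g (c t) (snd (\<gamma> t) j) (\<sigma> l (c t))"
      by (simp add: a_def)
    also have "\<dots> = g (c t) (\<Sum>k\<in>UNIV. snd (\<gamma> t) j (\<lambda>z. \<phi> z $ k) *\<^sub>t ?e k (c t)) (\<sigma> l (c t))"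
      by (rule arg_cong[OF v, of "\<lambda>v. g (c t) v (\<sigma> l (c t))"])
    also have "\<dots> = (\<Sum>k\<in>UNIV. g (c t) (snd (\<gamma> t) j (\<lambda>z. \<phi> z $ k) *\<^sub>t ?e k (c t)) (\<sigma> l (c t)))"
      by (rule metric_sum[OF frame_tangent[OF cT(1)[OF t]] tangent_space_scale[OF e]])
    finally show ?thesis by (simp only: metric_scale[OF e frame_tangent[OF cT(1)[OF t]]])
  qed
  have "smooth_on ?T (\<lambda>t. \<chi> l j. \<Sum>k\<in>UNIV. snd (\<gamma> t) j (\<lambda>z. \<phi> z $ k) * g (c t) (?e k (c t)) (\<sigma> l (c t)))"
    using smu sme by (intro smooth_on_vec smooth_on_sum smooth_on_mult) auto
  then have sma: "smooth_on ?T a"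
    by (rule smooth_on_eq) (simp_all add: a_eq vec_eq_iff)
  have a0: "a 0 = mat 1"
    using \<gamma>0 frame_orthonormal[OF \<gamma>0(2)] c(2) by (auto simp: a_def mat_def vec_eq_iff)
  define C where "C = vector_derivative a (at 0)"
  have C: "(a has_vector_derivative C) (at 0)"
  proof -
    have "a differentiable (at 0)"
      using smooth_on_has_derivative[OF sma, of 0] \<delta>(1) unfolding differentiable_def by auto
    then show ?thesis unfolding C_def using vector_derivative_works by blast
  qed
  have vel: "velocity \<F> \<gamma> = differential \<F> (sec \<sigma>) x (velocity \<A> c)
      + fundamental \<A> C (sec \<sigma> x)"
  proof -
    have "velocity \<F> \<gamma> = velocity \<F> (\<lambda>t. frame_act (a t) (sec \<sigma> (c t)))"
      by (rule velocity_cong[OF \<delta>(1) \<gamma>_act])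
    also have "\<dots> = differential \<F> (sec \<sigma>) x (velocity \<A> c) + fundamental \<A> C (sec \<sigma> x)"
      by (rule velocity_frame_act[OF U(1) \<delta>(4,1,3) c(2) sma
            orthogonal_det_nz[OF orth] a0 C])
    finally show ?thesis .
  qed
  have constant_derivative: "D = 0" if "(h has_vector_derivative D) (at 0)" "\<And>t. t \<in> ?T \<Longrightarrow> h t = k" for h :: "real \<Rightarrow> 'b::real_normed_vector" and D k
  proof -
    have "((\<lambda>t. k) has_vector_derivative D) (at 0)"
      by (rule has_vector_derivative_transform_within_open[OF that(1), of ?T]) (use \<delta>(1) that(2) in auto)
    then show ?thesis using vector_derivative_unique_at has_vector_derivative_const by metis
  qed
  \<comment> \<open>Differentiating \<open>transpose (a t) ** a t = mat 1\<close> at 0, where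
    \<open>a\<close> is the identity, makes \<open>C\<close> skew-symmetric.\<close>
  have "((\<lambda>t. transpose (a t)) has_vector_derivative transpose C) (at 0)"
    by (rule bounded_linear.has_vector_derivative[OF bounded_linear_transpose C])
  from has_vector_derivative_matrix_mult[OF this C]
  have "((\<lambda>t. transpose (a t) ** a t) has_vector_derivative C + transpose C) (at 0)"
    by (simp add: a0 transpose_mat)
  then have "C + transpose C = 0" by (rule constant_derivative) (rule orth)
  then have anti: "transpose C = - C" by (simp add: add_eq_0_iff)
  have "block_diagonal I C" if ad: "\<gamma> ` {-\<epsilon><..<\<epsilon>} \<subseteq> adapted_frames \<A> g M I"
  proof -
    \<comment> \<open>For \<open>j\<close> in \<open>I\<close> column \<open>j\<close> of
      \<open>a t\<close> expands a vector tangent to \<open>M\<close>, which has no component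
      outside \<open>I\<close>.\<close>
    have lower: "C $ l $ j = 0" if "l \<notin> I" "j \<in> I" for l j
    proof -
      have "bounded_linear (\<lambda>A :: real ^ 'm ^ 'm. A $ l $ j)"
        by (intro bounded_linear_compose[OF bounded_linear_vec_nth] bounded_linear_vec_nth)
      from bounded_linear.has_vector_derivative[OF this C]
      have "((\<lambda>t. a t $ l $ j) has_vector_derivative C $ l $ j) (at 0)" .
      moreover have "a t $ l $ j = 0" if t: "t \<in> ?T" for t
      proof -
        have "t \<in> {-\<epsilon><..<\<epsilon>}" using t \<delta>(2) by auto
        then have "(c t, snd (\<gamma> t)) \<in> adapted_frames \<A> g M I" using ad \<gamma>T(2)[OF t] by (metis image_subset_iff)
        then have "c t \<in> M" "snd (\<gamma> t) j \<in> tangent_in \<A> M (c t)" using \<open>j \<in> I\<close> by (auto simp: adapted_frames_def)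
        then obtain b where "snd (\<gamma> t) j = \<Phi> (c t) b" "b \<in> coord_subspace I"
          using frame_tangent_in[OF cT(1)[OF t]] by blast
        then show ?thesis using frame_coeff[OF cT(1)[OF t], of b l] \<open>l \<notin> I\<close> by (simp add: a_def)
      qed
      ultimately show ?thesis using constant_derivative by blast
    qed
    \<comment> \<open>Skew-symmetry carries the vanishing over to the opposite block.\<close>
    have "C $ j $ l = 0" if "l \<notin> I" "j \<in> I" for l j
      using arg_cong[OF anti, of "\<lambda>A. A $ l $ j"] lower[OF that] by (simp add: transpose_def)
    then show ?thesis using lower unfolding block_diagonal_def by blast
  qed
  then show ?thesis using vel anti unfolding c_def by blast
qed

text \<open>The two halves combined: matrices of block type \<open>J\<close> parametrise the tangent
  vectors of \<open>Q\<close> over \<open>X\<close>, and horizontality for \<theta> singles out one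
  of them, which gives existence and uniqueness in the description. The alternatives for
  \<open>J\<close> in the second condition on \<open>Q\<close> ensure that every curve in
  \<open>Q\<close> yields a matrix of that type.\<close>

lemma horizontal_lift_eq:
  assumes x: "x \<in> W" and X: "X \<in> tangent_in \<A> M' x"
    and C: "transpose C = - C" "block_diagonal J C"
    and Q: "Q \<subseteq> orthonormal_frames \<A> g" "J = UNIV \<or> J = I \<and> Q \<subseteq> adapted_frames \<A> g M I"
      "\<And>y R. y \<in> W \<Longrightarrow> y \<in> M' \<Longrightarrow> transpose R ** R = mat 1 \<Longrightarrow> block_diagonal J R \<Longrightarrow>
        frame_act R (sec \<sigma> y) \<in> Q"
    and \<theta>: "\<And>C'. transpose C' = - C' \<Longrightarrow> block_diagonal J C' \<Longrightarrow>
      \<theta> (sec \<sigma> x) (differential \<F> (sec \<sigma>) x X + fundamental \<A> C' (sec \<sigma> x)) = 0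
        \<longleftrightarrow> C' = C"
  shows "horizontal_lift \<A> Q \<theta> (sec \<sigma> x) X
    = differential \<F> (sec \<sigma>) x X + fundamental \<A> C (sec \<sigma> x)"
  unfolding horizontal_lift_def
proof (rule the_equality, intro conjI)
  let ?Z = "differential \<F> (sec \<sigma>) x X + fundamental \<A> C (sec \<sigma> x)"
  show "?Z \<in> tangent_in \<F> Q (sec \<sigma> x)"
    "differential \<A> fst (sec \<sigma> x) ?Z = X"
    by (rule tangent_frame_section[OF x X C Q(3)]; assumption)+
  show "\<theta> (sec \<sigma> x) ?Z = 0" using \<theta>[OF C] by simp
next
  fix Z assume Z: "Z \<in> tangent_in \<F> Q (sec \<sigma> x) \<and>
    differential \<A> fst (sec \<sigma> x) Z = X \<and> \<theta> (sec \<sigma> x) Z = 0"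
  obtain \<gamma> \<epsilon> where \<gamma>: "Z = velocity \<F> \<gamma>" "\<epsilon> > 0" "smooth_curve \<F> {-\<epsilon><..<\<epsilon>} \<gamma>"
    "\<gamma> 0 = sec \<sigma> x" "\<gamma> ` {-\<epsilon><..<\<epsilon>} \<subseteq> Q"
    using tangent_inE[OF conjunct1[OF Z]] by metis
  have "velocity \<A> (fst \<circ> \<gamma>) = X"
    using Z differential_fst_velocity[of \<gamma>] frame_section_linear[OF x] \<gamma>(1,4) by simp
  then obtain C' where C': "Z = differential \<F> (sec \<sigma>) x X + fundamental \<A> C' (sec \<sigma> x)"
    "transpose C' = - C'" "\<gamma> ` {-\<epsilon><..<\<epsilon>} \<subseteq> adapted_frames \<A> g M I \<longrightarrow> block_diagonal I C'"
    using frame_curve_decomposition[OF \<gamma>(3,2) subset_trans[OF \<gamma>(5) Q(1)] \<gamma>(4) x] \<gamma>(1) by auto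
  then have "block_diagonal J C'" using Q(2) \<gamma>(5) by (auto simp: block_diagonal_def)
  then have "C' = C" using \<theta>[OF C'(2)] conjunct2[OF conjunct2[OF Z]] C'(1) by simp
  then show "Z = differential \<F> (sec \<sigma>) x X + fundamental \<A> C (sec \<sigma> x)"
    using C'(1) by simp
qed

end

section \<open>Covariant derivatives in an adapted frame\<close>

lemma smooth_vf_nearI: "x \<in> W \<Longrightarrow> smooth_vf \<A> W Y \<Longrightarrow> smooth_vf_near \<A> x Y"
  unfolding smooth_vf_near_def by blast

definition coord_proj :: "'m set \<Rightarrow> real ^ 'm::finite \<Rightarrow> real ^ 'm" where
  "coord_proj J a = (\<chi> j. if j \<in> J then a $ j else 0)"

lemma coord_proj_nth [simp]: "coord_proj J a $ j = (if j \<in> J then a $ j else 0)"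
  by (simp add: coord_proj_def)

lemma coord_proj_compl: "a - coord_proj J a = coord_proj (- J) a"
  by (simp add: vec_eq_iff)

definition off_diagonal :: "'m set \<Rightarrow> real ^ 'm::finite ^ 'm \<Rightarrow> real ^ 'm ^ 'm" where
  "off_diagonal I B = (\<chi> i j. if (i \<in> I) = (j \<in> I) then 0 else B $ i $ j)"

text \<open>In an adapted frame the two terms are the tangential part of what normal components
  contribute and the normal part of what tangential ones contribute: the matrix form of the tensor
  S.\<close>

lemma off_diagonal_mult:
  "off_diagonal I B *v a = coord_proj I (B *v coord_proj (- I) a) + coord_proj (- I) (B *v coord_proj I a)"
  by (auto simp: vec_eq_iff off_diagonal_def matrix_vector_mult_def intro!: sum.cong)

lemma matrix_eq_sum_matE: "A = (\<Sum>i\<in>UNIV. \<Sum>j\<in>UNIV. (A $ j $ i) *\<^sub>R matE j i)"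
proof -
  have "(\<Sum>i\<in>UNIV. \<Sum>j\<in>UNIV. (A $ j $ i) *\<^sub>R matE j i) $ r $ c = A $ r $ c" for r c
  proof -
    have "(\<Sum>i\<in>UNIV. \<Sum>j\<in>UNIV. (A $ j $ i) *\<^sub>R matE j i) $ r $ c
      = (\<Sum>i\<in>UNIV. \<Sum>j\<in>UNIV. A $ j $ i * matE j i $ r $ c)"
      by simp
    also have "\<dots> = (\<Sum>i\<in>UNIV. \<Sum>j\<in>UNIV. if j = r then if i = c then A $ r $ c else 0 else 0)"
      by (intro sum.cong refl) (auto simp: matE_def)
    also have "\<dots> = A $ r $ c" by simp
    finally show ?thesis .
  qed
  then show ?thesis by (simp add: vec_eq_iff)
qed

locale covariant_manifold = vec_manifold \<A>
  for \<A> :: "('a, real ^ 'm::finite) chart set" +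
  fixes nabla :: "'a cov"
  assumes cov: "covariant_derivative \<A> nabla"
begin

lemma nabla_add: "X \<in> tangent_space \<A> x \<Longrightarrow> smooth_vf_near \<A> x Y \<Longrightarrow> smooth_vf_near \<A> x Z \<Longrightarrow>
    nabla x X (\<lambda>y. Y y + Z y) = nabla x X Y + nabla x X Z"
  and nabla_mult: "X \<in> tangent_space \<A> x \<Longrightarrow> smooth_vf_near \<A> x Y \<Longrightarrow> smooth_near \<A> x f \<Longrightarrow>
    nabla x X (\<lambda>y. f y *\<^sub>t Y y) = f x *\<^sub>t nabla x X Y + X f *\<^sub>t Y x"
  using cov tangent_in_base(2)[of X \<A> "carrier_of \<A>" x] unfolding covariant_derivative_def by simp_all

lemma nabla_sum:
  assumes X: "X \<in> tangent_space \<A> x" and W: "x \<in> W" "open_in \<A> W"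
    and Y: "\<And>i. i \<in> A \<Longrightarrow> smooth_vf \<A> W (Y i)"
  shows "nabla x X (\<lambda>y. \<Sum>i\<in>A. Y i y) = (\<Sum>i\<in>A. nabla x X (Y i))"
proof -
  \<comment> \<open>The Leibniz rule for the zero field and the constant function 0.\<close>
  have zero: "nabla x X (\<lambda>y. 0) = 0"
  proof -
    have sv: "smooth_vf_near \<A> x (\<lambda>y. 0)"
      using smooth_vf_sum[OF W(2), of "{}"] W(1) by (auto simp: smooth_vf_near_def)
    show ?thesis
      using nabla_mult[OF X sv smooth_near_const[OF tangent_in_base(2)[OF X], of 0]]
        tangent_const[OF X, of 0] by simp
  qed
  show ?thesis
    using Y
  proof (induction A rule: infinite_finite_induct)
    case (insert i A)
    have sv: "smooth_vf_near \<A> x (Y i)" "smooth_vf_near \<A> x (\<lambda>y. \<Sum>i\<in>A. Y i y)"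
      using insert.prems by (auto intro!: smooth_vf_nearI[OF W(1)] smooth_vf_sum[OF W(2)])
    have IH: "nabla x X (\<lambda>y. \<Sum>i\<in>A. Y i y) = (\<Sum>i\<in>A. nabla x X (Y i))"
      using insert.IH insert.prems by blast
    show ?case
      unfolding sum.insert[OF insert.hyps] IH[symmetric] by (rule nabla_add[OF X sv])
  qed (simp_all add: zero)
qed

text \<open>Multiplying by the indicator function of a neighbourhood, which is smooth near the point,
  turns fields with the same germ into equal fields.\<close>

lemma nabla_germ:
  assumes X: "X \<in> tangent_space \<A> x" and W: "x \<in> W" "open_in \<A> W"
    and Y: "smooth_vf_near \<A> x Y" and Z: "smooth_vf_near \<A> x Z" and eq: "\<And>y. y \<in> W \<Longrightarrow> Y y = Z y"
  shows "nabla x X Y = nabla x X Z"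
proof -
  define f where "f y = (if y \<in> W then 1 else 0 :: real)" for y
  have one: "smooth_near \<A> x (\<lambda>y. 1)" by (rule smooth_near_const[OF tangent_in_base(2)[OF X]])
  have f: "smooth_near \<A> x f"
    using smooth_near_cong[OF W(2,1), of f "\<lambda>y. 1"] one by (simp add: f_def)
  have "X f = X (\<lambda>y. 1)"
    by (rule tangent_in_cong_on[OF X W(2,1) f one]) (simp add: f_def)
  then have Xf: "X f = 0" using tangent_const[OF X] by simp
  have "(\<lambda>y. f y *\<^sub>t Y y) = (\<lambda>y. f y *\<^sub>t Z y)" using eq by (auto simp: f_def fun_eq_iff)
  moreover have "nabla x X (\<lambda>y. f y *\<^sub>t V y) = nabla x X V" if "smooth_vf_near \<A> x V" for V
    unfolding nabla_mult[OF X that f] Xf using W(1) by (simp add: f_def)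
  ultimately show ?thesis using Y Z by metis
qed

end

text \<open>The data at one point and in one direction: column \<open>j\<close> of \<open>B\<close>
  holds the components of the derivative of \<open>\<sigma> j\<close>. The connection form does not
  appear here; it supplies \<open>B\<close> in the final proof.\<close>

locale adapted_frame_at = adapted_frame_field \<A> g M W I \<sigma> + covariant_manifold \<A> nabla
  for \<A> :: "('a, real ^ 'm::finite) chart set" and g :: "'a metric" and M W :: "'a set" and I :: "'m set"
    and \<sigma> :: "'m \<Rightarrow> 'a \<Rightarrow> 'a tvec" and nabla :: "'a cov" +
  fixes x :: 'a and X :: "'a tvec" and B :: "real ^ 'm ^ 'm"
  assumes x: "x \<in> W" "x \<in> M" and X: "X \<in> tangent_in \<A> M x"
    and B: "\<And>j. nabla x X (\<sigma> j) = (\<Sum>i\<in>UNIV. (B $ i $ j) *\<^sub>t \<sigma> i x)"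
begin

section \<open>Covariant derivatives in frame components\<close>

abbreviation "u \<equiv> \<lambda>j. \<sigma> j x"

lemma X_tangent: "X \<in> tangent_space \<A> x"
  by (rule subsetD[OF tangent_in_subset_tangent_space X])

definition frame_coeffs :: "('a \<Rightarrow> 'a tvec) \<Rightarrow> 'a \<Rightarrow> real ^ 'm" where
  "frame_coeffs Y y = (\<chi> i. g y (Y y) (\<sigma> i y))"

definition frame_derivs :: "('a \<Rightarrow> 'a tvec) \<Rightarrow> real ^ 'm" where
  "frame_derivs Y = (\<chi> i. X (\<lambda>y. g y (Y y) (\<sigma> i y)))"

lemma smooth_near_frame_coeff:
  assumes "smooth_vf_near \<A> x Y"
  shows "smooth_near \<A> x (\<lambda>y. g y (Y y) (\<sigma> i y))"
proof -
  obtain V where V: "x \<in> V" "smooth_vf \<A> V Y" using assms unfolding smooth_vf_near_def by blast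
  have op: "open_in \<A> (V \<inter> W)" using open_in_Int[OF smooth_vf_open[OF V(2)] frame_open] .
  have "smooth_fun \<A> (V \<inter> W) (\<lambda>y. g y (Y y) (\<sigma> i y))"
    by (intro metric_smooth smooth_vf_subset[OF V(2) op] smooth_vf_subset[OF frame_smooth op]) auto
  then show ?thesis using smooth_nearI[OF op] V(1) x(1) by blast
qed

text \<open>The Leibniz rule for the expansion of \<open>Y\<close> in the frame: the components are
  differentiated by \<open>X\<close>, and the derivatives of the frame vectors contribute
  \<open>B\<close>. The expansion holds only near \<open>x\<close>, so locality of
  \<open>nabla\<close> enters.\<close>

lemma nabla_frame:
  assumes Y: "smooth_vf_near \<A> x Y"
  shows "nabla x X Y = frame_map u (frame_derivs Y + B *v frame_coeffs Y x)"
proof -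
  obtain V where V: "x \<in> V" "smooth_vf \<A> V Y" using Y unfolding smooth_vf_near_def by blast
  let ?W = "V \<inter> W"
  have op: "open_in \<A> ?W" using open_in_Int[OF smooth_vf_open[OF V(2)] frame_open] .
  have xW: "x \<in> ?W" using V(1) x(1) by blast
  let ?f = "\<lambda>i y. g y (Y y) (\<sigma> i y)"
  have smf: "smooth_fun \<A> ?W (?f i)" and sms: "smooth_vf \<A> ?W (\<sigma> i)" for i
    by (intro metric_smooth smooth_vf_subset[OF V(2) op] smooth_vf_subset[OF frame_smooth op]; blast)+
  have smfs: "smooth_vf \<A> ?W (\<lambda>y. ?f i y *\<^sub>t \<sigma> i y)" for i by (rule smooth_vf_scale[OF sms smf])
  have "nabla x X Y = nabla x X (\<lambda>y. \<Sum>i\<in>UNIV. ?f i y *\<^sub>t \<sigma> i y)"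
  proof (rule nabla_germ[OF X_tangent xW op Y])
    show "smooth_vf_near \<A> x (\<lambda>y. \<Sum>i\<in>UNIV. ?f i y *\<^sub>t \<sigma> i y)"
      by (rule smooth_vf_nearI[OF xW smooth_vf_sum[OF op smfs]])
    show "Y y = (\<Sum>i\<in>UNIV. ?f i y *\<^sub>t \<sigma> i y)" if "y \<in> ?W" for y
      using frame_expand[of y "Y y"] smooth_vf_tangent[OF V(2), of y] that
      by (simp add: frame_map_def)
  qed
  also have "\<dots> = (\<Sum>i\<in>UNIV. nabla x X (\<lambda>y. ?f i y *\<^sub>t \<sigma> i y))"
    by (rule nabla_sum[OF X_tangent xW op smfs])
  also have "\<dots> = (\<Sum>i\<in>UNIV. ?f i x *\<^sub>t nabla x X (\<sigma> i) + X (?f i) *\<^sub>t \<sigma> i x)"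
  proof (rule sum.cong[OF refl])
    fix i
    have "smooth_vf_near \<A> x (\<sigma> i)" by (rule smooth_vf_nearI[OF xW sms])
    then show "nabla x X (\<lambda>y. ?f i y *\<^sub>t \<sigma> i y) = ?f i x *\<^sub>t nabla x X (\<sigma> i) + X (?f i) *\<^sub>t \<sigma> i x"
      by (rule nabla_mult[OF X_tangent _ smooth_nearI[OF op xW smf]])
  qed
  also have "\<dots> = frame_map u (frame_derivs Y) + (\<Sum>i\<in>UNIV. ?f i x *\<^sub>t (\<Sum>l\<in>UNIV. (B $ l $ i) *\<^sub>t \<sigma> l x))"
    by (simp add: B sum.distrib frame_map_def frame_derivs_def add.commute)
  also have "(\<Sum>i\<in>UNIV. ?f i x *\<^sub>t (\<Sum>l\<in>UNIV. (B $ l $ i) *\<^sub>t \<sigma> l x))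
      = (\<Sum>l\<in>UNIV. \<Sum>i\<in>UNIV. (?f i x * B $ l $ i) *\<^sub>t \<sigma> l x)"
    by (subst sum.swap) (simp add: tscale_sum)
  also have "\<dots> = frame_map u (B *v frame_coeffs Y x)"
    by (simp add: frame_map_def matrix_vector_mult_def frame_coeffs_def tscale_sum mult.commute)
  finally show ?thesis by (simp only: frame_map_add)
qed

text \<open>As \<open>X\<close> is tangent to \<open>M\<close>, a component may be replaced by any
  function smooth near \<open>x\<close> with the same values on \<open>M\<close>.\<close>

lemma frame_derivs_cong:
  assumes Y: "smooth_vf_near \<A> x Y" and W': "open_in \<A> W'" "x \<in> W'"
    and h: "smooth_near \<A> x h" "\<And>y. y \<in> W' \<inter> M \<Longrightarrow> g y (Y y) (\<sigma> i y) = h y"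
  shows "frame_derivs Y $ i = X h"
  using tangent_in_cong_on[OF X W' smooth_near_frame_coeff[OF Y] h] by (simp add: frame_derivs_def)

lemma extends_sectionD:
  assumes "extends_section \<A> M x s Y"
  shows "smooth_vf_near \<A> x Y" "Y x = s x"
  using assms x unfolding extends_section_def smooth_vf_near_def by blast+

text \<open>Justifies the description in \<open>cov_along\<close>: two extensions have components
  that agree on \<open>M\<close> near \<open>x\<close>, hence the same derivatives along
  \<open>X\<close> and the same value at \<open>x\<close>.\<close>

lemma cov_along_eq:
  assumes Y: "extends_section \<A> M x s Y"
  shows "cov_along \<A> nabla M x X s = frame_map u (frame_derivs Y + B *v frame_coeffs Y x)"
  unfolding cov_along_def
proof (rule the_equality)
  show "\<exists>Y'. extends_section \<A> M x s Y' \<and> frame_map u (frame_derivs Y + B *v frame_coeffs Y x) = nabla x X Y'"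
    using Y nabla_frame[OF extends_sectionD(1)[OF Y]] by metis
  fix V assume "\<exists>Y'. extends_section \<A> M x s Y' \<and> V = nabla x X Y'"
  then obtain Y' where Y': "extends_section \<A> M x s Y'" "V = nabla x X Y'" by blast
  obtain W1 W2 where W: "x \<in> W1" "smooth_vf \<A> W1 Y" "\<forall>y\<in>W1 \<inter> M. Y y = s y"
    "x \<in> W2" "smooth_vf \<A> W2 Y'" "\<forall>y\<in>W2 \<inter> M. Y' y = s y"
    using Y Y'(1) unfolding extends_section_def by blast
  have op: "open_in \<A> (W1 \<inter> W2)"
    using open_in_Int[OF smooth_vf_open[OF W(2)] smooth_vf_open[OF W(5)]] .
  have "frame_derivs Y' $ i = frame_derivs Y $ i" for i
  proof -
    have "frame_derivs Y' $ i = X (\<lambda>y. g y (Y y) (\<sigma> i y))"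
      using W smooth_near_frame_coeff[OF extends_sectionD(1)[OF Y]]
      by (intro frame_derivs_cong[OF extends_sectionD(1)[OF Y'(1)] op]) auto
    then show ?thesis by (simp add: frame_derivs_def)
  qed
  then have "frame_derivs Y' = frame_derivs Y" by (simp add: vec_eq_iff)
  moreover have "frame_coeffs Y' x = frame_coeffs Y x"
    using extends_sectionD(2)[OF Y] extends_sectionD(2)[OF Y'(1)] by (simp add: frame_coeffs_def)
  ultimately show "V = frame_map u (frame_derivs Y + B *v frame_coeffs Y x)"
    using nabla_frame[OF extends_sectionD(1)[OF Y'(1)]] Y'(2) by simp
qed

section \<open>Tangential and normal parts along the submanifold\<close>

lemma tan_part_frame_map:
  assumes y: "y \<in> W" "y \<in> M"
  shows "tan_part \<A> g M y (\<Phi> y a) = \<Phi> y (coord_proj I a)"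
  unfolding tan_part_def
proof (rule the_equality)
  let ?u = "\<lambda>j. \<sigma> j y"
  note TM = frame_tangent_in[OF y]
  note inner = metric_frame_map_inner[OF frame_orthonormal[OF y(1)] frame_tangent[OF y(1)]]
  show "frame_map ?u (coord_proj I a) \<in> tangent_in \<A> M y \<and>
    (\<forall>z\<in>tangent_in \<A> M y. g y (frame_map ?u a - frame_map ?u (coord_proj I a)) z = 0)"
  proof (intro conjI ballI)
    show "frame_map ?u (coord_proj I a) \<in> tangent_in \<A> M y" unfolding TM by (intro imageI) simp
    fix z assume "z \<in> tangent_in \<A> M y"
    then obtain b where b: "z = frame_map ?u b" "b \<in> coord_subspace I" unfolding TM by blast
    have "(coord_proj (- I) a) \<bullet> b = 0"
      using b(2) by (auto simp: inner_vec_def intro!: sum.neutral)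
    then show "g y (frame_map ?u a - frame_map ?u (coord_proj I a)) z = 0"
      unfolding b(1) frame_map_diff[symmetric] coord_proj_compl inner .
  qed
next
  let ?u = "\<lambda>j. \<sigma> j y"
  note TM = frame_tangent_in[OF y]
  fix w assume w: "w \<in> tangent_in \<A> M y \<and> (\<forall>z\<in>tangent_in \<A> M y. g y (frame_map ?u a - w) z = 0)"
  then obtain b where b: "w = frame_map ?u b" "b \<in> coord_subspace I" unfolding TM by blast
  \<comment> \<open>Inside \<open>I\<close>, orthogonality to the frame vector \<open>i\<close>
    fixes the component; outside, tangency to \<open>M\<close> makes it 0.\<close>
  have "b $ i = coord_proj I a $ i" for i
  proof (cases "i \<in> I")
    case True
    then have "\<sigma> i y \<in> tangent_in \<A> M y"
      unfolding TM by (intro image_eqI[of _ _ "axis i 1"]) (simp add: frame_map_axis, auto simp: axis_def)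
    then have "g y (frame_map ?u (a - b)) (\<sigma> i y) = 0" using w unfolding b(1) frame_map_diff by blast
    then show ?thesis using True by (simp only: frame_coeff[OF y(1)]) simp
  next
    case False
    then show ?thesis using b(2) by simp
  qed
  then show "w = frame_map ?u (coord_proj I a)" using b(1) by (metis vec_eq_iff)
qed

lemma nor_part_frame_map:
  "y \<in> W \<Longrightarrow> y \<in> M \<Longrightarrow> nor_part \<A> g M y (\<Phi> y a) = \<Phi> y (coord_proj (- I) a)"
  by (simp only: nor_part_def tan_part_frame_map frame_map_diff[symmetric] coord_proj_compl)

text \<open>\<open>J = I\<close> treats the tangential part of a section, \<open>J = - I\<close> the
  normal part. Taking such a part only deletes components, which commutes with \<open>X\<close>; it
  need not commute with \<open>B\<close>, and that defect is the tensor S. The tangency premise for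
  \<open>s'\<close> is there because \<open>s\<close> is known to consist of tangent vectors only
  where it has an extension.\<close>

lemma cov_along_proj:
  assumes Y: "extends_section \<A> M x s Y"
    and s': "\<And>y. y \<in> W \<Longrightarrow> y \<in> M \<Longrightarrow> s y \<in> tangent_space \<A> y \<Longrightarrow>
      s' y = \<Phi> y (coord_proj J (frame_coeffs s y))"
  shows "cov_along \<A> nabla M x X s' = frame_map u (coord_proj J (frame_derivs Y) + B *v coord_proj J (frame_coeffs Y x))"
proof -
  obtain V where V: "x \<in> V" "smooth_vf \<A> V Y" "\<forall>y\<in>V \<inter> M. Y y = s y"
    using Y unfolding extends_section_def by blast
  let ?W = "V \<inter> W"
  have op: "open_in \<A> ?W" using open_in_Int[OF smooth_vf_open[OF V(2)] frame_open] .
  have xW: "x \<in> ?W" using V(1) x(1) by blast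
  \<comment> \<open>The projected extension is a smooth extension of the projected section.\<close>
  define Y' where "Y' y = (\<Sum>i\<in>J. g y (Y y) (\<sigma> i y) *\<^sub>t \<sigma> i y)" for y
  have Y'_eq: "Y' y = \<Phi> y (coord_proj J (frame_coeffs Y y))" for y
    unfolding Y'_def by (subst frame_map_subset[of J]) (auto simp: frame_coeffs_def)
  have smY': "smooth_vf \<A> ?W Y'"
    unfolding Y'_def[abs_def]
    by (intro smooth_vf_sum[OF op] smooth_vf_scale metric_smooth
        smooth_vf_subset[OF V(2) op] smooth_vf_subset[OF frame_smooth op]) auto
  have "s' y = Y' y" if y: "y \<in> ?W \<inter> M" for y
  proof -
    have "s y = Y y" using V(3) y by auto
    then show ?thesis
      using s'[of y] smooth_vf_tangent[OF V(2), of y] y by (simp add: Y'_eq frame_coeffs_def)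
  qed
  then have ext: "extends_section \<A> M x s' Y'"
    unfolding extends_section_def using xW smY' by (intro exI[of _ ?W]) simp
  have near: "smooth_vf_near \<A> x Y'" "smooth_vf_near \<A> x Y"
    by (rule smooth_vf_nearI[OF xW smY'], rule smooth_vf_nearI[OF V(1,2)])
  have c: "g y (Y' y) (\<sigma> i y) = (if i \<in> J then g y (Y y) (\<sigma> i y) else 0)" if "y \<in> W" for y i
    unfolding Y'_eq frame_coeff[OF that] by (simp add: frame_coeffs_def)
  have "frame_derivs Y' $ i = coord_proj J (frame_derivs Y) $ i" for i
  proof (cases "i \<in> J")
    case True
    have "frame_derivs Y' $ i = X (\<lambda>y. g y (Y y) (\<sigma> i y))"
      by (rule frame_derivs_cong[OF near(1) op xW smooth_near_frame_coeff[OF near(2)]]) (simp add: c True)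
    then show ?thesis using True by (simp add: frame_derivs_def)
  next
    case False
    have "frame_derivs Y' $ i = X (\<lambda>y. 0)"
      by (rule frame_derivs_cong[OF near(1) op xW smooth_near_const[OF tangent_in_base(2)[OF X_tangent]]]) (simp add: c False)
    then show ?thesis using False tangent_const[OF X_tangent] by simp
  qed
  then have "frame_derivs Y' = coord_proj J (frame_derivs Y)" by (intro iffD2[OF vec_eq_iff] allI)
  moreover have "frame_coeffs Y' x = coord_proj J (frame_coeffs Y x)"
    using c[OF x(1)] by (simp add: vec_eq_iff frame_coeffs_def)
  ultimately show ?thesis using cov_along_eq[OF ext] by simp
qed

text \<open>The derivatives of the components occur equally in both connections and cancel. What is
  left depends only on the value of the section at \<open>x\<close>: this is the tensoriality of
  S.\<close>

lemma cov_along_minus_cov':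
  assumes Y: "extends_section \<A> M x s Y"
  shows "cov_along \<A> nabla M x X s - cov' \<A> g nabla M x X s = frame_map u (off_diagonal I B *v frame_coeffs Y x)"
proof -
  have exp: "s y = \<Phi> y (frame_coeffs s y)" if "y \<in> W" "s y \<in> tangent_space \<A> y" for y
    using frame_expand[OF that] unfolding frame_coeffs_def .
  have 1: "cov_along \<A> nabla M x X (\<lambda>y. tan_part \<A> g M y (s y))
      = frame_map u (coord_proj I (frame_derivs Y) + B *v coord_proj I (frame_coeffs Y x))"
    by (rule cov_along_proj[OF Y]) (metis exp tan_part_frame_map)
  have 2: "cov_along \<A> nabla M x X (\<lambda>y. nor_part \<A> g M y (s y))
      = frame_map u (coord_proj (- I) (frame_derivs Y) + B *v coord_proj (- I) (frame_coeffs Y x))"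
    by (rule cov_along_proj[OF Y]) (metis exp nor_part_frame_map)
  let ?D = "frame_derivs Y" and ?F = "frame_coeffs Y x"
  have "B *v ?F = B *v coord_proj I ?F + B *v coord_proj (- I) ?F"
    unfolding matrix_vector_right_distrib[symmetric] by (rule arg_cong[of _ _ "(*v) B"]) (simp add: vec_eq_iff)
  then have "?D + B *v ?F - (coord_proj I (coord_proj I ?D + B *v coord_proj I ?F)
      + coord_proj (- I) (coord_proj (- I) ?D + B *v coord_proj (- I) ?F)) = off_diagonal I B *v ?F"
    unfolding off_diagonal_mult by (auto simp: vec_eq_iff)
  then show ?thesis
    unfolding cov'_def 1 2 cov_along_eq[OF Y] tan_part_frame_map[OF x] nor_part_frame_map[OF x]
    by (simp only: frame_map_add[symmetric] frame_map_diff[symmetric])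
qed

lemma section_along_extends: "section_along \<A> M W' s \<Longrightarrow> x \<in> W' \<Longrightarrow> \<exists>Y. extends_section \<A> M x s Y"
  using x(2) unfolding section_along_def by blast

lemma section_along_frame: "section_along \<A> M W (\<sigma> k)"
  unfolding section_along_def extends_section_def using frame_open frame_smooth by blast

lemma frame_coeffs_at:
  assumes "Y x = \<sigma> k x"
  shows "frame_coeffs Y x = axis k 1"
  using frame_orthonormal[OF x(1)] assms by (auto simp: frame_coeffs_def axis_def vec_eq_iff)

section \<open>The tensor S, the second fundamental form and the Weingarten operator on frame
  vectors\<close>

lemma diff_tensor_frame:
  "diff_tensor \<A> g nabla M x X (\<sigma> k x) = frame_map u (column k (off_diagonal I B))"
  unfolding diff_tensor_def
proof (rule the_equality)
  have val: "cov_along \<A> nabla M x X s - cov' \<A> g nabla M x X s = frame_map u (column k (off_diagonal I B))"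
    if s: "x \<in> W'" "section_along \<A> M W' s" "s x = \<sigma> k x" for W' s
  proof -
    obtain Y where Y: "extends_section \<A> M x s Y" using section_along_extends[OF s(2,1)] by blast
    show ?thesis
      using cov_along_minus_cov'[OF Y] frame_coeffs_at[of Y k] extends_sectionD(2)[OF Y] s(3)
      by (simp add: matrix_vector_mult_basis)
  qed
  show "\<exists>W s. x \<in> W \<and> section_along \<A> M W s \<and> s x = \<sigma> k x \<and>
      frame_map u (column k (off_diagonal I B)) = cov_along \<A> nabla M x X s - cov' \<A> g nabla M x X s"
    using val[OF x(1) section_along_frame] x(1) section_along_frame[of k] by metis
  show "V = frame_map u (column k (off_diagonal I B))"
    if "\<exists>W s. x \<in> W \<and> section_along \<A> M W s \<and> s x = \<sigma> k x \<and>
      V = cov_along \<A> nabla M x X s - cov' \<A> g nabla M x X s" for V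
    using that val by blast
qed

text \<open>Common core for the second fundamental form, with \<open>J = - I\<close>, and the
  Weingarten operator, with \<open>J = I\<close>: components that vanish along \<open>M\<close> have
  zero derivative in direction \<open>X\<close>, so in the block \<open>J\<close> only column
  \<open>k\<close> of \<open>B\<close> remains.\<close>

lemma cov_along_vanishing:
  assumes s: "x \<in> W'" "section_along \<A> M W' s" "s x = \<sigma> k x"
    and zero: "\<And>y i. y \<in> W' \<Longrightarrow> y \<in> W \<Longrightarrow> y \<in> M \<Longrightarrow> i \<in> J \<Longrightarrow> g y (s y) (\<sigma> i y) = 0"
  shows "\<exists>a. cov_along \<A> nabla M x X s = frame_map u a \<and> coord_proj J a = coord_proj J (column k B)"
proof -
  obtain Y where Y: "extends_section \<A> M x s Y" using section_along_extends[OF s(2,1)] by blast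
  obtain V where V: "x \<in> V" "smooth_vf \<A> V Y" "\<forall>y\<in>V \<inter> M. Y y = s y"
    using Y unfolding extends_section_def by blast
  have W': "open_in \<A> W'" using s(2) unfolding section_along_def by blast
  have op: "open_in \<A> (V \<inter> (W \<inter> W'))"
    using open_in_Int[OF smooth_vf_open[OF V(2)] open_in_Int[OF frame_open W']] .
  have d: "frame_derivs Y $ i = 0" if "i \<in> J" for i
  proof -
    have "frame_derivs Y $ i = X (\<lambda>y. 0)"
      using V(1) x(1) s(1)
      by (intro frame_derivs_cong[OF extends_sectionD(1)[OF Y] op _ smooth_near_const[OF tangent_in_base(2)[OF X_tangent]]])
        (use V(3) zero \<open>i \<in> J\<close> in auto)
    then show ?thesis using tangent_const[OF X_tangent] by simp
  qed
  have B': "B *v frame_coeffs Y x = column k B"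
    using frame_coeffs_at[of Y k] extends_sectionD(2)[OF Y] s(3) by (simp add: matrix_vector_mult_basis)
  have "coord_proj J (frame_derivs Y + B *v frame_coeffs Y x) = coord_proj J (column k B)"
    unfolding B' by (simp add: vec_eq_iff d)
  then show ?thesis using cov_along_eq[OF Y] by blast
qed

lemma frame_tangent_to_submanifold: "y \<in> W \<Longrightarrow> y \<in> M \<Longrightarrow> i \<in> I \<Longrightarrow> \<sigma> i y \<in> tangent_in \<A> M y"
  unfolding frame_tangent_in
  by (intro image_eqI[of _ _ "axis i 1"]) (simp add: frame_map_axis, auto simp: axis_def)

lemma second_fundamental_form_frame:
  assumes k: "k \<in> I"
  shows "second_fundamental_form \<A> g nabla M x X (\<sigma> k x) = frame_map u (column k (off_diagonal I B))"
  unfolding second_fundamental_form_def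
proof (rule the_equality)
  have val: "nor_part \<A> g M x (cov_along \<A> nabla M x X s) = frame_map u (column k (off_diagonal I B))"
    if s: "x \<in> W'" "section_along \<A> M W' s" "\<forall>y\<in>W' \<inter> M. s y \<in> tangent_in \<A> M y" "s x = \<sigma> k x" for W' s
  proof -
    have zero: "g y (s y) (\<sigma> i y) = 0" if y: "y \<in> W'" "y \<in> W" "y \<in> M" "i \<in> - I" for y i
    proof -
      have "s y \<in> tangent_in \<A> M y" using s(3) y by blast
      then obtain b where "s y = \<Phi> y b" "b \<in> coord_subspace I"
        unfolding frame_tangent_in[OF y(2,3)] by blast
      then show ?thesis using frame_coeff[OF y(2), of b i] y(4) by simp
    qed
    obtain a where a: "cov_along \<A> nabla M x X s = frame_map u a" "coord_proj (- I) a = coord_proj (- I) (column k B)"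
      using cov_along_vanishing[OF s(1,2,4) zero] by blast
    \<comment> \<open>For \<open>k\<close> in \<open>I\<close> the off-diagonal blocks meet column
      \<open>k\<close> exactly in the rows outside \<open>I\<close>.\<close>
    have "coord_proj (- I) (column k B) = column k (off_diagonal I B)"
      using k by (auto simp: vec_eq_iff column_def off_diagonal_def)
    then show ?thesis by (simp only: a nor_part_frame_map[OF x])
  qed
  have ex: "\<forall>y\<in>W \<inter> M. \<sigma> k y \<in> tangent_in \<A> M y" using frame_tangent_to_submanifold k by blast
  show "\<exists>W s. x \<in> W \<and> section_along \<A> M W s \<and> (\<forall>y\<in>W \<inter> M. s y \<in> tangent_in \<A> M y) \<and> s x = \<sigma> k x \<and>
      frame_map u (column k (off_diagonal I B)) = nor_part \<A> g M x (cov_along \<A> nabla M x X s)"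
    using val[OF x(1) section_along_frame ex] x(1) section_along_frame[of k] ex by metis
  show "V = frame_map u (column k (off_diagonal I B))"
    if "\<exists>W s. x \<in> W \<and> section_along \<A> M W s \<and> (\<forall>y\<in>W \<inter> M. s y \<in> tangent_in \<A> M y) \<and> s x = \<sigma> k x \<and>
      V = nor_part \<A> g M x (cov_along \<A> nabla M x X s)" for V
    using that val by blast
qed

lemma weingarten_frame:
  assumes k: "k \<notin> I"
  shows "weingarten \<A> g nabla M x (\<sigma> k x) X = - frame_map u (column k (off_diagonal I B))"
  unfolding weingarten_def
proof (rule the_equality)
  have val: "- tan_part \<A> g M x (cov_along \<A> nabla M x X s) = - frame_map u (column k (off_diagonal I B))"
    if s: "x \<in> W'" "section_along \<A> M W' s" "\<forall>y\<in>W' \<inter> M. \<forall>z\<in>tangent_in \<A> M y. g y (s y) z = 0" "s x = \<sigma> k x" for W' s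
  proof -
    have zero: "g y (s y) (\<sigma> i y) = 0" if "y \<in> W'" "y \<in> W" "y \<in> M" "i \<in> I" for y i
      using s(3) frame_tangent_to_submanifold[OF that(2-4)] that by blast
    obtain a where a: "cov_along \<A> nabla M x X s = frame_map u a" "coord_proj I a = coord_proj I (column k B)"
      using cov_along_vanishing[OF s(1,2,4) zero] by blast
    \<comment> \<open>For \<open>k\<close> outside \<open>I\<close> the off-diagonal blocks meet
      column \<open>k\<close> exactly in the rows inside \<open>I\<close>.\<close>
    have "coord_proj I (column k B) = column k (off_diagonal I B)"
      using k by (auto simp: vec_eq_iff column_def off_diagonal_def)
    then show ?thesis by (simp only: a tan_part_frame_map[OF x])
  qed
  have ex: "\<forall>y\<in>W \<inter> M. \<forall>z\<in>tangent_in \<A> M y. g y (\<sigma> k y) z = 0"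
  proof (intro ballI)
    fix y z assume y: "y \<in> W \<inter> M" and "z \<in> tangent_in \<A> M y"
    then obtain b where "z = \<Phi> y b" "b \<in> coord_subspace I"
      using frame_tangent_in[of y] by blast
    moreover have "g y (\<sigma> k y) (\<Phi> y b) = b $ k"
      by (rule metric_frame_map(2)[OF frame_orthonormal frame_tangent])
        (use y in auto)
    ultimately show "g y (\<sigma> k y) z = 0" using k by simp
  qed
  show "\<exists>W s. x \<in> W \<and> section_along \<A> M W s \<and> (\<forall>y\<in>W \<inter> M. \<forall>z\<in>tangent_in \<A> M y. g y (s y) z = 0) \<and>
      s x = \<sigma> k x \<and> - frame_map u (column k (off_diagonal I B)) = - tan_part \<A> g M x (cov_along \<A> nabla M x X s)"
    using val[OF x(1) section_along_frame ex] x(1) section_along_frame[of k] ex by metis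
  show "V = - frame_map u (column k (off_diagonal I B))"
    if "\<exists>W s. x \<in> W \<and> section_along \<A> M W s \<and> (\<forall>y\<in>W \<inter> M. \<forall>z\<in>tangent_in \<A> M y. g y (s y) z = 0) \<and>
      s x = \<sigma> k x \<and> V = - tan_part \<A> g M x (cov_along \<A> nabla M x X s)" for V
    using that val by blast
qed

end

section \<open>Vertical vectors and the horizontal lifts\<close>

context vec_manifold
begin

text \<open>The matrix on the right has column \<open>i\<close> equal to \<open>b\<close> and zeros
  elsewhere.\<close>

lemma vert_frame_map:
  assumes q: "(x, u) \<in> linear_frames \<A>"
  shows "vert \<A> (x, u) i (frame_map u b) = fundamental \<A> (\<Sum>j\<in>UNIV. (b $ j) *\<^sub>R matE j i) (x, u)"
proof -
  have "inj (frame_map u)" using q by (simp add: linear_frames_def bij_betw_def)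
  then have inv: "inv (frame_map u) (frame_map u b) = b" by simp
  have "fundamental \<A> (\<Sum>j\<in>J. (b $ j) *\<^sub>R matE j i) (x, u) = (\<Sum>j\<in>J. (b $ j) *\<^sub>t fundamental \<A> (matE j i) (x, u))" for J
  proof (induction J rule: infinite_finite_induct)
    case (insert k J)
    then show ?case
      unfolding sum.insert[OF insert.hyps] fundamental_linear(1,2)[OF q] by (simp only:)
  qed (simp_all add: fundamental_linear(3)[OF q])
  then show ?thesis by (simp add: vert_def inv)
qed

lemma fundamental_sum:
  assumes "q \<in> linear_frames \<A>"
  shows "fundamental \<A> (\<Sum>i\<in>A. B i) q = (\<Sum>i\<in>A. fundamental \<A> (B i) q)"
proof (induction A rule: infinite_finite_induct)
  case (insert k A)
  then show ?case
    unfolding sum.insert[OF insert.hyps] fundamental_linear(1)[OF assms] by (simp only:)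
qed (simp_all add: fundamental_linear(3)[OF assms])

lemma fundamental_uminus:
  assumes "q \<in> linear_frames \<A>"
  shows "fundamental \<A> (- B) q = - fundamental \<A> B q"
  using fundamental_linear(2)[OF assms, of "-1" B] by (simp only: scaleR_minus1_left tscale_simps)

lemma vert_uminus:
  assumes "(x, u) \<in> linear_frames \<A>"
  shows "vert \<A> (x, u) i (- frame_map u b) = - vert \<A> (x, u) i (frame_map u b)"
proof -
  have "(\<Sum>j\<in>UNIV. ((- b) $ j) *\<^sub>R matE j i) = - (\<Sum>j\<in>UNIV. (b $ j) *\<^sub>R matE j i)"
    by (simp add: sum_negf)
  then show ?thesis
    by (simp only: frame_map_uminus[symmetric] vert_frame_map[OF assms] fundamental_uminus[OF assms])
qed

text \<open>\<open>A\<close> is split into its columns. If \<open>A\<close> is the matrix of an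
  endomorphism in the frame \<open>u\<close>, the left side is its \<open>endo_bar\<close>, which is
  thus a single fundamental vector.\<close>

lemma sum_vert_columns:
  fixes A :: "real ^ 'm::finite ^ 'm"
  assumes "(x, u) \<in> linear_frames \<A>"
  shows "(\<Sum>i\<in>UNIV. vert \<A> (x, u) i (frame_map u (column i A))) = fundamental \<A> A (x, u)"
proof -
  have "fundamental \<A> A (x, u) = fundamental \<A> (\<Sum>i\<in>UNIV. \<Sum>j\<in>UNIV. (column i A $ j) *\<^sub>R matE j i) (x, u)"
    using matrix_eq_sum_matE[of A] by (simp add: column_def)
  then show ?thesis
    by (simp only: fundamental_sum[OF assms] vert_frame_map[OF assms])
qed

end

lemma connection_formD:
  assumes "connection_form \<A> g \<omega>" "q \<in> orthonormal_frames \<A> g"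
  shows "Z \<in> tangent_in (frame_atlas \<A>) (orthonormal_frames \<A> g) q \<Longrightarrow> transpose (\<omega> q Z) = - \<omega> q Z"
    and "Z \<in> tangent_in (frame_atlas \<A>) (orthonormal_frames \<A> g) q \<Longrightarrow>
      Z' \<in> tangent_in (frame_atlas \<A>) (orthonormal_frames \<A> g) q \<Longrightarrow> \<omega> q (Z + Z') = \<omega> q Z + \<omega> q Z'"
    and "transpose A = - A \<Longrightarrow> \<omega> q (fundamental \<A> A q) = A"
  using assms unfolding connection_form_def by simp_all

theorem proposition3p1:
  fixes \<A> :: "('a, real ^ 'm::finite) chart set"
    and g :: "'a metric" and nabla :: "'a cov" and \<omega> :: "('a, 'm) conn_form"
    and M :: "'a set" and I :: "'m set" and p n :: nat
    and x :: 'a and u :: "'m \<Rightarrow> 'a tvec" and X :: "'a tvec"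
  assumes "CARD('m) = p + n" and "card I = p"
    and "smooth_manifold \<A>" and "riemannian_metric \<A> g"
    and "levi_civita \<A> g nabla" and "connection_form_of \<A> g nabla \<omega>"
    and "submanifold \<A> I M"
    and "(x, u) \<in> adapted_frames \<A> g M I" and "X \<in> tangent_in \<A> M x"
  shows "horizontal_lift \<A> (adapted_frames \<A> g M I) (block_diag_form I \<omega>) (x, u) X
           = horizontal_lift \<A> (orthonormal_frames_over \<A> g M) \<omega> (x, u) X
             + endo_bar \<A> (x, u) (diff_tensor \<A> g nabla M x X)
       \<and> horizontal_lift \<A> (orthonormal_frames_over \<A> g M) \<omega> (x, u) X
             + endo_bar \<A> (x, u) (diff_tensor \<A> g nabla M x X)
           = horizontal_lift \<A> (orthonormal_frames_over \<A> g M) \<omega> (x, u) X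
             + (\<Sum>A\<in>I. vert \<A> (x, u) A (second_fundamental_form \<A> g nabla M x X (u A)))
             - (\<Sum>\<alpha>\<in>- I. vert \<A> (x, u) \<alpha> (weingarten \<A> g nabla M x (u \<alpha>) X))"
proof -
  note metric = assms(4) and X = assms(9)
  have atlas: "smooth_atlas \<A>" using assms(3) by (simp add: smooth_manifold_def)
  have cov: "covariant_derivative \<A> nabla" using assms(5) by (simp add: levi_civita_def)
  have \<omega>: "connection_form \<A> g \<omega>" using assms(6) by (simp add: connection_form_of_def)
  note xM = adapted_framesD(1)[OF assms(8)] and xu = adapted_framesD(6)[OF assms(8)]
  interpret vec_riemannian_manifold \<A> g using atlas metric by unfold_locales
  obtain W \<sigma> where xW: "x \<in> W" and frame: "local_frame \<A> g M I W \<sigma>" and \<sigma>x: "\<And>j. \<sigma> j x = u j"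
    using ex_local_frame[OF assms(7,8)] by metis
  interpret adapted_frame_field \<A> g M W I \<sigma> using frame by unfold_locales
  have X_tangent: "X \<in> tangent_space \<A> x" by (rule subsetD[OF tangent_in_subset_tangent_space X])
  let ?F = "frame_atlas \<A>" and ?q = "sec \<sigma> x" and ?O = "orthonormal_frames \<A> g"
  have q: "?q = (x, u)" by (simp add: \<sigma>x)
  note lift = tangent_frame_section[OF xW]
  define d where "d = differential ?F (sec \<sigma>) x X"
  define B where "B = \<omega> ?q d"
  \<comment> \<open>\<open>D\<close> will turn out to be the matrix of the tensor S in direction
    \<open>X\<close>; the two lifts differ by its fundamental vector.\<close>
  define D where "D = off_diagonal I B"
  have ON: "?q \<in> ?O" by (rule frame_section_orthonormal[OF xW])
  have act: "frame_act R (sec \<sigma> y) \<in> ?O" if "y \<in> W" "transpose R ** R = mat 1" for y R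
    by (rule frame_act_orthonormal[OF frame_section_orthonormal[OF that(1)] that(2)])
  have blockU: "block_diagonal UNIV A" for A :: "real ^ 'm ^ 'm" by (simp add: block_diagonal_def)
  \<comment> \<open>The case of the full bundle: base curves may leave \<open>M\<close>, and the
    block condition for \<open>UNIV\<close> is empty.\<close>
  have tan: "differential ?F (sec \<sigma>) x Y + fundamental \<A> C ?q \<in> tangent_in ?F ?O ?q"
    if "Y \<in> tangent_space \<A> x" "transpose C = - C" for Y C
    by (rule lift(1)[OF that blockU act]; assumption)
  have fund0: "fundamental \<A> 0 ?q = 0" unfolding q by (rule fundamental_linear(3)[OF xu])
  have tr0: "transpose (0 :: real ^ 'm ^ 'm) = - 0" by (simp add: transpose_def vec_eq_iff)
  have d_tan: "d \<in> tangent_in ?F ?O ?q"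
    using tan[OF X_tangent tr0] unfolding fund0 d_def by (simp only: add_0_right)
  \<comment> \<open>The zero base velocity shows that fundamental vectors of skew-symmetric matrices
    are tangent to the orthonormal frame bundle; additivity of \<omega> is given only for vectors
    tangent to it.\<close>
  have "differential ?F (sec \<sigma>) x 0 = 0" by (auto simp: differential_def)
  then have fund_tan: "fundamental \<A> C ?q \<in> tangent_in ?F ?O ?q" if "transpose C = - C" for C
    using tan[OF tangent_space_zero[OF tangent_in_base(2)[OF X_tangent]] that] by (simp only: add_0_left)
  have \<omega>_sum: "\<omega> ?q (d + fundamental \<A> C ?q) = B + C" if "transpose C = - C" for C
    unfolding connection_formD(2)[OF \<omega> ON d_tan fund_tan[OF that]] connection_formD(3)[OF \<omega> ON that] B_def ..
  have B_anti: "transpose B = - B" unfolding B_def by (rule connection_formD(1)[OF \<omega> ON d_tan])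
  note lin = bounded_linear.linear[OF bounded_linear_transpose]
  \<comment> \<open>The pull-back formula for the connection form, with the frame field as local
    section.\<close>
  have nablaB: "nabla x X (\<sigma> j) = (\<Sum>i\<in>UNIV. (B $ i $ j) *\<^sub>t \<sigma> i x)" for j
  proof -
    have "(\<forall>j. smooth_vf \<A> W (\<sigma> j)) \<and> (\<forall>y\<in>W. (y, \<lambda>j. \<sigma> j y) \<in> ?O)"
      using frame_smooth frame_section_orthonormal by blast
    then show ?thesis
      using assms(6) xW X_tangent unfolding connection_form_of_def B_def d_def by simp
  qed
  interpret adapted_frame_at \<A> g M W I \<sigma> nabla x X B
    using xW xM X cov nablaB by unfold_locales
  have lift\<omega>: "horizontal_lift \<A> (orthonormal_frames_over \<A> g M) \<omega> ?q X = d + fundamental \<A> (- B) ?q"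
    unfolding d_def
  proof (rule horizontal_lift_eq[OF xW X,
        where C = "- B" and J = UNIV and \<theta> = \<omega> and Q = "orthonormal_frames_over \<A> g M"])
    show "transpose (- B) = - (- B)" by (simp only: linear_neg[OF lin] B_anti)
    show "orthonormal_frames_over \<A> g M \<subseteq> ?O" by (auto simp: orthonormal_frames_over_def)
    show "frame_act R (sec \<sigma> y) \<in> orthonormal_frames_over \<A> g M"
      if "y \<in> W" "y \<in> M" "transpose R ** R = mat 1" for y R
      using act[OF that(1,3)] that(2) by (auto simp: orthonormal_frames_over_def frame_act_def)
    show "\<omega> ?q (differential ?F (sec \<sigma>) x X + fundamental \<A> C ?q) = 0 \<longleftrightarrow> C = - B"
      if "transpose C = - C" for C
      using \<omega>_sum[OF that] by (auto simp: d_def add_eq_0_iff)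
  qed (auto intro: blockU)
  have D_anti: "transpose D = - D"
  proof -
    have "transpose D $ i $ j = (- D) $ i $ j" for i j
      using arg_cong[OF B_anti, of "\<lambda>A. A $ i $ j"] by (simp add: D_def off_diagonal_def transpose_def)
    then show ?thesis by (simp add: vec_eq_iff)
  qed
  have lift\<omega>': "horizontal_lift \<A> (adapted_frames \<A> g M I) (block_diag_form I \<omega>) ?q X = d + fundamental \<A> (- B + D) ?q"
    unfolding d_def
  proof (rule horizontal_lift_eq[OF xW X,
        where C = "- B + D" and J = I and \<theta> = "block_diag_form I \<omega>" and Q = "adapted_frames \<A> g M I"])
    show "transpose (- B + D) = - (- B + D)"
      by (simp only: linear_add[OF lin] linear_neg[OF lin] B_anti D_anti minus_add_distrib)
    show "block_diagonal I (- B + D)" by (auto simp: block_diagonal_def D_def off_diagonal_def)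
    show "adapted_frames \<A> g M I \<subseteq> ?O" by (auto simp: adapted_frames_def)
    show "frame_act R (sec \<sigma> y) \<in> adapted_frames \<A> g M I"
      if "y \<in> W" "y \<in> M" "transpose R ** R = mat 1" "block_diagonal I R" for y R
      by (rule frame_act_adapted[OF that])
    show "block_diag_form I \<omega> ?q (differential ?F (sec \<sigma>) x X + fundamental \<A> C ?q) = 0 \<longleftrightarrow> C = - B + D"
      if C: "transpose C = - C" "block_diagonal I C" for C
    proof -
      \<comment> \<open>The projected form sees only the diagonal blocks of \<open>B + C\<close>. As
        \<open>C\<close> has no others, its vanishing fixes \<open>C\<close> as minus the diagonal
        blocks of \<open>B\<close>, which is \<open>- B + D\<close>.\<close>
      have "block_diag_form I \<omega> ?q (d + fundamental \<A> C ?q) = 0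
        \<longleftrightarrow> (\<forall>i j. (i \<in> I) = (j \<in> I) \<longrightarrow> B $ i $ j + C $ i $ j = 0)"
        unfolding block_diag_form_def \<omega>_sum[OF C(1)] by (auto simp: vec_eq_iff)
      also have "\<dots> \<longleftrightarrow> (\<forall>i j. C $ i $ j = (- B + D) $ i $ j)"
      proof (intro all_cong1)
        show "((i \<in> I) = (j \<in> I) \<longrightarrow> B $ i $ j + C $ i $ j = 0) \<longleftrightarrow> C $ i $ j = (- B + D) $ i $ j" for i j
          using C(2) by (cases "(i \<in> I) = (j \<in> I)") (auto simp: D_def off_diagonal_def block_diagonal_def)
      qed
      finally show ?thesis by (simp add: d_def vec_eq_iff)
    qed
  qed auto
  have tensor: "diff_tensor \<A> g nabla M x X (u k) = frame_map u (column k D)" for k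
    using diff_tensor_frame[of k] by (simp only: \<sigma>x D_def)
  have form: "second_fundamental_form \<A> g nabla M x X (u k) = frame_map u (column k D)" if "k \<in> I" for k
    using second_fundamental_form_frame[OF that] by (simp only: \<sigma>x D_def)
  have weing: "weingarten \<A> g nabla M x (u k) X = - frame_map u (column k D)" if "k \<in> - I" for k
    using weingarten_frame[of k] that by (simp only: \<sigma>x D_def Compl_iff not_False_eq_True)
  let ?v = "\<lambda>i. vert \<A> (x, u) i (frame_map u (column i D))"
  have bar: "endo_bar \<A> (x, u) (diff_tensor \<A> g nabla M x X) = (\<Sum>i\<in>UNIV. ?v i)"
    by (simp only: endo_bar_def snd_conv tensor)
  \<comment> \<open>Linearity splits off the fundamental vector of \<open>D\<close>, which is then
    written column by column.\<close>
  have "d + fundamental \<A> (- B + D) (x, u) = d + fundamental \<A> (- B) (x, u) + (\<Sum>i\<in>UNIV. ?v i)"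
    by (simp only: fundamental_linear(1)[OF xu] sum_vert_columns[OF xu] add.assoc)
  moreover have "(\<Sum>i\<in>UNIV. ?v i) = (\<Sum>A\<in>I. vert \<A> (x, u) A (second_fundamental_form \<A> g nabla M x X (u A)))
      - (\<Sum>\<alpha>\<in>- I. vert \<A> (x, u) \<alpha> (weingarten \<A> g nabla M x (u \<alpha>) X))"
  proof -
    \<comment> \<open>The Weingarten operator carries a minus sign, so subtracting it restores the
      columns of \<open>D\<close> outside \<open>I\<close>.\<close>
    have "(\<Sum>\<alpha>\<in>- I. vert \<A> (x, u) \<alpha> (weingarten \<A> g nabla M x (u \<alpha>) X)) = (\<Sum>\<alpha>\<in>- I. - ?v \<alpha>)"
      by (rule sum.cong[OF refl]) (simp only: weing vert_uminus[OF xu])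
    moreover have "(\<Sum>A\<in>I. vert \<A> (x, u) A (second_fundamental_form \<A> g nabla M x X (u A))) = (\<Sum>A\<in>I. ?v A)"
      by (rule sum.cong[OF refl]) (simp only: form)
    moreover have "(\<Sum>i\<in>UNIV. ?v i) = (\<Sum>A\<in>I. ?v A) + (\<Sum>\<alpha>\<in>- I. ?v \<alpha>)"
      using sum.union_disjoint[of I "- I" ?v] by (simp only: finite Compl_disjoint Compl_partition)
    ultimately show ?thesis by (simp only: sum_negf diff_minus_eq_add)
  qed
  ultimately show ?thesis
    using lift\<omega> lift\<omega>' unfolding q bar by (simp only: add_diff_eq) 
qed

end
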